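(* Let $r\geq 3$, $k_1\geq k_2\geq\cdots\geq k_r\geq t+2$ and $n\geq 5-k_1+2k_1\log_2 k_1$. If $\mathcal{F}_1\subseteq\Pi(n,k_1),\ldots,\mathcal{F}_r\subseteq\Pi(n,k_r)$ are non-trivial $r$-cross $t$-intersecting, then $$\prod_{i=1}^r|\mathcal{F}_i|\leq\Big((t+1)S(n-t,k_r-t)-t\,S(n-t-1,k_r-t-1)\Big)\prod_{i=1}^{r-1}S(n-t-1,k_i-t-1).$$ If equality holds, then there are $a\in[r]$ with $k_a=k_r$ and a partition $T$ consisting of $t+1$ singletons such that $\mathcal{F}_a=\{F\in\Pi(n,k_a):|T\cap F|\geq t\}$ and $\mathcal{F}_i=\{F\in\Pi(n,k_i):T\subseteq F\}$ for each $i\in[r]\setminus\{a\}$.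
   Context: All letters denote positive integers. $[n]=\{1,\ldots,n\}$. A partition is a set of pairwise disjoint nonempty sets (blocks). $\Pi(n,k)$ is the set of all partitions of $[n]$ into $k$ blocks; $S(n,k)=|\Pi(n,k)|$ (Stirling number of the second kind), with $S(n,a)=0$ for $a\leq 0$. For partitions $F,G$, $F\cap G$ is the set of common blocks. Families $\mathcal{F}_i\subseteq\Pi(n,k_i)$, $i\in[r]$, are $r$-cross $t$-intersecting if $|F_1\cap\cdots\cap F_r|\geq t$ for all $F_i\in\mathcal{F}_i$; they are non-trivial if the set of blocks belonging to every member of every $\mathcal{F}_i$ has fewer than $t$ elements. *)

theory Defs
  imports Complex_Main "HOL-Library.Disjoint_Sets" "HOL-Combinatorics.Stirling"
begin

definition Pi_part :: "nat \<Rightarrow> nat \<Rightarrow> nat set set set" where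
  "Pi_part n k = {P. partition_on {1..n} P \<and> card P = k}"

definition cross_t_intersecting ::
  "nat \<Rightarrow> nat \<Rightarrow> (nat \<Rightarrow> nat set set set) \<Rightarrow> bool" where
  "cross_t_intersecting r t F \<longleftrightarrow>
     (\<forall>G. (\<forall>i\<in>{1..r}. G i \<in> F i) \<longrightarrow> card (\<Inter>i\<in>{1..r}. G i) \<ge> t)"

definition common_blocks :: "nat \<Rightarrow> (nat \<Rightarrow> nat set set set) \<Rightarrow> nat set set" where
  "common_blocks r F = {B. \<forall>i\<in>{1..r}. \<forall>G\<in>F i. B \<in> G}"

definition non_trivial :: "nat \<Rightarrow> nat \<Rightarrow> (nat \<Rightarrow> nat set set set) \<Rightarrow> bool" where
  "non_trivial r t F \<longleftrightarrow> card (common_blocks r F) < t"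

end

theory Submission
  imports Defs "HOL-Analysis.Harmonic_Numbers"
begin

text \<open>
  A partition in \<open>Pi_part n k\<close> containing \<open>j\<close> prescribed blocks can be chosen in at most \<open>S(n - j, k - j)\<close>
  ways, and the lower bound on \<open>n\<close> makes these numbers drop by a factor of at least \<open>2 K\<^sup>2\<close>,
  \<open>K = k 1\<close>, with every further block. Hence branching over covers, which costs a factor \<open>K\<close> per
  block, shows that families all of whose cross intersections have size at least \<open>h\<close> have product at
  most \<open>\<Prod>i. S(n - h, k i - h)\<close>.

  For an index \<open>a\<close> consider the traces, that is, the intersections of one member of each \<open>F i\<close> with
  \<open>i \<noteq> a\<close>. If every index has a trace of size \<open>t\<close>, nontriviality forces all cover numbers to be at
  least \<open>t + 2\<close>, and the product is too small. Otherwise some index \<open>a\<close> has only traces of size at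
  least \<open>t + 1\<close>: then the other families are cross \<open>(t + 1)\<close>-intersecting, while every member of \<open>F a\<close>
  contains \<open>t\<close> blocks of a smallest trace. A trace of size \<open>t + 1\<close> gives the extremal configuration, a
  larger one loses more in the other families than it gains in \<open>F a\<close>. Log-concavity of \<open>l S(m, l)\<close>
  shows that the smallest \<open>k a\<close> is the best choice. The estimates degenerate for \<open>k i = t + 2\<close>, where
  \<open>t + 1\<close> blocks already determine the partition; there block sizes and pairwise traces are examined
  directly.
\<close>

section \<open>Stirling numbers of the second kind\<close>

text \<open>The factor \<open>2 * K^2\<close> is sized by its use. Coming down from a cover of size
  \<open>h + e\<close> to \<open>h\<close> blocks costs at most \<open>K^e\<close> for choosing
  \<open>h\<close> blocks of the cover and \<open>K^e\<close> for branching. The remaining 2 pays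
  for the overlap of the \<open>t + 1\<close> stars in the extremal family, that is, for comparing
  \<open>(t + 1) * S(n - t, k - t)\<close> with the slightly smaller \<open>top_bound\<close>. The
  obstacle is \<open>k i = t + 2\<close>. The bound on a star is then 1 from \<open>t + 1\<close>
  blocks on, further blocks gain nothing, and polynomial factors survive that would spoil a sharp
  bound. Many are paid for by \<open>S(n - t, 2)\<close>, which is exponential in \<open>n\<close>
  and at least \<open>K^6 - 1\<close>: if the distinguished index \<open>a\<close> has
  \<open>k a = t + 2\<close>, a bound of \<open>2 * K^5\<close> in place of
  \<open>S(n - t, 2)\<close> is harmless. What cannot be paid for in this way is the factor
  \<open>t + 2\<close> when \<open>F a\<close> is itself large. Then either the other families with
  \<open>k i = t + 2\<close> are single partitions, or two members of one of them pin down so many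
  common blocks that the remaining families shrink.\<close>

lemma Stirling_rec: "n > 0 \<Longrightarrow> k > 0 \<Longrightarrow> Stirling n k = k * Stirling (n - 1) k + Stirling (n - 1) (k - 1)"
  by (cases n; cases k) auto

lemma Stirling_pos: "1 \<le> k \<Longrightarrow> k \<le> n \<Longrightarrow> Stirling n k > 0"
proof (induction n arbitrary: k)
  case (Suc n)
  then show ?case
    by (cases k; cases "k = Suc n") (auto simp: not_le)
qed simp

lemma Stirling_mono_left: "m \<le> n \<Longrightarrow> 1 \<le> k \<Longrightarrow> Stirling m k \<le> Stirling n k"
proof (induction n rule: dec_induct)
  case (step n)
  then show ?case by (cases k) auto
qed simp

lemma Stirling_one: "n \<ge> 1 \<Longrightarrow> Stirling n 1 = 1"
  using Stirling_1[of "n - 1"] by simp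

lemma Stirling_two: "n \<ge> 1 \<Longrightarrow> Stirling n 2 = 2 ^ (n - 1) - 1"
  using Stirling_2[of "n - 1"] by (simp add: numeral_2_eq_2)

text \<open>Sorts the maps from an \<open>m\<close>-set to an \<open>l\<close>-set by their image of
  size \<open>j\<close>. In the proof \<open>g j\<close> is the falling factorial of
  \<open>l\<close>, and the induction rests on \<open>l * g j = g (j + 1) + j * g j\<close>.\<close>

lemma power_eq_sum_Stirling: "l ^ m = (\<Sum>j\<le>l. (l choose j) * fact j * Stirling m j)"
proof (induction m)
  case 0
  have "(\<Sum>j\<le>l. (l choose j) * fact j * Stirling 0 j) = (\<Sum>j\<in>{0}. (l choose j) * fact j * Stirling 0 j)"
    by (rule sum.mono_neutral_right) (auto simp: gr0_conv_Suc)
  then show ?case by simp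
next
  case (Suc m)
  define g where "g j = (l choose j) * fact j" for j :: nat
  have g: "l * g j = g (Suc j) + j * g j" if "j \<le> l" for j
  proof -
    have "Suc j * (l choose Suc j) = (l - j) * (l choose j)"
      using binomial_absorb_comp[of l j] binomial_absorption[of j l] by simp
    hence "g (Suc j) = (l - j) * g j"
      unfolding g_def fact_Suc of_nat_id by (metis mult.assoc mult.commute)
    thus ?thesis using that by (metis add_mult_distrib le_add_diff_inverse2)
  qed
  have "(\<Sum>j\<le>l. g j * Stirling (Suc m) j) = (\<Sum>j\<le>l. g j * (j * Stirling m j)) + (\<Sum>j<l. g (Suc j) * Stirling m j)"
  proof (cases l)
    case [simp]: (Suc p)
    have "(\<Sum>j\<le>l. g j * Stirling (Suc m) j) = (\<Sum>j\<le>p. g (Suc j) * Stirling (Suc m) (Suc j))"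
      unfolding Suc by (subst sum.atMost_Suc_shift) (simp add: g_def)
    also have "\<dots> = (\<Sum>j\<le>p. g (Suc j) * (Suc j * Stirling m (Suc j))) + (\<Sum>j\<le>p. g (Suc j) * Stirling m j)"
      by (simp add: algebra_simps sum.distrib)
    also have "(\<Sum>j\<le>p. g (Suc j) * (Suc j * Stirling m (Suc j))) = (\<Sum>j\<le>l. g j * (j * Stirling m j))"
      unfolding Suc by (subst sum.atMost_Suc_shift) simp
    finally show ?thesis by (simp add: lessThan_Suc_atMost)
  qed simp
  also have "(\<Sum>j<l. g (Suc j) * Stirling m j) = (\<Sum>j\<le>l. g (Suc j) * Stirling m j)"
    by (rule sum.mono_neutral_left) (auto simp: g_def not_less)
  also have "(\<Sum>j\<le>l. g j * (j * Stirling m j)) + \<dots> = (\<Sum>j\<le>l. l * g j * Stirling m j)"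
    unfolding sum.distrib[symmetric] by (intro sum.cong refl) (simp add: g algebra_simps)
  also have "\<dots> = l * l ^ m"
    unfolding Suc.IH g_def sum_distrib_left by (simp add: mult.assoc)
  finally show ?case by (simp add: g_def)
qed

lemma fact_Stirling_le_power: "fact l * Stirling m l \<le> l ^ m"
  unfolding power_eq_sum_Stirling using member_le_sum[of l "{..l}" "\<lambda>j. (l choose j) * fact j * Stirling m j"]
  by simp

text \<open>A map that is not surjective omits one of the \<open>l\<close> values, so there are at
  most \<open>l * (l - 1) ^ m\<close> of them. On the level of sums this is
  \<open>(l choose j) <= l * (l - 1 choose j)\<close> for \<open>j < l\<close>.\<close>

lemma power_le_fact_Stirling: "l ^ m \<le> fact l * Stirling m l + l * (l - 1) ^ m"
proof (cases l)
  case [simp]: (Suc p)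
  have "(l choose j) \<le> l * (p choose j)" if "j \<le> p" for j
  proof -
    have "(l - j) * (l choose j) = l * (p choose j)"
      using binomial_absorb_comp[of l j] by simp
    moreover have "1 * (l choose j) \<le> (l - j) * (l choose j)"
      using that by (intro mult_right_mono) auto
    ultimately show ?thesis by simp
  qed
  hence "(\<Sum>j\<le>p. (l choose j) * fact j * Stirling m j) \<le> (\<Sum>j\<le>p. l * (p choose j) * fact j * Stirling m j)"
    by (intro sum_mono mult_right_mono) auto
  also have "\<dots> = l * p ^ m"
    unfolding power_eq_sum_Stirling sum_distrib_left by (simp only: mult.assoc)
  finally have *: "(\<Sum>j\<le>p. (l choose j) * fact j * Stirling m j) \<le> l * p ^ m" .
  have "l ^ m = (\<Sum>j\<le>p. (l choose j) * fact j * Stirling m j) + fact l * Stirling m l"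
    by (subst power_eq_sum_Stirling) (simp add: Suc)
  thus ?thesis using * by simp
qed (cases m; simp)

text \<open>The factor \<open>(l + 1) / l\<close> is what makes the inequality reproduce itself under the recurrence.\<close>

lemma Stirling_log_concave:
  "1 \<le> l \<Longrightarrow> l \<le> m \<Longrightarrow>
    real (l + 1) * real (Stirling m (l + 1)) * real (Stirling m (l - 1)) < real l * (real (Stirling m l))\<^sup>2"
proof (induction m arbitrary: l)
  case (Suc m)
  \<comment> \<open>Weakened to \<open><=\<close>, the hypothesis holds for every \<open>l\<close>:
    for \<open>l = 0\<close> and for \<open>l > m\<close> both sides are 0.\<close>
  have IH: "real (l + 1) * real (Stirling m (l + 1)) * real (Stirling m (l - 1)) \<le> real l * (real (Stirling m l))\<^sup>2" for l
    using Suc.IH[of l] by (cases "l = 0"; cases "l \<le> m"; cases m) auto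
  consider "l = 1" | p where "l = p + 2"
    using Suc.prems by (metis One_nat_def Suc_eq_plus1 add_2_eq_Suc' not0_implies_Suc not_one_le_zero)
  then show ?case
  proof cases
    case 1
    then show ?thesis by (simp add: Stirling_one del: Stirling.simps(4))
  next
    case 2
    define a b c d where "a = real (Stirling m p)" "b = real (Stirling m (p + 1))"
      "c = real (Stirling m (p + 2))" "d = real (Stirling m (p + 3))"
    define x where "x = real l"
    have "b > 0" using Stirling_pos[of "p + 1" m] Suc.prems 2 by (simp add: a_b_c_d_def)
    hence nn: "a \<ge> 0" "b > 0" "c \<ge> 0" "d \<ge> 0" "x \<ge> 2" by (auto simp: a_b_c_d_def x_def 2)
    have IH1: "(x + 1) * d * b \<le> x * c\<^sup>2" using IH[of "p + 2"]
      by (simp add: a_b_c_d_def x_def 2 eval_nat_numeral algebra_simps)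
    have IH2: "x * c * a \<le> (x - 1) * b\<^sup>2" using IH[of "p + 1"]
      by (simp add: a_b_c_d_def x_def 2 eval_nat_numeral algebra_simps)
    \<comment> \<open>The product of the two neighbouring hypotheses, divided by
      \<open>x * (c * b)\<close>. For \<open>c = 0\<close> this division fails, but then
      \<open>d = 0\<close> as well.\<close>
    have IH12: "(x + 1) * (d * a) \<le> (x - 1) * (c * b)"
    proof (cases "c = 0")
      case True
      then have "m < p + 2" using Stirling_pos[of "p + 2" m] by (force simp: a_b_c_d_def)
      then show ?thesis using True by (simp add: a_b_c_d_def)
    next
      case False
      hence pos: "x * (c * b) > 0" using nn by (simp add: mult_pos_pos order_less_le)
      have "((x + 1) * d * b) * (x * c * a) \<le> (x * c\<^sup>2) * ((x - 1) * b\<^sup>2)"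
        by (rule mult_mono[OF IH1 IH2]) (use nn in auto)
      hence "(x * (c * b)) * ((x + 1) * (d * a)) \<le> (x * (c * b)) * ((x - 1) * (c * b))"
        by (simp add: algebra_simps power2_eq_square)
      thus ?thesis using pos by (simp only: mult_le_cancel_left_pos)
    qed
    have S: "real (Stirling (Suc m) (l + 1)) = (x + 1) * d + c" "real (Stirling (Suc m) l) = x * c + b"
      "real (Stirling (Suc m) (l - 1)) = (x - 1) * b + a"
      by (simp_all add: a_b_c_d_def x_def 2 eval_nat_numeral algebra_simps)
    have IH2': "(x + 1) * (c * a) < x * b\<^sup>2"
    proof -
      have "x * ((x + 1) * (c * a)) \<le> (x + 1) * ((x - 1) * b\<^sup>2)"
        using mult_left_mono[OF IH2, of "x + 1"] nn by (simp add: algebra_simps)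
      also have "\<dots> < x * (x * b\<^sup>2)" using nn by (simp add: algebra_simps)
      finally show ?thesis using nn by simp
    qed
    have "(x + 1) * ((x + 1) * d + c) * ((x - 1) * b + a)
       = (x + 1) * (x - 1) * ((x + 1) * d * b) + (x + 1) * ((x + 1) * (d * a)) + (x + 1) * (x - 1) * (c * b) + (x + 1) * (c * a)"
      by (simp add: algebra_simps)
    \<comment> \<open>Strictness comes from the last summand alone, where \<open>b > 0\<close>
      enters through \<open>IH2'\<close>.\<close>
    also have "\<dots> < (x + 1) * (x - 1) * (x * c\<^sup>2) + (x + 1) * ((x - 1) * (c * b)) + (x + 1) * (x - 1) * (c * b) + x * b\<^sup>2"
      using nn IH1 IH12 IH2' by (intro add_le_less_mono add_mono mult_left_mono) auto
    also have "\<dots> \<le> x * (x * c + b)\<^sup>2"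
    proof -
      have "x * (x * c + b)\<^sup>2 - ((x + 1) * (x - 1) * (x * c\<^sup>2) + (x + 1) * ((x - 1) * (c * b)) + (x + 1) * (x - 1) * (c * b) + x * b\<^sup>2)
        = x * c\<^sup>2 + 2 * (c * b)" by (simp add: algebra_simps power2_eq_square power3_eq_cube)
      moreover have "x * c\<^sup>2 + 2 * (c * b) \<ge> 0" using nn by simp
      ultimately show ?thesis by linarith
    qed
    finally show ?thesis unfolding S by (simp add: x_def add.commute)
  qed
qed simp

text \<open>Cross-multiplied form of the fact that \<open>l * S(m, l) / S(m, l - 1)\<close>
  decreases in \<open>l\<close>. Log-concavity compares consecutive values, and the induction chains
  these comparisons.\<close>

lemma Stirling_ratio_decreasing:
  assumes "1 \<le> p" "p < q" "q \<le> m"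
  shows "q * Stirling m q * Stirling m (p - 1) < p * Stirling m p * Stirling m (q - 1)"
proof -
  have "Suc p \<le> q" using assms by simp
  hence "q \<le> m \<Longrightarrow> real q * real (Stirling m q) * real (Stirling m (p - 1)) < real p * real (Stirling m p) * real (Stirling m (q - 1))"
  proof (induction q rule: dec_induct)
    case base
    then show ?case using Stirling_log_concave[of p m] assms by (simp add: power2_eq_square mult.assoc add.commute)
  next
    case (step q)
    define a b c where "a = real (Stirling m (q - 1))" "b = real (Stirling m q)" "c = real (Stirling m (Suc q))"
    have pos: "a > 0" "b > 0" using step assms by (auto simp: a_b_c_def Stirling_pos)
    have 1: "real (Suc q) * c * a \<le> real q * b\<^sup>2"
      using Stirling_log_concave[of q m] step assms by (simp add: a_b_c_def)
    have "a * (real (Suc q) * c * real (Stirling m (p - 1))) \<le> real q * b\<^sup>2 * real (Stirling m (p - 1))"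
      using mult_right_mono[OF 1, of "real (Stirling m (p - 1))"] by (simp add: algebra_simps)
    also have "\<dots> = b * (real q * b * real (Stirling m (p - 1)))"
      by (simp add: power2_eq_square)
    also have "\<dots> < b * (real p * real (Stirling m p) * a)"
      using step pos by (intro mult_strict_left_mono) (auto simp: a_b_c_def)
    also have "\<dots> = a * (real p * real (Stirling m p) * b)" by simp
    finally show ?case using pos by (simp add: a_b_c_def)
  qed
  thus ?thesis using assms by (simp flip: of_nat_mult)
qed

text \<open>Containing all \<open>k\<close> blocks still leaves one partition, so the value at \<open>j = k\<close> is \<open>1\<close> and not
  \<open>S(n - k, 0) = 0\<close>.\<close>

definition star_bound :: "nat \<Rightarrow> nat \<Rightarrow> nat \<Rightarrow> nat" where
  "star_bound n k j = (if j < k then Stirling (n - j) (k - j) else 1)"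

section \<open>Numerical consequences of the lower bound on \<open>n\<close>\<close>

locale large_ground =
  fixes n K :: nat
  assumes K_ge_3: "K \<ge> 3"
    and n_ge: "real n \<ge> 5 - real K + 2 * real K * log 2 (real K)"
begin

lemma log_K_ge: "log 2 (real K) \<ge> 3 / 2"
proof -
  have "3 = log 2 (2 ^ 3 :: real)" by (subst log_nat_power) auto
  also have "\<dots> \<le> log 2 (real K ^ 2)"
    using power_mono[of 3 "real K" 2] K_ge_3 by (subst log_le_cancel_iff) auto
  also have "\<dots> = 2 * log 2 (real K)" using K_ge_3 by (subst log_nat_power) auto
  finally show ?thesis by simp
qed

lemma n_ge_2K: "n \<ge> 2 * K + 5"
proof -
  have "2 * real K * (3/2) \<le> 2 * real K * log 2 (real K)"
    using log_K_ge by (intro mult_left_mono) auto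
  hence "real n \<ge> real (2 * K + 5)" using n_ge by simp
  thus ?thesis by linarith
qed

text \<open>The hypothesis uses \<open>log 2\<close>; passing to \<open>ln\<close> gains the factor
  \<open>1 / ln 2 >= 36/25\<close>. This surplus lifts the exponent to \<open>2 * ln K + 1\<close>.
  Finally \<open>exp 1 >= (4/3)^3 = 64/27 > 7/3\<close>, and \<open>3 * K <= K^2\<close> turns
  \<open>7/3 * K^2\<close> into \<open>2 * K^2 + K\<close>.\<close>

lemma exp_ground_ge: "exp (real (n - 1) / real K) \<ge> 2 * real K ^ 2 + real K"
proof -
  define x where "x = real K"
  have x: "x \<ge> 3" using K_ge_3 by (simp add: x_def)
  have ln2: "ln 2 \<le> (25/36::real)" "ln 2 \<ge> (2/3::real)" "ln 2 > (0::real)"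
    by (fact ln2_le_25_over_36, fact ln2_ge_two_thirds, simp)
  have lnx: "ln x \<ge> 0" using x by simp
  have "real (n - 1) / x \<ge> (4 - x + 2 * x * log 2 x) / x"
    using n_ge n_ge_2K x by (intro divide_right_mono) (auto simp: x_def of_nat_diff)
  also have "(4 - x + 2 * x * log 2 x) / x = 4 / x - 1 + 2 * log 2 x"
    using x by (simp add: field_simps)
  finally have 1: "real (n - 1) / x \<ge> 4 / x - 1 + 2 * log 2 x" .
  have "log 2 x \<ge> 36/25 * ln x"
  proof -
    have "36/25 * ln x * ln 2 \<le> 36/25 * ln x * (25/36)"
      using ln2 lnx by (intro mult_left_mono) auto
    thus ?thesis using ln2 by (simp add: log_def field_simps)
  qed
  hence 2: "2 * log 2 x \<ge> 2 * ln x + 22/25 * ln x" by simp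
  \<comment> \<open>The tangent at 4 bounds \<open>ln x\<close> below by \<open>7/3 - 4 / x\<close>;
    the loss \<open>4 / x\<close> is made up by the same term in the bound on
    \<open>n\<close>.\<close>
  have "ln (4 / x) \<le> 4 / x - 1" using x by (intro ln_le_minus_one) auto
  moreover have "ln (4 / x) = 2 * ln 2 - ln x"
    using x ln_mult[of 2 "2::real"] by (simp add: ln_div)
  ultimately have 3: "ln x \<ge> 4/3 + 1 - 4 / x" using ln2 by simp
  have "4 / x \<ge> 0" using x by simp
  hence "4 / x - 1 + 22/25 * ln x \<ge> 1" using 3 by linarith
  hence "real (n - 1) / x \<ge> 2 * ln x + 1" using 1 2 by linarith
  hence "exp (2 * ln x + 1) \<le> exp (real (n - 1) / x)" by simp
  moreover have "exp (2 * ln x + 1) = x\<^sup>2 * exp 1"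
    using x exp_of_nat_mult[of 2 "ln x"] by (simp add: exp_add)
  moreover have "x\<^sup>2 * (64/27) \<le> x\<^sup>2 * exp 1"
    using exp_ge_one_plus_x_over_n_power_n[of 3 1] by (intro mult_left_mono) (auto simp: power_divide)
  moreover have "3 * x \<le> x\<^sup>2" using x by (simp add: power2_eq_square)
  moreover have "0 \<le> x\<^sup>2" by simp
  ultimately have "2 * x\<^sup>2 + x \<le> exp (real (n - 1) / x)" by linarith
  thus ?thesis by (simp only: x_def)
qed

text \<open>The ratio is at least \<open>(l / (l - 1)) ^ m - l + 1\<close> by inclusion-exclusion for surjections, and
  \<open>l / (l - 1) \<ge> exp (1 / l)\<close>.\<close>

lemma Stirling_ratio_ge:
  assumes "j + 2 \<le> k" "k \<le> K"
  shows "2 * K ^ 2 * Stirling (n - j - 1) (k - j - 1) \<le> Stirling (n - j) (k - j)"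
proof -
  define m l where "m = n - j - 1" "l = k - j"
  have l: "l \<ge> 2" "l \<le> K" and jn: "j + 1 < n" using assms n_ge_2K by (auto simp: m_l_def)
  define A B where "A = real (Stirling m (l - 1))" "B = real (Stirling m l)"
  have fl: "fact l = l * fact (l - 1 :: nat)" using l by (simp add: fact_reduce)
  have "real l ^ m \<le> real (fact l * Stirling m l + l * (l - 1) ^ m)"
    using power_le_fact_Stirling[of l m] by (metis of_nat_le_iff of_nat_power)
  hence up: "real l ^ m \<le> fact (l - 1) * (real l * B) + real l * real (l - 1) ^ m"
    by (simp add: A_B_def fl mult_ac)
  have lo: "fact (l - 1) * A \<le> real (l - 1) ^ m"
    using fact_Stirling_le_power[of "l - 1" m] unfolding A_B_def by (metis of_nat_le_iff of_nat_power of_nat_mult of_nat_fact)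
  define q where "q = real l / real (l - 1)"
  have "exp (1 / real l) \<le> q"
  proof -
    have "1 - 1 / real l \<le> exp (- (1 / real l))" using exp_ge_add_one_self[of "- (1 / real l)"] by simp
    hence "(1 - 1 / real l) * exp (1 / real l) \<le> exp (- (1 / real l)) * exp (1 / real l)"
      by (intro mult_right_mono) auto
    hence "(1 - 1 / real l) * exp (1 / real l) \<le> 1" by (simp flip: exp_add)
    moreover have "1 - 1 / real l = inverse q" using l by (simp add: q_def field_simps of_nat_diff)
    ultimately show ?thesis using l by (simp add: q_def field_simps)
  qed
  hence "exp (1 / real l) ^ m \<le> q ^ m" by (intro power_mono) auto
  moreover have "exp (1 / real l) ^ m = exp (real m / real l)"
    by (simp flip: exp_of_nat_mult)
  \<comment> \<open>Taking \<open>j\<close> off both parts of a fraction that is at least 1 does not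
    decrease it: \<open>m = n - 1 - j\<close> and \<open>l <= K - j\<close>.\<close>
  moreover have "real m / real l \<ge> real (n - 1) / real K"
  proof -
    have "real (n - 1) * real l \<le> real m * real K"
    proof -
      have "real (n - 1) * real l \<le> real (n - 1) * (real K - real j)"
        using assms by (intro mult_left_mono) (auto simp: m_l_def of_nat_diff)
      also have "\<dots> = real (n - 1) * real K - real (n - 1) * real j" by (simp add: algebra_simps)
      also have "\<dots> \<le> real (n - 1) * real K - real K * real j"
        using n_ge_2K by (intro diff_left_mono mult_right_mono) (auto simp: of_nat_diff)
      also have "\<dots> = real m * real K" using jn by (simp add: m_l_def of_nat_diff algebra_simps)
      finally show ?thesis .
    qed
    thus ?thesis using l K_ge_3 by (simp add: field_simps)
  qed
  hence "exp (real m / real l) \<ge> exp (real (n - 1) / real K)" by simp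
  ultimately have q: "q ^ m \<ge> 2 * real K ^ 2 + real K" using exp_ground_ge by linarith
  have "(2 * real K ^ 2 + real K - real l) * (fact (l - 1) * A) \<le> (q ^ m - real l) * real (l - 1) ^ m"
  proof (rule mult_mono[OF _ lo])
    have "2 * real K ^ 2 \<ge> 0" "real l \<le> real K" using l by auto
    thus "0 \<le> q ^ m - real l" using q by linarith
  qed (use q in \<open>auto simp: A_B_def\<close>)
  also have "\<dots> = real l ^ m - real l * real (l - 1) ^ m"
    using l by (simp add: q_def power_divide left_diff_distrib)
  also have "\<dots> \<le> fact (l - 1) * (real l * B)" using up by simp
  finally have "fact (l - 1) * ((2 * real K ^ 2 + real K - real l) * A) \<le> fact (l - 1) * (real l * B)"
    by (simp add: algebra_simps)
  hence "(2 * real K ^ 2 + real K - real l) * A \<le> real l * B"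
    by simp
  moreover have "2 * real K ^ 2 * A \<le> (2 * real K ^ 2 + real K - real l) * A"
    using l by (intro mult_right_mono) (auto simp: A_B_def)
  ultimately have "2 * real K ^ 2 * A \<le> real l * B" by linarith
  also have "\<dots> \<le> real (Stirling (Suc m) l)"
    using l by (cases l) (auto simp: A_B_def algebra_simps)
  also have "Suc m = n - j" using jn by (simp add: m_l_def)
  finally have "real (2 * K ^ 2 * Stirling m (l - 1)) \<le> real (Stirling (n - j) l)"
    by (simp add: A_B_def)
  thus ?thesis unfolding of_nat_le_iff m_l_def .
qed

text \<open>The Stirling number is \<open>2^(n - k + 1) - 1\<close>. With
  \<open>L = log 2 K\<close>, the bound on \<open>n\<close> gives
  \<open>n - K + 1 - 6 * L >= (2 * K - 6) * (L - 1) >= 0\<close>, which is tight at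
  \<open>K = 3\<close>; this is where the sixth power comes from.\<close>

lemma Stirling_two_ge:
  assumes "2 \<le> k" "k \<le> K"
  shows "K ^ 6 \<le> Stirling (n - (k - 2)) 2 + 1"
proof -
  define L where "L = log 2 (real K)"
  have "real K = 2 powr L" using K_ge_3 by (simp add: L_def)
  hence "real K ^ 6 = 2 powr (6 * L)" by (simp add: powr_power)
  also have "\<dots> \<le> 2 powr (real (n - K + 1))"
  proof -
    have "(2 * real K - 6) * 1 \<le> (2 * real K - 6) * L"
      using log_K_ge K_ge_3 by (intro mult_left_mono) (auto simp: L_def)
    hence "6 * L \<le> 6 - 2 * real K + 2 * real K * L" by (simp add: algebra_simps)
    thus ?thesis using n_ge n_ge_2K by (simp add: L_def of_nat_diff)
  qed
  also have "\<dots> = 2 ^ (n - K + 1)" by (simp only: powr_realpow)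
  also have "\<dots> \<le> 2 ^ (n - k + 1)" using assms by (intro power_increasing) auto
  finally have "K ^ 6 \<le> 2 ^ (n - k + 1)"
    by (metis of_nat_le_iff of_nat_numeral of_nat_power)
  moreover have "Stirling (n - (k - 2)) 2 = 2 ^ (n - k + 1) - 1"
    using assms n_ge_2K by (subst Stirling_two) (auto simp: Suc_diff_le)
  ultimately show ?thesis by simp
qed

text \<open>Says that an index with \<open>k - t = 2\<close> is a far better base than one with
  \<open>k - t >= 3\<close>. Log-concavity reduces the claim to \<open>k - t = 3\<close>, where it
  compares \<open>3^m / 2\<close> with about \<open>4^m\<close>, and
  \<open>(4/3)^m >= K^3\<close>.\<close>

lemma Stirling_two_dominates:
  assumes "1 \<le> t" "t + 3 \<le> k" "k \<le> K"
  shows "K ^ 3 * Stirling (n - t) (k - t) \<le> 2 * Stirling (n - t) 2 * Stirling (n - t - 1) (k - t - 1)"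
proof -
  define m l where "m = n - t - 1" "l = k - t"
  have l: "l \<ge> 3" "l \<le> m" and m: "n - t = Suc m" "m \<ge> 3" using assms n_ge_2K by (auto simp: m_l_def)
  define L where "L = log 2 (real K)"
  have K4: "K \<ge> 4" using assms by simp
  have L2: "L \<ge> 2"
  proof -
    have "2 = log 2 (2 ^ 2 :: real)" by (subst log_nat_power) auto
    also have "\<dots> \<le> L" unfolding L_def using K4 by (subst log_le_cancel_iff) auto
    finally show ?thesis .
  qed
  have KL: "real K = 2 powr L" using K_ge_3 by (simp add: L_def)
  have "real K ^ 3 \<le> (4/3) ^ m"
  proof -
    have "real m \<ge> 7 - 2 * real K + 2 * real K * L"
      using n_ge assms n_ge_2K by (simp add: L_def m_l_def of_nat_diff)
    moreover have "2 * real K * (L - 1) \<ge> 8 * (L - 1)"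
      using K4 L2 by (intro mult_right_mono) auto
    ultimately have mL: "3 * L \<le> 2 / 5 * real m" using L2 by (simp add: algebra_simps)
    have "real K ^ 3 = 2 powr (3 * L)" by (simp add: KL powr_power)
    also have "\<dots> \<le> 2 powr (2 / 5 * real m)" using mL by simp
    also have "\<dots> = (2 powr (2/5)) powr real m" by (simp add: powr_powr)
    \<comment> \<open>The exponent \<open>2/5\<close> works because
      \<open>4 * 3^5 = 972 <= 1024 = 4^5\<close>.\<close>
    also have "\<dots> \<le> (4/3) powr real m"
    proof (rule powr_mono2)
      have "(2 powr (2/5::real)) ^ 5 = 4" by (simp add: powr_power)
      also have "\<dots> \<le> (4/3) ^ 5" by (simp add: power_divide)
      finally show "2 powr (2/5::real) \<le> 4/3" using power_le_imp_le_base[of "2 powr (2/5::real)" 4 "4/3"] by (simp add: numeral_eq_Suc)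
    qed auto
    finally show ?thesis by (simp add: powr_realpow)
  qed
  define a b where "a = real (Stirling m (l - 1))" "b = real (Stirling m 2)"
  have bpos: "b > 0" using Stirling_pos[of 2 m] m by (simp add: a_b_def)
  have "l * Stirling m l * Stirling m 2 \<le> 3 * Stirling m 3 * Stirling m (l - 1)"
    using Stirling_ratio_decreasing[of 3 l m] l by (cases "l = 3") (auto simp: eval_nat_numeral)
  hence "Stirling (Suc m) l * Stirling m 2 \<le> Stirling (Suc m) 3 * Stirling m (l - 1)"
    using l Stirling_rec[of "Suc m" l] Stirling_rec[of "Suc m" 3] by (simp add: algebra_simps)
  hence 1: "real (Stirling (Suc m) l) * b \<le> real (Stirling (Suc m) 3) * a"
    unfolding a_b_def by (metis of_nat_le_iff of_nat_mult)
  have "fact 3 * Stirling (Suc m) 3 \<le> 3 ^ Suc m" by (rule fact_Stirling_le_power)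
  hence "6 * Stirling (Suc m) 3 \<le> 3 ^ Suc m" by (simp add: fact_numeral)
  hence "real (6 * Stirling (Suc m) 3) \<le> real (3 ^ Suc m)" unfolding of_nat_le_iff .
  hence 2: "real (Stirling (Suc m) 3) \<le> 3 ^ m / 2" by simp
  have b: "b = 2 ^ m / 2 - 1" using m Stirling_two[of m] power_Suc[of "2::real" "m - 1"] by (simp add: a_b_def of_nat_diff)
  have R: "real (Stirling (Suc m) 2) = 2 ^ m - 1" using Stirling_two[of "Suc m"] by (simp add: of_nat_diff)
  have 3: "real K ^ 3 * (3 ^ m / 2) \<le> 4 ^ m / 2"
  proof -
    have "real K ^ 3 * 3 ^ m \<le> (4/3) ^ m * 3 ^ m" using \<open>real K ^ 3 \<le> (4/3) ^ m\<close> by (intro mult_right_mono) auto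
    thus ?thesis by (simp add: power_divide)
  qed
  define y :: real where "y = 2 ^ m"
  have y8: "y \<ge> 8" unfolding y_def using m power_increasing[of 3 m "2::real"] by simp
  have "8 * y \<le> y * y" using y8 by (intro mult_right_mono) auto
  moreover have y4: "4 ^ m = y * y" using power_mult_distrib[of 2 "2::real" m] by (simp add: y_def)
  moreover have "2 * (y - 1) * (y / 2 - 1) = y * y - 3 * y + 2" by (simp add: field_simps)
  ultimately have 4: "4 ^ m / 2 \<le> 2 * (2 ^ m - 1) * (2 ^ m / 2 - 1 :: real)"
    using y8 unfolding y_def[symmetric] by linarith
  have "b * (real K ^ 3 * real (Stirling (Suc m) l)) \<le> real K ^ 3 * (real (Stirling (Suc m) 3) * a)"
    using mult_left_mono[OF 1, of "real K ^ 3"] by (simp add: mult_ac)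
  also have "\<dots> \<le> real K ^ 3 * (3 ^ m / 2 * a)"
    using 2 by (intro mult_left_mono mult_right_mono) (auto simp: a_b_def)
  also have "\<dots> = real K ^ 3 * (3 ^ m / 2) * a" by simp
  also have "\<dots> \<le> 2 * (2 ^ m - 1) * (2 ^ m / 2 - 1) * a"
    using 3 4 by (intro mult_right_mono) (auto simp: a_b_def)
  also have "\<dots> = b * (2 * real (Stirling (Suc m) 2) * a)" by (simp only: b R mult_ac)
  finally have "real K ^ 3 * real (Stirling (Suc m) l) \<le> 2 * real (Stirling (Suc m) 2) * a"
    using bpos by (simp only: mult_le_cancel_left_pos)
  hence "real (K ^ 3 * Stirling (Suc m) l) \<le> real (2 * Stirling (Suc m) 2 * Stirling m (l - 1))"
    by (simp add: a_b_def)
  hence "K ^ 3 * Stirling (n - t) l \<le> 2 * Stirling (n - t) 2 * Stirling m (l - 1)"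
    unfolding of_nat_le_iff m(1) .
  thus ?thesis unfolding m_l_def .
qed

text \<open>Meant for \<open>b\<close> the size of a largest block in a partition into at most
  \<open>K\<close> blocks. Dividing the bound on \<open>n\<close> by \<open>K\<close> gives
  \<open>b >= 2 * L - 1 + 5 / K\<close> with \<open>L = log 2 K\<close>, and this is at least
  \<open>L + 1\<close>.\<close>

lemma power_block_size_ge:
  assumes "n \<le> b * K"
  shows "K \<le> 2 ^ (b - 1)"
proof -
  define L where "L = log 2 (real K)"
  have KL: "real K = 2 powr L" using K_ge_3 by (simp add: L_def)
  have "5 - real K + 2 * real K * L \<le> real b * real K"
    using n_ge assms unfolding L_def by (metis of_nat_le_iff of_nat_mult order_trans)
  moreover have "2 * real K \<le> real K * L + 5"
  proof (cases "K = 3")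
    case True
    then show ?thesis using log_K_ge by (simp add: L_def)
  next
    case False
    have "2 = log 2 (2 ^ 2 :: real)" by (subst log_nat_power) auto
    also have "\<dots> \<le> L" unfolding L_def using False K_ge_3 by (subst log_le_cancel_iff) auto
    finally have "real K * 2 \<le> real K * L" by (intro mult_left_mono) auto
    thus ?thesis by simp
  qed
  ultimately have "real K * (L + 1) \<le> real K * real b" by (simp add: algebra_simps)
  hence "L + 1 \<le> real b" using K_ge_3 by simp
  moreover have "L \<ge> 0" using log_K_ge by (simp add: L_def)
  ultimately have "L \<le> real (b - 1)" by linarith
  hence "real K \<le> 2 powr (real (b - 1))" by (simp add: KL)
  also have "\<dots> = 2 ^ (b - 1)" by (simp only: powr_realpow)
  finally show ?thesis by (metis of_nat_le_iff of_nat_numeral of_nat_power)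
qed

text \<open>Iterates \<open>Stirling_ratio_ge\<close> as long as a block remains free. The bound is
  1 both at \<open>k - 1\<close> and at \<open>k\<close> blocks, so the very last step gains
  nothing; the last two steps are therefore taken together, using
  \<open>S(n - k + 2, 2) >= K^6 - 1 >= (2 * K^2)^2\<close>.\<close>

lemma star_bound_decay:
  assumes "j + 2 \<le> k" "k \<le> K" "j + e \<le> k"
  shows "star_bound n k (j + e) * (2 * K ^ 2) ^ e \<le> star_bound n k j"
proof -
  have A: "star_bound n k (j + e) * (2 * K ^ 2) ^ e \<le> star_bound n k j" if "j + e < k" for e
    using that
  proof (induction e)
    case (Suc e)
    have "star_bound n k (j + Suc e) * (2 * K ^ 2) ^ Suc e
      = (2 * K ^ 2 * star_bound n k (j + Suc e)) * (2 * K ^ 2) ^ e" by simp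
    also have "\<dots> \<le> star_bound n k (j + e) * (2 * K ^ 2) ^ e"
      using Stirling_ratio_ge[of "j + e" k] Suc.prems assms
      by (intro mult_right_mono) (auto simp: star_bound_def)
    also have "\<dots> \<le> star_bound n k j" using Suc by simp
    finally show ?case .
  qed simp
  show ?thesis
  proof (cases "j + e < k")
    case False
    define e' where "e' = e - 2"
    have e: "e = e' + 2" "k = j + e' + 2" using assms False by (auto simp: e'_def)
    have "(2 * K ^ 2) ^ 2 \<le> star_bound n k (j + e')"
    proof -
      have "9 * K ^ 4 \<le> K ^ 2 * K ^ 4" using K_ge_3 power_mono[of 3 K 2] by (intro mult_right_mono) auto
      moreover have "K ^ 4 \<ge> 1" using K_ge_3 by simp
      ultimately have "(2 * K ^ 2) ^ 2 + 1 \<le> K ^ 6"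
        by (simp add: power_mult_distrib flip: power_mult power_add)
      moreover have "k - (j + e') = 2" "k - 2 = j + e'" "j + e' < k" using e by auto
      ultimately show ?thesis using Stirling_two_ge[of k] e assms by (simp add: star_bound_def)
    qed
    hence "(2 * K ^ 2) ^ e \<le> star_bound n k (j + e') * (2 * K ^ 2) ^ e'"
      by (simp add: e(1) power_add mult.commute)
    also have "\<dots> \<le> star_bound n k j" using A[of e'] e by simp
    finally show ?thesis using e by (simp add: star_bound_def)
  qed (rule A)
qed

end

section \<open>Counting partitions with prescribed blocks\<close>

text \<open>The recurrence is read off the block of the new element \<open>a\<close>: either
  \<open>{a}\<close>, or a block \<open>B\<close> of a partition of \<open>A\<close> enlarged by
  \<open>a\<close>, with \<open>k\<close> choices of \<open>B\<close>.\<close>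

lemma card_partition_on:
  fixes A :: "'a set"
  assumes "finite A"
  shows "card {P. partition_on A P \<and> card P = k} = Stirling (card A) k"
  using assms
proof (induction A arbitrary: k rule: finite_induct)
  case empty
  have *: "{P. partition_on ({} :: 'a set) P \<and> card P = k} = (if k = 0 then {{}} else {})"
    by (auto simp: partition_on_empty)
  show ?case unfolding * by (cases k) simp_all
next
  case (insert a A)
  define Q where "Q B j = {P. partition_on B P \<and> card P = j}" for B :: "'a set" and j
  have fin: "finite (Q B j)" if "finite B" for B j
    using finitely_many_partition_on[OF that] by (auto simp: Q_def)
  have fP: "finite P" if "P \<in> Q A j" for P j
    using that insert.hyps finite_elements by (auto simp: Q_def)
  have fP': "finite P" if "P \<in> Q (insert a A) j" for P j
    using that insert.hyps finite_elements[of "insert a A"] by (auto simp: Q_def)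
  show ?case
  proof (cases k)
    case 0
    have "False" if "partition_on (insert a A) P" "card P = 0" for P
    proof -
      have "finite P" using that(1) insert.hyps finite_elements[of "insert a A" P] by blast
      hence "P = {}" using that(2) card_0_eq by blast
      moreover have "a \<in> \<Union>P" unfolding partition_onD1[OF that(1), symmetric] by (rule insertI1)
      ultimately show False by blast
    qed
    hence *: "{P. partition_on (insert a A) P \<and> card P = k} = {}"
      using 0 by blast
    show ?thesis unfolding * using insert.hyps 0 by simp
  next
    case k: (Suc j)
    define f where "f = (\<lambda>(P, B). insert (insert a B) (P - {B}))"
    define S where "S = (SIGMA P:Q A k. P)"
    have memP: "B \<subseteq> A" "B \<noteq> {}" "a \<notin> B" if "P \<in> Q A i" "B \<in> P" for P B i
      using that insert.hyps by (auto simp: Q_def partition_on_def)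
    have img1: "insert {a} P \<in> Q (insert a A) k \<and> {a} \<in> insert {a} P" if "P \<in> Q A j" for P
    proof -
      have "disjnt {a} (\<Union>P)" "\<Union>P = A" using that insert.hyps by (auto simp: Q_def partition_on_def)
      hence "partition_on (insert a A) (insert {a} P)"
        using that insert.hyps by (subst partition_on_insert) (auto simp: Q_def)
      moreover have "{a} \<notin> P" using memP(3)[OF that] by auto
      ultimately show ?thesis using that fP[OF that] k by (auto simp: Q_def)
    qed
    have 1: "bij_betw (insert {a}) (Q A j) {P \<in> Q (insert a A) k. {a} \<in> P}"
    proof (rule bij_betw_byWitness[where f' = "\<lambda>P. P - {{a}}"])
      show "\<forall>P\<in>Q A j. insert {a} P - {{a}} = P" using memP(3) by fastforce
      show "\<forall>P\<in>{P \<in> Q (insert a A) k. {a} \<in> P}. insert {a} (P - {{a}}) = P" by auto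
      show "insert {a} ` Q A j \<subseteq> {P \<in> Q (insert a A) k. {a} \<in> P}" using img1 by auto
      show "(\<lambda>P. P - {{a}}) ` {P \<in> Q (insert a A) k. {a} \<in> P} \<subseteq> Q A j"
      proof safe
        fix P assume P: "P \<in> Q (insert a A) k" "{a} \<in> P"
        hence p: "partition_on (insert a A) (insert {a} (P - {{a}}))" by (simp add: Q_def insert_absorb)
        have "disjnt {a} (\<Union>(P - {{a}}))"
          using P by (fastforce simp: Q_def partition_on_def pairwise_def disjnt_def)
        hence "partition_on A (P - {{a}})"
          using p insert.hyps by (subst (asm) partition_on_insert) auto
        thus "P - {{a}} \<in> Q A j" using P k fP'[OF P(1)] by (auto simp: Q_def)
      qed
    qed
    have 2: "bij_betw f S {P \<in> Q (insert a A) k. {a} \<notin> P}"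
    proof (rule bij_betwI')
      fix x y assume x: "x \<in> S" and y: "y \<in> S"
      obtain P B where xe: "x = (P, B)" by (cases x)
      obtain P' B' where ye: "y = (P', B')" by (cases y)
      have PB: "P \<in> Q A k" "B \<in> P" "P' \<in> Q A k" "B' \<in> P'" using x y xe ye by (auto simp: S_def)
      show "(f x = f y) = (x = y)"
      proof
        assume eq: "f x = f y"
        have nin: "insert a C \<notin> P" "insert a C \<notin> P'" for C using memP(3) PB by blast+
        have "insert a B \<in> insert (insert a B') (P' - {B'})" using eq by (auto simp: f_def xe ye)
        hence "insert a B = insert a B'" using nin by auto
        hence B: "B = B'" using memP(3)[OF PB(1,2)] memP(3)[OF PB(3,4)] by (metis insert_ident)
        have "P - {B} = f x - {insert a B}" using nin by (auto simp: f_def xe)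
        also have "\<dots> = P' - {B'}" unfolding eq using nin B by (auto simp: f_def ye)
        finally have "insert B (P - {B}) = insert B' (P' - {B'})" using B by simp
        thus "x = y" using PB B by (simp add: xe ye insert_absorb)
      qed simp
    next
      fix x assume x: "x \<in> S"
      obtain P B where xe: "x = (P, B)" by (cases x)
      have PB: "P \<in> Q A k" "B \<in> P" using x xe by (auto simp: S_def)
      have U: "\<Union>P = A" and dj: "\<And>C D. C \<in> P \<Longrightarrow> D \<in> P \<Longrightarrow> C \<noteq> D \<Longrightarrow> C \<inter> D = {}"
        using PB by (auto simp: Q_def partition_on_def pairwise_def disjnt_def)
      have d0: "disjnt B (\<Union>(P - {B}))" using dj[OF PB(2)] by (fastforce simp: disjnt_def)
      have d: "disjnt (insert a B) (\<Union>(P - {B}))"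
        using d0 memP(3)[OF PB(1)] by (auto simp: disjnt_def)
      have "partition_on A (insert B (P - {B}))" using PB by (simp add: Q_def insert_absorb)
      hence "partition_on (A - B) (P - {B})" using d0 by (subst (asm) partition_on_insert) auto
      moreover have "insert a A - insert a B = A - B" using insert.hyps by auto
      ultimately have "partition_on (insert a A) (f x)"
        unfolding f_def xe prod.case partition_on_insert[OF d] using memP(1)[OF PB] by auto
      moreover have "card (f x) = k"
      proof -
        have "insert a B \<notin> P - {B}" using memP(3)[OF PB(1)] by blast
        hence "card (f x) = Suc (card (P - {B}))"
          unfolding f_def xe prod.case using fP[OF PB(1)] by (intro card_insert_disjoint) auto
        also have "\<dots> = card P" using fP[OF PB(1)] PB(2) by (rule card_Suc_Diff1)
        finally show ?thesis using PB(1) by (simp add: Q_def)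
      qed
      moreover have "{a} \<notin> f x"
      proof
        assume "{a} \<in> f x"
        then consider "{a} = insert a B" | "{a} \<in> P" by (auto simp: f_def xe)
        thus False
        proof cases
          case 1
          hence "B \<subseteq> {a}" by blast
          thus False using memP(2,3)[OF PB] by blast
        qed (use memP(3)[OF PB(1)] in blast)
      qed
      ultimately show "f x \<in> {P \<in> Q (insert a A) k. {a} \<notin> P}" by (simp add: Q_def)
    next
      fix P assume "P \<in> {P \<in> Q (insert a A) k. {a} \<notin> P}"
      hence P: "partition_on (insert a A) P" "card P = k" "{a} \<notin> P" and PQ: "P \<in> Q (insert a A) k" by (auto simp: Q_def)
      then obtain C where C: "C \<in> P" "a \<in> C" by (auto simp: partition_on_def)
      obtain B where CB: "C = insert a B" "a \<notin> B" "B \<noteq> {}" using C P(3) by (metis mk_disjoint_insert)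
      have dj: "\<And>C D. C \<in> P \<Longrightarrow> D \<in> P \<Longrightarrow> C \<noteq> D \<Longrightarrow> C \<inter> D = {}"
        using P by (auto simp: partition_on_def pairwise_def disjnt_def)
      have d: "disjnt C (\<Union>(P - {C}))" using dj[OF C(1)] by (fastforce simp: disjnt_def)
      have "partition_on (insert a A) (insert C (P - {C}))" using P(1) C by (simp add: insert_absorb)
      hence p: "partition_on (insert a A - C) (P - {C})" "C \<subseteq> insert a A"
        unfolding partition_on_insert[OF d] by blast+
      have BP: "B \<notin> P - {C}" using d CB by (auto simp: disjnt_def)
      have "insert a A - C = A - B" using CB insert.hyps by auto
      moreover have dB: "disjnt B (\<Union>(P - {C}))" using d CB(1) by (auto simp: disjnt_def)
      ultimately have "partition_on A (insert B (P - {C}))"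
        unfolding partition_on_insert[OF dB] using p CB by auto
      moreover have "card (insert B (P - {C})) = k"
        using card_insert_disjoint[OF _ BP] card_Suc_Diff1[OF _ C(1)] fP'[OF PQ] P(2) by simp
      ultimately have "(insert B (P - {C}), B) \<in> S" by (simp add: S_def Q_def)
      moreover have "P = f (insert B (P - {C}), B)"
      proof -
        have "insert B (P - {C}) - {B} = P - {C}" using BP by blast
        thus ?thesis unfolding f_def prod.case CB(1)[symmetric] using C(1) by auto
      qed
      ultimately show "\<exists>x\<in>S. P = f x" by blast
    qed
    have "card S = (\<Sum>P\<in>Q A k. card P)"
      unfolding S_def using fin[OF insert.hyps(1)] fP by (intro card_SigmaI) blast+
    also have "\<dots> = (\<Sum>P\<in>Q A k. k)" by (rule sum.cong) (simp_all add: Q_def)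
    finally have "card S = k * card (Q A k)" by simp
    hence c2: "card {P \<in> Q (insert a A) k. {a} \<notin> P} = k * Stirling (card A) k"
      using bij_betw_same_card[OF 2] insert.IH by (simp add: Q_def)
    have c1: "card {P \<in> Q (insert a A) k. {a} \<in> P} = Stirling (card A) j"
      using bij_betw_same_card[OF 1] insert.IH by (simp add: Q_def)
    have "Q (insert a A) k = {P \<in> Q (insert a A) k. {a} \<in> P} \<union> {P \<in> Q (insert a A) k. {a} \<notin> P}" by auto
    also have "card \<dots> = Stirling (card A) j + k * Stirling (card A) k"
      using fin[of "insert a A" k] insert.hyps by (subst card_Un_disjoint) (auto simp: c1 c2)
    finally have "card (Q (insert a A) k) = Stirling (card A) j + k * Stirling (card A) k" .
    thus ?thesis using insert.hyps k by (simp add: Q_def)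
  qed
qed

lemma partition_on_Un_iff:
  assumes "partition_on U T" "U \<subseteq> A"
  shows "partition_on A P \<and> T \<subseteq> P \<longleftrightarrow> (\<exists>R. partition_on (A - U) R \<and> P = T \<union> R)"
proof
  assume P: "partition_on A P \<and> T \<subseteq> P"
  have UT: "U = \<Union>T" and dj: "\<And>p q. p \<in> P \<Longrightarrow> q \<in> P \<Longrightarrow> p \<noteq> q \<Longrightarrow> p \<inter> q = {}"
    and PA: "\<Union>P = A" "{} \<notin> P"
    using P assms by (auto simp: partition_on_def pairwise_def disjnt_def)
  have "partition_on (A - U) (P - T)"
  proof (rule partition_onI)
    have "x \<notin> \<Union>T" if "x \<in> p" "p \<in> P - T" for x p
      using dj[of p] that P by fastforce
    thus "\<Union>(P - T) = A - U" unfolding UT PA(1)[symmetric] using P by auto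
    show "disjnt p q" if "p \<in> P - T" "q \<in> P - T" "p \<noteq> q" for p q
      using dj that by (auto simp: disjnt_def)
  qed (use PA in auto)
  thus "\<exists>R. partition_on (A - U) R \<and> P = T \<union> R" using P by blast
next
  assume "\<exists>R. partition_on (A - U) R \<and> P = T \<union> R"
  then obtain R where R: "partition_on (A - U) R" "P = T \<union> R" by blast
  show "partition_on A P \<and> T \<subseteq> P"
  proof
    show "partition_on A P"
    proof (rule partition_onI)
      show "\<Union>P = A" "{} \<notin> P" using R assms by (auto simp: partition_on_def)
      fix p q assume pq: "p \<in> P" "q \<in> P" "p \<noteq> q"
      have 1: "p \<subseteq> U" if "p \<in> T" for p using that assms(1) by (auto simp: partition_on_def)
      have 2: "p \<subseteq> A - U" if "p \<in> R" for p using that R(1) by (auto simp: partition_on_def)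
      have 3: "disjnt p q" if "p \<in> T" "q \<in> T"
        using that assms(1) pq(3) by (auto simp: partition_on_def pairwise_def)
      have 4: "disjnt p q" if "p \<in> R" "q \<in> R"
        using that R(1) pq(3) by (auto simp: partition_on_def pairwise_def)
      from pq R consider "p \<in> T" "q \<in> T" | "p \<in> R" "q \<in> R" | "p \<in> T" "q \<in> R" | "p \<in> R" "q \<in> T" by auto
      thus "disjnt p q"
      proof cases
        case c: 3
        then show ?thesis using 1[OF c(1)] 2[OF c(2)] by (auto simp: disjnt_def)
      next
        case c: 4
        then show ?thesis using 2[OF c(1)] 1[OF c(2)] by (auto simp: disjnt_def)
      qed (use 3 4 in auto)
    qed
  qed (use R in auto)
qed

lemma card_partition_on_superset:
  assumes "finite A" "partition_on U T" "U \<subseteq> A" "card T \<le> k"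
  shows "card {P. partition_on A P \<and> card P = k \<and> T \<subseteq> P} = Stirling (card A - card U) (k - card T)"
proof -
  have fT: "finite T" using assms finite_elements finite_subset by blast
  have disj: "T \<inter> R = {}" if "partition_on (A - U) R" for R
  proof (rule ccontr)
    assume "T \<inter> R \<noteq> {}"
    then obtain x where x: "x \<in> T" "x \<in> R" by auto
    hence "x \<subseteq> U" "x \<subseteq> A - U" "x \<noteq> {}" using that assms(2) by (auto simp: partition_on_def)
    thus False by auto
  qed
  have cR: "card (T \<union> R) = card T + card R" if "partition_on (A - U) R" for R
    using that disj[OF that] fT finite_elements[of "A - U" R] assms by (simp add: card_Un_disjoint)
  have "{P. partition_on A P \<and> card P = k \<and> T \<subseteq> P} = (\<union>) T ` {R. partition_on (A - U) R \<and> card R = k - card T}"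
  proof (intro equalityI subsetI)
    fix P assume "P \<in> {P. partition_on A P \<and> card P = k \<and> T \<subseteq> P}"
    moreover then obtain R where "partition_on (A - U) R" "P = T \<union> R"
      using partition_on_Un_iff[OF assms(2,3), of P] by blast
    ultimately show "P \<in> (\<union>) T ` {R. partition_on (A - U) R \<and> card R = k - card T}"
      using cR by auto
  next
    fix P assume "P \<in> (\<union>) T ` {R. partition_on (A - U) R \<and> card R = k - card T}"
    then obtain R where R: "partition_on (A - U) R" "card R = k - card T" "P = T \<union> R" by auto
    hence "partition_on A P \<and> T \<subseteq> P" using partition_on_Un_iff[OF assms(2,3), of P] by blast
    thus "P \<in> {P. partition_on A P \<and> card P = k \<and> T \<subseteq> P}" using R cR[OF R(1)] assms(4) by simp
  qed
  moreover have "inj_on ((\<union>) T) {R. partition_on (A - U) R \<and> card R = k - card T}"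
    using disj by (intro inj_onI) blast
  ultimately have "card {P. partition_on A P \<and> card P = k \<and> T \<subseteq> P} = card {R. partition_on (A - U) R \<and> card R = k - card T}"
    by (simp add: card_image)
  thus ?thesis using assms card_partition_on[of "A - U"] by (simp add: card_Diff_subset finite_subset)
qed

section \<open>Stars: partitions containing a given set of blocks\<close>

definition star :: "nat \<Rightarrow> nat \<Rightarrow> nat set set \<Rightarrow> nat set set set" where
  "star n k T = {P \<in> Pi_part n k. T \<subseteq> P}"

lemma finite_Pi_part [simp]: "finite (Pi_part n k)"
  using finitely_many_partition_on[of "{1..n}"] by (auto simp: Pi_part_def)

lemma finite_star [simp]: "finite (star n k T)"
  by (simp add: star_def)

lemma Pi_part_finite: "P \<in> Pi_part n k \<Longrightarrow> finite P"
  by (auto simp: Pi_part_def intro: finite_elements)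

lemma Pi_part_card: "P \<in> Pi_part n k \<Longrightarrow> card P = k"
  by (simp add: Pi_part_def)

lemma subset_Pi_part:
  assumes "P \<in> Pi_part n k" "T \<subseteq> P"
  shows "finite T" "partition_on (\<Union>T) T" "\<Union>T \<subseteq> {1..n}" "card T \<le> k"
    "\<And>B. B \<in> T \<Longrightarrow> finite B \<and> B \<noteq> {}" "card (\<Union>T) = (\<Sum>B\<in>T. card B)"
proof -
  show f: "finite T" and "card T \<le> k" using assms Pi_part_finite Pi_part_card card_mono finite_subset by metis+
  have p: "partition_on {1..n} P" using assms by (simp add: Pi_part_def)
  show "\<Union>T \<subseteq> {1..n}" using p assms by (auto simp: partition_on_def)
  show fB: "\<And>B. B \<in> T \<Longrightarrow> finite B \<and> B \<noteq> {}"
    using p assms by (metis Union_upper finite_atLeastAtMost finite_subset partition_onD1 partition_onD3 subsetD)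
  show "partition_on (\<Union>T) T" using p assms by (auto simp: partition_on_def intro: pairwise_subset)
  thus "card (\<Union>T) = (\<Sum>B\<in>T. card B)" using fB by (intro card_Union_disjoint) (auto simp: partition_on_def)
qed

lemma card_star:
  assumes "Q \<in> Pi_part n q" "T \<subseteq> Q" "card T \<le> k"
  shows "card (star n k T) = Stirling (n - card (\<Union>T)) (k - card T)"
  using card_partition_on_superset[of "{1..n}" "\<Union>T" T k] subset_Pi_part[OF assms(1,2)] assms(3)
  by (simp add: star_def Pi_part_def conj_assoc)

text \<open>\<open>T\<close> may be any finite set: unless its members are disjoint nonempty blocks,
  the star is empty. Otherwise \<open>T\<close> covers at least \<open>card T\<close> elements, and
  a smaller remainder has fewer partitions.\<close>

lemma card_star_le:
  assumes "k < n" "1 \<le> k" "finite T"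
  shows "card (star n k T) \<le> star_bound n k (card T)"
proof (cases "star n k T = {}")
  case False
  then obtain P where P: "P \<in> Pi_part n k" "T \<subseteq> P" by (auto simp: star_def)
  note sub = subset_Pi_part[OF P]
  show ?thesis
  proof (cases "card T = k")
    case True
    have "R = T" if "R \<in> star n k T" for R
    proof -
      have "R \<in> Pi_part n k" "T \<subseteq> R" using that by (auto simp: star_def)
      thus ?thesis using card_subset_eq[of R T] Pi_part_finite[of R n k] Pi_part_card[of R n k] True by simp
    qed
    hence "star n k T \<subseteq> {T}" by auto
    hence "card (star n k T) \<le> 1" using card_mono[of "{T}"] by auto
    thus ?thesis using True by (simp add: star_bound_def)
  next
    case False
    have "card T \<le> card (\<Union>T)"
    proof -
      have "(\<Sum>B\<in>T. 1) \<le> (\<Sum>B\<in>T. card B)"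
        using sub(5) by (intro sum_mono) (simp add: Suc_le_eq card_gt_0_iff)
      thus ?thesis using sub(6) by simp
    qed
    hence "Stirling (n - card (\<Union>T)) (k - card T) \<le> Stirling (n - card T) (k - card T)"
      using False sub by (intro Stirling_mono_left) auto
    thus ?thesis using False sub card_star[OF P sub(4)] by (simp add: star_bound_def)
  qed
qed simp

text \<open>The binomial coefficient is the product of \<open>(h + i) / i\<close> for
  \<open>i = 1, ..., e\<close>, and each factor is at most \<open>h + 1\<close>.\<close>

lemma choose_add_le_power: "(h + e) choose h \<le> (h + 1) ^ e"
proof (induction e)
  case (Suc e)
  have "Suc e * ((h + Suc e) choose Suc e) = (h + Suc e) * ((h + e) choose e)"
    using Suc_times_binomial_eq[of "h + e" e] by (simp only: add_Suc_right mult.commute)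
  moreover have "(h + Suc e) choose Suc e = (h + Suc e) choose h" "(h + e) choose e = (h + e) choose h"
    using binomial_symmetric[of h "h + Suc e"] binomial_symmetric[of h "h + e"] by simp_all
  ultimately have "Suc e * ((h + Suc e) choose h) = (h + Suc e) * ((h + e) choose h)" by simp
  also have "\<dots> \<le> (Suc e * (h + 1)) * (h + 1) ^ e"
    using Suc by (intro mult_mono) (auto simp: algebra_simps)
  finally have "Suc e * ((h + Suc e) choose h) \<le> Suc e * (h + 1) ^ Suc e" by (simp only: power_Suc mult.assoc)
  thus ?case by (simp only: mult_le_cancel1)
qed simp

lemma Pi_part_superset_eq:
  assumes "P \<in> Pi_part n k" "Q \<in> Pi_part n l" "P \<subseteq> Q"
  shows "Q = P"
proof (rule ccontr)
  assume "Q \<noteq> P"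
  then obtain q where q: "q \<in> Q" "q \<notin> P" using assms(3) by auto
  have "q \<noteq> {}" "q \<subseteq> \<Union>P" using assms q by (auto simp: Pi_part_def partition_on_def)
  then obtain x p where x: "x \<in> q" "x \<in> p" "p \<in> P" by blast
  have "disjoint Q" using assms by (simp add: Pi_part_def partition_on_def)
  hence "disjnt p q" using x q assms(3) by (auto simp: pairwise_def)
  thus False using x by (auto simp: disjnt_def)
qed

lemma card_le_card_Union:
  assumes "P \<in> Pi_part n k" "T \<subseteq> P"
  shows "card T \<le> card (\<Union>T)"
    and "B \<in> T \<Longrightarrow> card T + card B \<le> card (\<Union>T) + 1"
    and "(\<And>B. B \<in> T \<Longrightarrow> card B = 1) \<Longrightarrow> card (\<Union>T) = card T"
proof -
  note sub = subset_Pi_part[OF assms]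
  have ge: "card B \<ge> 1" if "B \<in> T" for B using sub(5)[OF that] by (simp add: Suc_le_eq card_gt_0_iff)
  have "(\<Sum>B\<in>T. 1) \<le> (\<Sum>B\<in>T. card B)" using ge by (intro sum_mono) auto
  thus "card T \<le> card (\<Union>T)" using sub(6) by simp
  show "card T + card B \<le> card (\<Union>T) + 1" if B: "B \<in> T"
  proof -
    have "(\<Sum>B\<in>T - {B}. 1) \<le> (\<Sum>B\<in>T - {B}. card B)" using ge by (intro sum_mono) auto
    moreover have "(\<Sum>B\<in>T. card B) = card B + (\<Sum>B\<in>T - {B}. card B)" using sub(1) B by (rule sum.remove)
    moreover have "card T = Suc (card (T - {B}))" using sub(1) B by (metis card_Suc_Diff1)
    ultimately show ?thesis using sub(6) by simp
  qed
  show "card (\<Union>T) = card T" if "\<And>B. B \<in> T \<Longrightarrow> card B = 1"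
    using sub(6) that by simp
qed

text \<open>Once \<open>k - 1\<close> blocks are known, the last one must be the rest of the ground
  set.\<close>

lemma Pi_part_eqI:
  assumes "P \<in> Pi_part n k" "Q \<in> Pi_part n k" "k \<le> card (P \<inter> Q) + 1" "1 \<le> k" "k < n"
  shows "P = Q"
proof -
  have f: "finite (P \<inter> Q)" using Pi_part_finite[OF assms(1)] by simp
  have "card (star n k (P \<inter> Q)) \<le> star_bound n k (card (P \<inter> Q))"
    using assms f by (intro card_star_le) auto
  also have "\<dots> \<le> 1"
  proof (cases "card (P \<inter> Q) < k")
    case True
    then have "k - card (P \<inter> Q) = 1" using assms by simp
    moreover have "n - card (P \<inter> Q) \<ge> 1" using True assms by simp
    ultimately show ?thesis using Stirling_one by (simp add: star_bound_def)
  qed (simp add: star_bound_def)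
  finally have "card (star n k (P \<inter> Q)) \<le> 1" .
  moreover have "{P, Q} \<subseteq> star n k (P \<inter> Q)" using assms by (auto simp: star_def)
  ultimately have "card {P, Q} \<le> 1" using card_mono[of "star n k (P \<inter> Q)" "{P, Q}"] by simp
  thus ?thesis by (cases "P = Q") auto
qed

text \<open>This is \<open>(t + 1) S(n - t, k - t) - t S(n - t - 1, k - t - 1)\<close>, written without subtraction.\<close>

definition top_bound :: "nat \<Rightarrow> nat \<Rightarrow> nat \<Rightarrow> nat" where
  "top_bound n k t = Stirling (n - t) (k - t) + t * (k - t) * Stirling (n - t - 1) (k - t)"

section \<open>Partitions sharing at least \<open>t\<close> blocks with a fixed set of
  blocks\<close>

definition near_star :: "nat \<Rightarrow> nat \<Rightarrow> nat \<Rightarrow> nat set set \<Rightarrow> nat set set set" where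
  "near_star n k t H = {A \<in> Pi_part n k. t \<le> card (A \<inter> H)}"

lemma finite_near_star [simp]: "finite (near_star n k t H)"
  by (simp add: near_star_def)

lemma near_star_cover:
  assumes "card H = t + 1"
  shows "near_star n k t H \<subseteq> (\<Union>b\<in>H. star n k (H - {b}))"
proof
  fix A assume A: "A \<in> near_star n k t H"
  have f: "finite H" using assms card.infinite by fastforce
  have "card (H - A) \<le> 1"
  proof -
    have "card (H - A) = card H - card (A \<inter> H)" using f by (metis Int_commute card_Diff_subset_Int finite_Int)
    moreover have "t \<le> card (A \<inter> H)" using A by (simp add: near_star_def)
    ultimately show ?thesis using assms by linarith
  qed
  have "\<exists>b\<in>H. H - A \<subseteq> {b}"
  proof (cases "H - A = {}")
    case True
    have "H \<noteq> {}" using assms by auto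
    thus ?thesis using True by blast
  next
    case False
    then obtain b where b: "b \<in> H - A" by auto
    have "H - A = {b}"
      using card_subset_eq[of "H - A" "{b}"] b f \<open>card (H - A) \<le> 1\<close>
      by (metis One_nat_def card_1_singletonE card_gt_0_iff emptyE finite_Diff le_antisym less_eq_Suc_le singletonD)
    thus ?thesis using b by blast
  qed
  then obtain b where "b \<in> H" "H - {b} \<subseteq> A" by blast
  thus "A \<in> (\<Union>b\<in>H. star n k (H - {b}))" using A by (auto simp: near_star_def star_def)
qed

context
  fixes n k t q :: nat and P H :: "nat set set"
  assumes P: "P \<in> Pi_part n q" and HP: "H \<subseteq> P" and cH: "card H = t + 1"
    and t: "1 \<le> t" and k: "t + 2 \<le> k" and n: "k < n"
begin

private lemma fH: "finite H" using subset_Pi_part[OF P HP] by simp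

private lemma card_H_minus: "b \<in> H \<Longrightarrow> card (H - {b}) = t" using fH cH by simp

private lemma card_star_minus: "b \<in> H \<Longrightarrow> card (star n k (H - {b})) = Stirling (n - card (\<Union>(H - {b}))) (k - t)"
  using card_star[OF P, of "H - {b}" k] card_H_minus HP k by (simp add: subset_insertI2 Diff_subset subset_trans[of _ H])

text \<open>Let \<open>c\<close> be a block with at least two elements. Each set
  \<open>H - {b}\<close> with \<open>b\<close> other than \<open>c\<close> still contains
  \<open>c\<close> and so covers at least \<open>t + 1\<close> elements; only \<open>H - {c}\<close>
  can leave as many as \<open>n - t\<close>.\<close>

lemma card_near_star_big:
  assumes "\<not> (\<forall>B\<in>H. card B = 1)"
  shows "card (near_star n k t H) \<le> Stirling (n - t) (k - t) + t * Stirling (n - t - 1) (k - t)"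
proof -
  obtain c where c: "c \<in> H" "card c \<noteq> 1" using assms by auto
  have "card c \<ge> 1" using subset_Pi_part(5)[OF P HP c(1)] by (simp add: Suc_le_eq card_gt_0_iff)
  hence c2: "card c \<ge> 2" using c by simp
  have 1: "card (star n k (H - {b})) \<le> Stirling (n - t) (k - t)" if "b \<in> H" for b
    using card_star_minus[OF that] card_H_minus[OF that] card_le_card_Union(1)[OF P, of "H - {b}"] HP k
    by (force intro!: Stirling_mono_left)
  have 2: "card (star n k (H - {b})) \<le> Stirling (n - t - 1) (k - t)" if "b \<in> H - {c}" for b
  proof -
    have "t + card c \<le> card (\<Union>(H - {b})) + 1"
      using card_le_card_Union(2)[OF P, of "H - {b}" c] HP that c(1) card_H_minus[of b] by auto
    thus ?thesis using card_star_minus[of b] that k c2 by (auto intro!: Stirling_mono_left)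
  qed
  have "card (near_star n k t H) \<le> card (\<Union>b\<in>H. star n k (H - {b}))"
    using fH by (intro card_mono near_star_cover cH) auto
  also have "\<dots> \<le> (\<Sum>b\<in>H. card (star n k (H - {b})))" using fH by (rule card_UN_le)
  also have "\<dots> = card (star n k (H - {c})) + (\<Sum>b\<in>H - {c}. card (star n k (H - {b})))"
    using fH c(1) by (rule sum.remove)
  also have "\<dots> \<le> Stirling (n - t) (k - t) + (\<Sum>b\<in>H - {c}. Stirling (n - t - 1) (k - t))"
    using 1 2 c(1) by (intro add_mono sum_mono) auto
  finally show ?thesis using card_H_minus[OF c(1)] by simp
qed

lemma near_star_big_less: "Stirling (n - t) (k - t) + t * Stirling (n - t - 1) (k - t) < top_bound n k t"
proof -
  have "Stirling (n - t - 1) (k - t) > 0" using n k by (intro Stirling_pos) auto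
  hence "t * Stirling (n - t - 1) (k - t) < t * (k - t) * Stirling (n - t - 1) (k - t)" using k t by simp
  thus ?thesis unfolding top_bound_def by simp
qed

text \<open>To avoid counting the overlap repeatedly, the star of \<open>H\<close> is counted once
  and each star of \<open>H - {b}\<close> contributes only its \<open>(k - t) * X\<close> members
  outside it.\<close>

lemma card_near_star_singletons:
  assumes "\<forall>B\<in>H. card B = 1"
  shows "card (near_star n k t H) \<le> top_bound n k t"
proof -
  define X where "X = Stirling (n - t - 1) (k - t)"
  define Y where "Y = Stirling (n - t - 1) (k - t - 1)"
  have S: "Stirling (n - t) (k - t) = (k - t) * X + Y"
    unfolding X_def Y_def using n k by (intro Stirling_rec) auto
  have UH: "card (\<Union>H) = t + 1" using card_le_card_Union(3)[OF P HP] assms cH by simp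
  have sH: "card (star n k H) = Y"
    using card_star[OF P HP, of k] cH k UH by (simp add: Y_def)
  have sb: "card (star n k (H - {b}) - star n k H) = (k - t) * X" if "b \<in> H" for b
  proof -
    have "card (\<Union>(H - {b})) = t"
      using card_le_card_Union(3)[OF P, of "H - {b}"] assms card_H_minus[OF that] HP by auto
    hence "card (star n k (H - {b})) = (k - t) * X + Y" using card_star_minus[OF that] S by simp
    moreover have "star n k H \<subseteq> star n k (H - {b})" by (auto simp: star_def)
    ultimately show ?thesis using sH by (simp add: card_Diff_subset)
  qed
  have "near_star n k t H \<subseteq> star n k H \<union> (\<Union>b\<in>H. star n k (H - {b}) - star n k H)"
    using near_star_cover[OF cH, of n k] by blast
  hence "card (near_star n k t H) \<le> card (star n k H \<union> (\<Union>b\<in>H. star n k (H - {b}) - star n k H))"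
    using fH by (intro card_mono) auto
  also have "\<dots> \<le> card (star n k H) + (\<Sum>b\<in>H. card (star n k (H - {b}) - star n k H))"
    by (intro order_trans[OF card_Un_le] add_left_mono card_UN_le fH)
  also have "\<dots> = Y + (t + 1) * ((k - t) * X)" using sb sH cH by simp
  also have "\<dots> = top_bound n k t"
    unfolding top_bound_def S X_def[symmetric] by (simp only: add_mult_distrib add_mult_distrib2 mult_1 mult_1_right mult.assoc ac_simps)
  finally show ?thesis .
qed

lemma card_near_star_le: "card (near_star n k t H) \<le> top_bound n k t"
  using card_near_star_big near_star_big_less card_near_star_singletons by fastforce

end

context large_ground
begin

text \<open>When the other families all equal \<open>{P}\<close>, this yields the extremal
  \<open>T = P - {b}\<close>. If \<open>A\<close> had fewer than \<open>t\<close> blocks there, it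
  would contain \<open>b\<close> and exactly \<open>t\<close> blocks of \<open>P\<close>. The two
  blocks left out are singletons, so two elements remain for two blocks and
  \<open>A = P\<close>.\<close>

lemma card_near_full_partition_singletons:
  assumes P: "P \<in> Pi_part n (t + 2)" and b: "b \<in> P" "\<forall>B\<in>P - {b}. card B = 1"
    and A: "A \<in> Pi_part n (t + 2)" "t \<le> card (A \<inter> P)" and t: "1 \<le> t"
  shows "t \<le> card (A \<inter> (P - {b}))"
proof (rule ccontr)
  assume less: "\<not> t \<le> card (A \<inter> (P - {b}))"
  have f: "finite A" "finite P" using A P Pi_part_finite by auto
  have "card (A \<inter> P) \<le> card (insert b (A \<inter> (P - {b})))" using f by (intro card_mono) auto
  also have "\<dots> \<le> Suc (card (A \<inter> (P - {b})))" by (rule card_insert_le_m1[THEN order_trans]) (auto simp: card_insert_if f)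
  finally have c: "card (A \<inter> P) = t" using less A(2) by simp
  have bA: "b \<in> A"
  proof (rule ccontr)
    assume "b \<notin> A"
    hence "A \<inter> (P - {b}) = A \<inter> P" by auto
    thus False using less A(2) by simp
  qed
  define T where "T = A \<inter> P"
  have Un: "\<Union>P = {1..n}" "disjoint P" using P by (auto simp: Pi_part_def partition_on_def)
  have "card (\<Union>(P - T)) = 2"
  proof -
    have "card (P - T) = 2" using c f P by (simp add: T_def card_Diff_subset Pi_part_card Int_commute)
    moreover have "P - T \<subseteq> P - {b}" using bA b by (auto simp: T_def)
    ultimately show ?thesis using card_le_card_Union(3)[OF P, of "P - T"] b by auto
  qed
  moreover have "(\<Sum>B\<in>P. card B) = (\<Sum>B\<in>P - T. card B) + (\<Sum>B\<in>T. card B)"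
    using f by (intro sum.subset_diff) (auto simp: T_def)
  ultimately have "n - card (\<Union>T) = 2"
    using subset_Pi_part(6)[OF P, of P] subset_Pi_part(6)[OF P, of T] subset_Pi_part(6)[OF P, of "P - T"] Un
    by (simp add: T_def)
  moreover have "card (star n (t + 2) T) = Stirling (n - card (\<Union>T)) (t + 2 - card T)"
    using P c by (intro card_star[OF P]) (auto simp: T_def)
  ultimately have "card (star n (t + 2) T) = 1" using c by (simp add: T_def)
  moreover have "{A, P} \<subseteq> star n (t + 2) T" using A P by (auto simp: star_def T_def)
  ultimately have "card {A, P} \<le> 1" using card_mono[of "star n (t + 2) T" "{A, P}"] by simp
  hence "A = P" by (cases "A = P") auto
  thus False using c P by (simp add: Pi_part_card)
qed

text \<open>Let \<open>b\<close> be a largest block and \<open>H\<close> the rest, which still has a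
  block that is no singleton. Partitions with \<open>t\<close> blocks in \<open>H\<close> fall under
  \<open>card_near_star_big\<close>, which stays below \<open>top_bound\<close> by
  \<open>t * S(n - t - 1, 2)\<close>. All others contain \<open>b\<close> and \<open>t - 1\<close>
  blocks of \<open>H\<close>. These cover at least \<open>t + card b - 1\<close> elements, and
  \<open>K <= 2^(card b - 1)\<close> makes the total of such partitions smaller than that
  gap.\<close>

lemma card_near_full_partition_less:
  assumes P: "P \<in> Pi_part n (t + 2)" and no: "\<not> (\<exists>b\<in>P. \<forall>B\<in>P - {b}. card B = 1)"
    and t: "1 \<le> t" "t + 2 \<le> K"
  shows "card (near_star n (t + 2) t P) < top_bound n (t + 2) t"
proof -
  have fP: "finite P" and cP: "card P = t + 2" using P Pi_part_finite Pi_part_card by auto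
  have "P \<noteq> {}" using cP by auto
  obtain b where b: "b \<in> P" "\<And>B. B \<in> P \<Longrightarrow> card B \<le> card b"
    using Max_in[of "card ` P"] Max_ge[of "card ` P"] fP \<open>P \<noteq> {}\<close>
    by (metis (no_types, lifting) finite_imageI image_eqI imageE image_is_empty)
  define \<beta> where "\<beta> = card b"
  have "n = (\<Sum>B\<in>P. card B)" using subset_Pi_part(6)[OF P, of P] P by (simp add: Pi_part_def partition_on_def)
  also have "\<dots> \<le> (t + 2) * \<beta>" using sum_bounded_above[of P card \<beta>] b cP by (simp add: \<beta>_def)
  also have "\<dots> \<le> \<beta> * K" using mult_le_mono1[OF t(2), of \<beta>] by (simp only: mult.commute)
  finally have K\<beta>: "K \<le> 2 ^ (\<beta> - 1)" by (rule power_block_size_ge)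
  hence \<beta>2: "\<beta> \<ge> 2" using K_ge_3 by (cases "\<beta> \<le> 1") auto
  define H where "H = P - {b}"
  have cH: "card H = t + 1" and HP: "H \<subseteq> P" using b cP fP by (auto simp: H_def)
  have big: "\<not> (\<forall>B\<in>H. card B = 1)" using no b by (auto simp: H_def)
  have nt: "n \<ge> t + 1 + \<beta>"
    using card_le_card_Union(2)[OF P, of P b] b P cP by (simp add: \<beta>_def Pi_part_def partition_on_def)
  have fH: "finite H" using fP by (simp add: H_def)
  define \<T> where "\<T> = {T. T \<subseteq> H \<and> card T = t - 1}"
  have "near_star n (t + 2) t P \<subseteq> near_star n (t + 2) t H \<union> (\<Union>T\<in>\<T>. star n (t + 2) (insert b T))"
  proof
    fix A assume A: "A \<in> near_star n (t + 2) t P"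
    show "A \<in> near_star n (t + 2) t H \<union> (\<Union>T\<in>\<T>. star n (t + 2) (insert b T))"
    proof (cases "t \<le> card (A \<inter> H)")
      case True
      then show ?thesis using A by (auto simp: near_star_def)
    next
      case False
      have bA: "b \<in> A"
      proof (rule ccontr)
        assume "b \<notin> A"
        hence "A \<inter> H = A \<inter> P" by (auto simp: H_def)
        thus False using False A by (simp add: near_star_def)
      qed
      hence "A \<inter> P = insert b (A \<inter> H)" "b \<notin> A \<inter> H" using b by (auto simp: H_def)
      hence "card (A \<inter> P) = Suc (card (A \<inter> H))" using fH by simp
      moreover have "t \<le> card (A \<inter> P)" using A by (simp add: near_star_def)
      ultimately have "t - 1 \<le> card (A \<inter> H)" by linarith
      then obtain T where "T \<subseteq> A \<inter> H" "card T = t - 1" using obtain_subset_with_card_n by metis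
      hence "T \<in> \<T>" "A \<in> star n (t + 2) (insert b T)" using A bA by (auto simp: \<T>_def near_star_def star_def)
      thus ?thesis by auto
    qed
  qed
  hence "card (near_star n (t + 2) t P) \<le> card (near_star n (t + 2) t H \<union> (\<Union>T\<in>\<T>. star n (t + 2) (insert b T)))"
    using fH by (intro card_mono) (auto simp: \<T>_def)
  also have "\<dots> \<le> card (near_star n (t + 2) t H) + (\<Sum>T\<in>\<T>. card (star n (t + 2) (insert b T)))"
    using fH by (intro order_trans[OF card_Un_le] add_left_mono card_UN_le) (auto simp: \<T>_def)
  also have "\<dots> \<le> (Stirling (n - t) 2 + t * Stirling (n - t - 1) 2) + (\<Sum>T\<in>\<T>. Stirling (n - t - \<beta> + 1) 2)"
  proof (intro add_mono sum_mono)
    show "card (near_star n (t + 2) t H) \<le> Stirling (n - t) 2 + t * Stirling (n - t - 1) 2"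
      using card_near_star_big[OF P HP cH t(1) _ _ big, of "t + 2"] nt \<beta>2 by simp
    fix T assume T: "T \<in> \<T>"
    have fT: "finite T" and bT: "b \<notin> T" using T fH finite_subset by (auto simp: \<T>_def H_def)
    have sub: "insert b T \<subseteq> P" using T b by (auto simp: \<T>_def H_def)
    have ct: "card (insert b T) = t" using T fT bT t by (simp add: \<T>_def)
    have "t + \<beta> \<le> card (\<Union>(insert b T)) + 1"
      using card_le_card_Union(2)[OF P sub, of b] ct by (simp add: \<beta>_def)
    hence "Stirling (n - card (\<Union>(insert b T))) 2 \<le> Stirling (n - t - \<beta> + 1) 2"
      using nt by (intro Stirling_mono_left) auto
    thus "card (star n (t + 2) (insert b T)) \<le> Stirling (n - t - \<beta> + 1) 2"
      using card_star[OF P sub, of "t + 2"] ct by simp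
  qed
  also have "(\<Sum>T\<in>\<T>. Stirling (n - t - \<beta> + 1) 2) = ((t + 1) choose 2) * Stirling (n - t - \<beta> + 1) 2"
    using n_subsets[OF fH, of "t - 1"] cH t binomial_symmetric[of 2 "t + 1"] by (simp add: \<T>_def)
  also have "\<dots> < t * Stirling (n - t - 1) 2"
  proof -
    define M where "M = (2::nat) ^ (n - t - \<beta>)"
    have "(t + 2) * M \<le> 2 ^ (\<beta> - 1) * M" using K\<beta> t by (intro mult_right_mono) auto
    also have "\<dots> = 2 * 2 ^ (n - t - 2)" using \<beta>2 nt by (simp add: M_def flip: power_add power_Suc)
    finally have "(t + 2) * M \<le> 2 * 2 ^ (n - t - 2)" .
    moreover have "M \<ge> 1" by (simp add: M_def)
    moreover have "(t + 1) * (M - 1) + (t + 1) = (t + 1) * M"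
      using \<open>M \<ge> 1\<close> by (metis le_add_diff_inverse2 mult.right_neutral distrib_left)
    ultimately have "(t + 1) * (M - 1) < 2 * (2 ^ (n - t - 2) - 1)" using t by simp
    moreover have "Stirling (n - t - \<beta> + 1) 2 = M - 1" using Stirling_two[of "n - t - \<beta> + 1"] by (simp add: M_def)
    moreover have "Stirling (n - t - 1) 2 = 2 ^ (n - t - 2) - 1"
      using Stirling_two[of "n - t - 1"] nt \<beta>2 by (simp add: numeral_2_eq_2)
    ultimately have "(t + 1) * Stirling (n - t - \<beta> + 1) 2 < 2 * Stirling (n - t - 1) 2" by simp
    hence "t * ((t + 1) * Stirling (n - t - \<beta> + 1) 2) < t * (2 * Stirling (n - t - 1) 2)" using t by simp
    moreover have "2 * ((t + 1) choose 2) = t * (t + 1)" by (simp add: choose_two)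
    ultimately have "2 * (((t + 1) choose 2) * Stirling (n - t - \<beta> + 1) 2) < 2 * (t * Stirling (n - t - 1) 2)"
      by (metis mult.assoc mult.left_commute)
    thus ?thesis by simp
  qed
  finally show ?thesis by (simp add: top_bound_def)
qed

section \<open>Cross-intersecting families\<close>

text \<open>If \<open>X\<close> meets some \<open>H\<close> in fewer than \<open>h\<close> blocks, a
  member of \<open>Fam\<close> containing \<open>X\<close> must contain a further block of
  \<open>H\<close>, one of at most \<open>K\<close>. This can be repeated until \<open>X\<close> has
  \<open>x\<close> blocks. The core \<open>T\<^sub>0\<close> restricts the assumption on covers to
  its supersets, as needed when only covers extending a fixed trace can be excluded.\<close>

lemma branching:
  assumes Fam: "Fam \<subseteq> Pi_part n k" "1 \<le> k" "k \<le> K"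
    and hit: "\<And>G H. G \<in> Fam \<Longrightarrow> H \<in> HH \<Longrightarrow> h \<le> card (G \<inter> H)"
    and HH: "\<And>H. H \<in> HH \<Longrightarrow> finite H \<and> card H \<le> K"
    and cov: "\<And>X. finite X \<Longrightarrow> T\<^sub>0 \<subseteq> X \<Longrightarrow> card X < x \<Longrightarrow> \<exists>H\<in>HH. card (X \<inter> H) < h"
    and "T\<^sub>0 \<subseteq> T" "finite T" "card T + e \<le> x"
  shows "card {G \<in> Fam. T \<subseteq> G} \<le> K ^ e * star_bound n k (card T + e)"
  using assms(7-9)
proof (induction e arbitrary: T)
  case 0
  have "{G \<in> Fam. T \<subseteq> G} \<subseteq> star n k T" using Fam by (auto simp: star_def)
  hence "card {G \<in> Fam. T \<subseteq> G} \<le> card (star n k T)" by (intro card_mono) auto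
  also have "\<dots> \<le> star_bound n k (card T)" using Fam n_ge_2K 0 by (intro card_star_le) auto
  finally show ?case by simp
next
  case (Suc e)
  obtain H where H: "H \<in> HH" "card (T \<inter> H) < h" using cov[of T] Suc.prems by auto
  have fH: "finite H" "card H \<le> K" using HH[OF H(1)] by auto
  have ff: "finite Fam" using Fam(1) finite_subset finite_Pi_part by blast
  have "{G \<in> Fam. T \<subseteq> G} \<subseteq> (\<Union>y\<in>H - T. {G \<in> Fam. insert y T \<subseteq> G})"
  proof
    fix G assume G: "G \<in> {G \<in> Fam. T \<subseteq> G}"
    have "\<not> G \<inter> H \<subseteq> T \<inter> H"
    proof
      assume "G \<inter> H \<subseteq> T \<inter> H"
      hence "card (G \<inter> H) \<le> card (T \<inter> H)" using fH by (intro card_mono) auto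
      thus False using hit[of G H] G H by auto
    qed
    thus "G \<in> (\<Union>y\<in>H - T. {G \<in> Fam. insert y T \<subseteq> G})" using G by auto
  qed
  hence "card {G \<in> Fam. T \<subseteq> G} \<le> card (\<Union>y\<in>H - T. {G \<in> Fam. insert y T \<subseteq> G})"
    using fH ff by (intro card_mono) auto
  also have "\<dots> \<le> (\<Sum>y\<in>H - T. card {G \<in> Fam. insert y T \<subseteq> G})" using fH by (intro card_UN_le) auto
  also have "\<dots> \<le> (\<Sum>y\<in>H - T. K ^ e * star_bound n k (card T + Suc e))"
  proof (intro sum_mono)
    fix y assume "y \<in> H - T"
    thus "card {G \<in> Fam. insert y T \<subseteq> G} \<le> K ^ e * star_bound n k (card T + Suc e)"
      using Suc.IH[of "insert y T"] Suc.prems by (simp add: subset_insertI2)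
  qed
  also have "\<dots> = card (H - T) * (K ^ e * star_bound n k (card T + Suc e))" by simp
  also have "\<dots> \<le> K * (K ^ e * star_bound n k (card T + Suc e))"
    using fH card_mono[of H "H - T"] by (intro mult_right_mono) auto
  finally show ?case by simp
qed

text \<open>Every member contains \<open>h\<close> blocks of \<open>Y\<close>; the binomial
  coefficient counts these starting sets, and \<open>branching\<close> continues from each.\<close>

lemma branching_from_cover:
  assumes Fam: "Fam \<subseteq> Pi_part n k" "1 \<le> k" "k \<le> K"
    and hit: "\<And>G H. G \<in> Fam \<Longrightarrow> H \<in> HH \<Longrightarrow> h \<le> card (G \<inter> H)"
    and HH: "\<And>H. H \<in> HH \<Longrightarrow> finite H \<and> card H \<le> K"
    and cov: "\<And>X. finite X \<Longrightarrow> card X < x \<Longrightarrow> \<exists>H\<in>HH. card (X \<inter> H) < h"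
    and Y: "finite Y" "\<And>G. G \<in> Fam \<Longrightarrow> h \<le> card (G \<inter> Y)" and he: "h + e \<le> x"
  shows "card Fam \<le> (card Y choose h) * (K ^ e * star_bound n k (h + e))"
proof -
  define \<T> where "\<T> = {T. T \<subseteq> Y \<and> card T = h}"
  have f: "finite \<T>" using Y by (auto simp: \<T>_def)
  have ff: "finite Fam" using Fam(1) finite_subset finite_Pi_part by blast
  have "Fam \<subseteq> (\<Union>T\<in>\<T>. {G \<in> Fam. T \<subseteq> G})"
  proof
    fix G assume G: "G \<in> Fam"
    then obtain T where "T \<subseteq> G \<inter> Y" "card T = h" using Y(2) obtain_subset_with_card_n by metis
    thus "G \<in> (\<Union>T\<in>\<T>. {G \<in> Fam. T \<subseteq> G})" using G by (auto simp: \<T>_def)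
  qed
  hence "card Fam \<le> card (\<Union>T\<in>\<T>. {G \<in> Fam. T \<subseteq> G})" using f ff by (intro card_mono) auto
  also have "\<dots> \<le> (\<Sum>T\<in>\<T>. card {G \<in> Fam. T \<subseteq> G})" using f by (rule card_UN_le)
  also have "\<dots> \<le> (\<Sum>T\<in>\<T>. K ^ e * star_bound n k (h + e))"
  proof (intro sum_mono)
    fix T assume "T \<in> \<T>"
    hence "finite T" "card T = h" using Y(1) finite_subset by (auto simp: \<T>_def)
    thus "card {G \<in> Fam. T \<subseteq> G} \<le> K ^ e * star_bound n k (h + e)"
      using branching[OF Fam hit HH cov, where T = T and e = e and T\<^sub>0 = "{}"] he by simp
  qed
  finally show ?thesis using n_subsets[OF Y(1), of h] by (simp add: \<T>_def)
qed

end

text \<open>The index set is variable so that the families other than \<open>F a\<close> can be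
  treated on their own.\<close>

definition cross_intersecting_on :: "nat set \<Rightarrow> nat \<Rightarrow> (nat \<Rightarrow> nat set set set) \<Rightarrow> bool" where
  "cross_intersecting_on I h F \<longleftrightarrow> (\<forall>G. (\<forall>i\<in>I. G i \<in> F i) \<longrightarrow> h \<le> card (\<Inter>i\<in>I. G i))"

lemma cross_intersecting_onD:
  "cross_intersecting_on I h F \<Longrightarrow> (\<And>i. i \<in> I \<Longrightarrow> G i \<in> F i) \<Longrightarrow> h \<le> card (\<Inter>i\<in>I. G i)"
  by (simp add: cross_intersecting_on_def)

lemma cross_intersecting_on_mono:
  assumes "cross_intersecting_on I h F" "J \<subseteq> I" "J \<noteq> {}" "h' \<le> h"
    and "\<And>i. i \<in> I \<Longrightarrow> F i \<noteq> {} \<and> F i \<subseteq> Pi_part n (k i)"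
  shows "cross_intersecting_on J h' F"
  unfolding cross_intersecting_on_def
proof (intro allI impI)
  fix G assume G: "\<forall>i\<in>J. G i \<in> F i"
  define G' where "G' i = (if i \<in> J then G i else (SOME P. P \<in> F i))" for i
  have "G' i \<in> F i" if "i \<in> I" for i
    using G assms(5)[OF that] by (auto simp: G'_def some_in_eq)
  hence "h \<le> card (\<Inter>i\<in>I. G' i)" by (rule cross_intersecting_onD[OF assms(1)])
  also have "\<dots> \<le> card (\<Inter>i\<in>J. G i)"
  proof (rule card_mono)
    obtain j where j: "j \<in> J" using assms(3) by auto
    hence "finite (G j)" using assms G Pi_part_finite by blast
    thus "finite (\<Inter>i\<in>J. G i)" using j by (meson INT_lower finite_subset)
    show "(\<Inter>i\<in>I. G' i) \<subseteq> (\<Inter>i\<in>J. G i)" using assms(2) by (auto simp: G'_def)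
  qed
  finally show "h' \<le> card (\<Inter>i\<in>J. G i)" using assms(4) by simp
qed

lemma cross_intersecting_on_pair:
  assumes "cross_intersecting_on I h F" "i \<in> I" "j \<in> I" "i \<noteq> j" "P \<in> F i" "Q \<in> F j"
    and "\<And>i. i \<in> I \<Longrightarrow> F i \<noteq> {} \<and> F i \<subseteq> Pi_part n (k i)"
  shows "h \<le> card (P \<inter> Q)"
proof -
  have "cross_intersecting_on {i, j} h F"
    using assms by (intro cross_intersecting_on_mono[OF assms(1), where n = n and k = k]) auto
  moreover have "(if l = i then P else Q) \<in> F l" if "l \<in> {i, j}" for l using assms that by auto
  ultimately have "h \<le> card (\<Inter>l\<in>{i, j}. if l = i then P else Q)" by (rule cross_intersecting_onD)
  thus ?thesis using assms(4) by (simp add: Int_commute)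
qed

text \<open>For \<open>k = h + 1\<close> a cover may have size \<open>h + 1\<close> although \<open>h\<close> blocks determine the partition, so branching
  gains nothing and the binomial coefficient \<open>(h + 1) choose h\<close> survives.\<close>

definition ekr_bound :: "nat \<Rightarrow> nat \<Rightarrow> nat \<Rightarrow> nat" where
  "ekr_bound n k h = (if k = h + 1 then h + 1 else star_bound n k h)"

context large_ground
begin

text \<open>For \<open>h + 2 <= k\<close> the binomial coefficient and the branching cost
  \<open>K^e\<close> each, within the decay \<open>(2 * K^2)^e\<close>. Otherwise
  \<open>e = 0\<close>: \<open>h\<close> blocks leave at most one partition, and only
  \<open>x = h + 1 = k\<close> has a binomial coefficient above 1.\<close>

lemma cover_bound_le_ekr_bound:
  assumes "h \<le> x" "x \<le> k" "k \<le> K" "1 \<le> k"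
  defines "e \<equiv> (if h + 2 \<le> k then x - h else 0)"
  shows "(x choose h) * (K ^ e * star_bound n k (h + e)) \<le> ekr_bound n k h"
proof (cases "h + 2 \<le> k")
  case True
  have x: "x = h + e" using assms True by simp
  have "(x choose h) \<le> K ^ e"
  proof -
    have "(x choose h) \<le> (h + 1) ^ e" unfolding x by (rule choose_add_le_power)
    also have "\<dots> \<le> K ^ e" using True assms by (intro power_mono) auto
    finally show ?thesis .
  qed
  hence "(x choose h) * (K ^ e * star_bound n k (h + e)) \<le> K ^ e * (K ^ e * star_bound n k (h + e))"
    by (rule mult_right_mono) simp
  also have "\<dots> = star_bound n k (h + e) * (K ^ 2) ^ e" by (simp add: power2_eq_square power_mult_distrib mult_ac)
  also have "\<dots> \<le> star_bound n k (h + e) * (2 * K ^ 2) ^ e" by (intro mult_left_mono power_mono) auto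
  also have "\<dots> \<le> star_bound n k h" using True assms(2,3) unfolding x by (intro star_bound_decay)
  finally show ?thesis using True by (simp add: ekr_bound_def)
next
  case False
  hence e: "e = 0" by (simp add: e_def)
  have s: "star_bound n k h \<le> 1"
  proof (cases "h < k")
    case True
    hence "k - h = 1" "n - h \<ge> 1" using False assms n_ge_2K by auto
    thus ?thesis using Stirling_one by (simp add: star_bound_def)
  qed (simp add: star_bound_def)
  consider "x = h" | "x = h + 1" "k = h + 1" using False assms by linarith
  thus ?thesis
  proof cases
    case 1
    thus ?thesis using s e by (auto simp: ekr_bound_def)
  next
    case 2
    have "(h + 1) * star_bound n k h \<le> (h + 1) * 1" using s by (rule mult_left_mono) simp
    thus ?thesis using 2 e by (simp add: ekr_bound_def)
  qed
qed

text \<open>Every member of \<open>F i\<close> meets a smallest cover \<open>X j\<close> of the intersections avoiding index \<open>j \<noteq> i\<close>, and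
  branching up to the cover number of \<open>i\<close> bounds \<open>card (F i)\<close>. Using the smallest cover for all indices but
  its own makes the bounds multiply up to the product of the diagonal ones.\<close>

theorem cross_intersecting_prod_le:
  assumes I: "finite I" "2 \<le> card I" and cross: "cross_intersecting_on I h F"
    and F: "\<And>i. i \<in> I \<Longrightarrow> F i \<noteq> {} \<and> F i \<subseteq> Pi_part n (k i)"
    and k: "\<And>i. i \<in> I \<Longrightarrow> 1 \<le> k i \<and> k i \<le> K"
  shows "(\<Prod>i\<in>I. card (F i)) \<le> (\<Prod>i\<in>I. ekr_bound n (k i) h)"
proof -
  define HH where "HH i = {\<Inter>j\<in>I - {i}. G j |G. \<forall>j\<in>I - {i}. G j \<in> F j}" for i
  define cov where "cov i X \<longleftrightarrow> finite X \<and> (\<forall>H\<in>HH i. h \<le> card (X \<inter> H))" for i and X :: "nat set set"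
  have other: "\<exists>j\<in>I. j \<noteq> i" for i
  proof (rule ccontr)
    assume "\<not> (\<exists>j\<in>I. j \<noteq> i)"
    hence "I \<subseteq> {i}" by auto
    hence "card I \<le> 1" using card_mono[of "{i}" I] by simp
    thus False using I by simp
  qed
  have fin: "finite P" "card P = k i" if "P \<in> F i" "i \<in> I" for P i
    using that F Pi_part_finite Pi_part_card by blast+
  have HHfin: "finite H \<and> card H \<le> K" if iH: "H \<in> HH i" "i \<in> I" for H i
  proof -
    obtain j where j: "j \<in> I" "j \<noteq> i" using other by blast
    obtain G where G: "H = (\<Inter>j\<in>I - {i}. G j)" "\<forall>j\<in>I - {i}. G j \<in> F j" using iH by (auto simp: HH_def)
    have "H \<subseteq> G j" "G j \<in> F j" using G j by auto
    thus ?thesis using fin[of "G j" j] j k by (metis card_mono finite_subset order_trans)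
  qed
  have sub: "\<exists>H\<in>HH i. H \<subseteq> P" if "P \<in> F j" "i \<in> I" "j \<in> I" "j \<noteq> i" for P i j
  proof -
    define G where "G l = (if l = j then P else (SOME Q. Q \<in> F l))" for l
    have "\<forall>l\<in>I - {i}. G l \<in> F l" using that F by (auto simp: G_def some_in_eq)
    hence "(\<Inter>l\<in>I - {i}. G l) \<in> HH i" by (auto simp: HH_def)
    moreover have "(\<Inter>l\<in>I - {i}. G l) \<subseteq> P" using that by (auto simp: G_def split: if_splits)
    ultimately show ?thesis by blast
  qed
  have mem_cov: "cov i P" if "P \<in> F i" "i \<in> I" for P i
    unfolding cov_def
  proof (intro conjI ballI)
    show "finite P" using fin that by blast
    fix H assume "H \<in> HH i"
    then obtain G where G: "H = (\<Inter>j\<in>I - {i}. G j)" "\<forall>j\<in>I - {i}. G j \<in> F j" by (auto simp: HH_def)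
    have "h \<le> card (\<Inter>j\<in>I. (G(i := P)) j)"
      using G that by (intro cross_intersecting_onD[OF cross]) auto
    also have "(\<Inter>j\<in>I. (G(i := P)) j) = P \<inter> H" using that G by (auto split: if_splits)
    finally show "h \<le> card (P \<inter> H)" .
  qed
  define X where "X i = (ARG_MIN card X. cov i X)" for i
  have X: "cov i (X i)" "\<And>Y. cov i Y \<Longrightarrow> card (X i) \<le> card Y" if iI: "i \<in> I" for i
  proof -
    obtain P where P: "P \<in> F i" using F[OF iI] by blast
    note * = arg_min_nat_lemma[of "cov i" P card, OF mem_cov[OF P iI]]
    show "cov i (X i)" "\<And>Y. cov i Y \<Longrightarrow> card (X i) \<le> card Y" using * unfolding X_def by blast+
  qed
  define x where "x i = card (X i)" for i
  have xk: "x i \<le> k i" if "i \<in> I" for i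
    using X(2)[OF that mem_cov] F[OF that] fin that unfolding x_def by (metis ex_in_conv)
  have hit: "h \<le> card (P \<inter> X j)" if P: "P \<in> F i" "i \<in> I" "j \<in> I" "i \<noteq> j" for P i j
  proof -
    obtain H where H: "H \<in> HH j" "H \<subseteq> P" using sub[OF P(1,3,2,4)] by blast
    have "h \<le> card (X j \<inter> H)" using X(1)[OF P(3)] H by (auto simp: cov_def)
    also have "\<dots> \<le> card (P \<inter> X j)" using H X(1)[OF P(3)] by (intro card_mono) (auto simp: cov_def)
    finally show ?thesis .
  qed
  have hx: "h \<le> x i" if iI: "i \<in> I" for i
  proof -
    obtain j where j: "j \<in> I" "j \<noteq> i" using other by blast
    obtain P where P: "P \<in> F j" using F[OF j(1)] by auto
    have "h \<le> card (P \<inter> X i)" using hit[OF P j(1) iI j(2)] .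
    also have "\<dots> \<le> x i" unfolding x_def using X(1)[OF iI] by (intro card_mono) (auto simp: cov_def)
    finally show ?thesis .
  qed
  define e where "e i = (if h + 2 \<le> k i then x i - h else 0)" for i
  define c where "c i = x i choose h" for i
  define d where "d i = K ^ e i * star_bound n (k i) (h + e i)" for i
  have le: "card (F i) \<le> c j * d i" if ij: "i \<in> I" "j \<in> I" "i \<noteq> j" for i j
    unfolding c_def d_def x_def
  proof (rule branching_from_cover[where HH = "HH i" and x = "x i"])
    show "F i \<subseteq> Pi_part n (k i)" "1 \<le> k i" "k i \<le> K" using F k ij by auto
    show "h \<le> card (G \<inter> H)" if "G \<in> F i" "H \<in> HH i" for G H
      using mem_cov[OF that(1) ij(1)] that(2) by (simp add: cov_def)
    show "finite H \<and> card H \<le> K" if "H \<in> HH i" for H using HHfin that ij by blast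
    show "\<exists>H\<in>HH i. card (Y \<inter> H) < h" if "finite Y" "card Y < x i" for Y
      using X(2)[OF ij(1), of Y] that by (force simp: cov_def x_def not_le)
    show "finite (X j)" using X(1)[OF ij(2)] by (simp add: cov_def)
    show "h \<le> card (G \<inter> X j)" if "G \<in> F i" for G using hit that ij by blast
    show "h + e i \<le> x i" using hx ij by (auto simp: e_def)
  qed
  have cd: "c i * d i \<le> ekr_bound n (k i) h" if "i \<in> I" for i
    unfolding c_def d_def e_def using cover_bound_le_ekr_bound[OF hx[OF that] xk[OF that]] k[OF that] by simp
  obtain j0 where j0: "j0 \<in> I" "\<And>i. i \<in> I \<Longrightarrow> x j0 \<le> x i"
    using ex_has_least_nat[of "\<lambda>i. i \<in> I" _ x] I(2) by (metis card.empty ex_in_conv not_numeral_le_zero)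
  obtain j1 where j1: "j1 \<in> I" "j1 \<noteq> j0" using other by blast
  have c0: "c j0 \<le> c i" if "i \<in> I" for i unfolding c_def using j0 that by (intro binomial_right_mono) auto
  have split: "(\<Prod>i\<in>I. f i) = f j0 * f j1 * (\<Prod>i\<in>I - {j0, j1}. f i)" for f :: "nat \<Rightarrow> nat"
    using I(1) j0(1) j1 prod.remove[of I j0 f] prod.remove[of "I - {j0}" j1 f]
    by (simp add: insert_commute Diff_insert2[symmetric] mult.assoc)
  \<comment> \<open>\<open>F j0\<close> cannot use its own cover and takes that of
    \<open>j1\<close>, while \<open>F j1\<close> takes that of \<open>j0\<close>; the coefficients
    \<open>c j0\<close> and \<open>c j1\<close> are merely swapped. For all other indices
    \<open>c j0 <= c i\<close>.\<close>
  have "(\<Prod>i\<in>I. card (F i)) \<le> (c j1 * d j0) * (c j0 * d j1) * (\<Prod>i\<in>I - {j0, j1}. c i * d i)"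
    unfolding split
  proof (intro mult_le_mono prod_mono conjI)
    fix i assume i: "i \<in> I - {j0, j1}"
    have "card (F i) \<le> c j0 * d i" using i j0 by (intro le) auto
    also have "\<dots> \<le> c i * d i" using c0 i by (intro mult_right_mono) auto
    finally show "card (F i) \<le> c i * d i" .
  qed (use le j0 j1 in auto)
  also have "\<dots> = (\<Prod>i\<in>I. c i * d i)" unfolding split by simp
  also have "\<dots> \<le> (\<Prod>i\<in>I. ekr_bound n (k i) h)" using cd by (intro prod_mono) auto
  finally show ?thesis .
qed

lemma star_bound_pred: "1 \<le> k \<Longrightarrow> k \<le> K \<Longrightarrow> k \<le> h + 1 \<Longrightarrow> star_bound n k h = 1"
proof (cases "h < k")
  case True
  assume "1 \<le> k" "k \<le> K" "k \<le> h + 1"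
  hence "k - h = 1" "n - h \<ge> 1" using True n_ge_2K by auto
  thus ?thesis using Stirling_one True by (simp add: star_bound_def)
qed (simp add: star_bound_def)

text \<open>\<open>ekr_bound\<close> brings a factor \<open>h + 1\<close> for every index with
  \<open>k i = h + 1\<close>; only one may remain. Members of two such families share
  \<open>h\<close> blocks and hence coincide, so with two such indices all these families are single
  partitions. All but one of the indices can then be dropped without changing either
  product.\<close>

corollary cross_intersecting_prod_le':
  assumes I: "finite I" "2 \<le> card I" and cross: "cross_intersecting_on I h F"
    and F: "\<And>i. i \<in> I \<Longrightarrow> F i \<noteq> {} \<and> F i \<subseteq> Pi_part n (k i)"
    and k: "\<And>i. i \<in> I \<Longrightarrow> h + 1 \<le> k i \<and> k i \<le> K"
  shows "(\<Prod>i\<in>I. card (F i)) \<le> (h + 1) * (\<Prod>i\<in>I. star_bound n (k i) h)"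
proof -
  define D where "D = {i\<in>I. k i = h + 1}"
  have fD: "finite D" "D \<subseteq> I" using I by (auto simp: D_def)
  have sD: "star_bound n (k i) h = 1" if "i \<in> D" for i
    using that k[of i] by (intro star_bound_pred) (auto simp: D_def)
  have eI: "ekr_bound n (k i) h = star_bound n (k i) h" if "i \<in> I - D" for i
    using that by (simp add: ekr_bound_def D_def)
  have sI: "(\<Prod>i\<in>I. star_bound n (k i) h) = (\<Prod>i\<in>I - D. star_bound n (k i) h)"
    using prod.subset_diff[OF fD(2) I(1), of "\<lambda>i. star_bound n (k i) h"] sD by simp
  show ?thesis
  proof (cases "card D \<le> 1")
    case True
    have "(\<Prod>i\<in>I. card (F i)) \<le> (\<Prod>i\<in>I. ekr_bound n (k i) h)"
    proof (rule cross_intersecting_prod_le[OF I cross F])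
      show "1 \<le> k i \<and> k i \<le> K" if "i \<in> I" for i using k[OF that] by simp
    qed
    also have "\<dots> = (\<Prod>i\<in>I - D. star_bound n (k i) h) * (\<Prod>i\<in>D. h + 1)"
      using prod.subset_diff[OF fD(2) I(1), of "\<lambda>i. ekr_bound n (k i) h"] eI by (simp add: ekr_bound_def D_def)
    also have "\<dots> \<le> (\<Prod>i\<in>I - D. star_bound n (k i) h) * (h + 1)"
      using power_increasing[OF True, of "h + 1"] by (intro mult_left_mono) auto
    finally show ?thesis by (simp add: sI mult.commute)
  next
    case False
    have single: "card (F i) = 1" if i: "i \<in> D" for i
    proof -
      have "\<exists>j\<in>D. j \<noteq> i"
      proof (rule ccontr)
        assume "\<not> (\<exists>j\<in>D. j \<noteq> i)"
        hence "D \<subseteq> {i}" by auto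
        thus False using False card_mono[of "{i}" D] by simp
      qed
      then obtain j where j: "j \<in> D" "j \<noteq> i" by blast
      obtain Q where Q: "Q \<in> F j" using F j fD by blast
      have "P = Q" if "P \<in> F i" for P
      proof (rule Pi_part_eqI)
        show "P \<in> Pi_part n (h + 1)" "Q \<in> Pi_part n (h + 1)" using that Q F[of i] F[of j] i j by (auto simp: D_def)
        show "h + 1 \<le> card (P \<inter> Q) + 1"
          using cross_intersecting_on_pair[OF cross _ _ _ that Q F] i j by (auto simp: D_def)
        show "h + 1 < n" using k i n_ge_2K by (force simp: D_def)
      qed simp
      hence "F i = {Q}" using F[of i] i fD by auto
      thus ?thesis by simp
    qed
    obtain d where d: "d \<in> D" using False by (cases "D = {}") auto
    define J where "J = insert d (I - D)"
    have J: "finite J" "J \<subseteq> I" "J \<noteq> {}" using I d fD by (auto simp: J_def)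
    have pI: "(\<Prod>i\<in>I. card (F i)) = (\<Prod>i\<in>I - D. card (F i))"
      using prod.subset_diff[OF fD(2) I(1), of "\<lambda>i. card (F i)"] single by simp
    have pJ: "(\<Prod>i\<in>J. card (F i)) = (\<Prod>i\<in>I - D. card (F i))"
      using single d I by (simp add: J_def)
    show ?thesis
    proof (cases "I - D = {}")
      case True
      then show ?thesis unfolding pI sI by (simp only: True) simp
    next
      case False
      have "card J = Suc (card (I - D))" unfolding J_def using I d by (intro card_insert_disjoint) auto
      moreover have "card (I - D) > 0" using False I by (simp add: card_gt_0_iff)
      ultimately have "2 \<le> card J" by simp
      have "(\<Prod>i\<in>J. card (F i)) \<le> (\<Prod>i\<in>J. ekr_bound n (k i) h)"
      proof (rule cross_intersecting_prod_le[OF J(1) \<open>2 \<le> card J\<close>])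
        show "cross_intersecting_on J h F" using cross_intersecting_on_mono[OF cross J(2,3) order_refl F] .
        show "F i \<noteq> {} \<and> F i \<subseteq> Pi_part n (k i)" if "i \<in> J" for i using that F J by blast
        show "1 \<le> k i \<and> k i \<le> K" if "i \<in> J" for i using k[of i] that J by auto
      qed
      also have "\<dots> = (h + 1) * (\<Prod>i\<in>I - D. star_bound n (k i) h)"
        unfolding J_def using I d eI by (subst prod.insert) (auto simp: ekr_bound_def D_def)
      finally show ?thesis by (simp add: pI sI pJ)
    qed
  qed
qed

lemma star_bound_pos: "1 \<le> k \<Longrightarrow> k \<le> K \<Longrightarrow> 0 < star_bound n k j"
  using n_ge_2K by (auto simp: star_bound_def intro!: Stirling_pos)

lemma top_bound_eq:
  assumes "t + 2 \<le> k" "k \<le> K"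
  shows "top_bound n k t + t * star_bound n k (t + 1) = (t + 1) * star_bound n k t"
proof -
  have "Stirling (n - t) (k - t) = (k - t) * Stirling (n - t - 1) (k - t) + Stirling (n - t - 1) (k - t - 1)"
    using assms n_ge_2K by (intro Stirling_rec) auto
  moreover have "star_bound n k t = Stirling (n - t) (k - t)" "star_bound n k (t + 1) = Stirling (n - t - 1) (k - t - 1)"
    using assms by (simp_all add: star_bound_def)
  moreover define d where "d = k - t"
  ultimately show ?thesis unfolding top_bound_def d_def[symmetric] by (simp add: algebra_simps)
qed

lemma star_bound_le_top: "t + 2 \<le> k \<Longrightarrow> star_bound n k t \<le> top_bound n k t"
  by (simp add: top_bound_def star_bound_def)

lemma star_bound_step:
  assumes "t + 2 \<le> k" "k \<le> K"
  shows "2 * K ^ 2 * star_bound n k (t + 1) \<le> star_bound n k t"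
  using Stirling_ratio_ge[OF assms] assms by (simp add: star_bound_def)

text \<open>\<open>top_bound\<close> divided by the star bound at \<open>t + 1\<close> is
  \<open>(t + 1) * X / Y + 1\<close>, with \<open>X / Y\<close> the ratio of
  \<open>Stirling_ratio_decreasing\<close>. Exchanging the base for an index with smaller
  \<open>k\<close> therefore increases the bound.\<close>

lemma top_bound_ratio:
  assumes "t + 2 \<le> p" "p < q" "q \<le> K"
  shows "top_bound n q t * star_bound n p (t + 1) < top_bound n p t * star_bound n q (t + 1)"
proof -
  define m where "m = n - t - 1"
  define X where "X i = (i - t) * Stirling m (i - t)" for i
  define Y where "Y i = Stirling m (i - t - 1)" for i
  have top: "top_bound n i t = (t + 1) * X i + Y i" if "i \<in> {p, q}" for i
  proof -
    have "Stirling (n - t) (i - t) = X i + Y i"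
      unfolding X_def Y_def m_def using that assms n_ge_2K by (intro Stirling_rec) auto
    thus ?thesis by (simp add: top_bound_def X_def m_def)
  qed
  have s: "star_bound n i (t + 1) = Y i" if "i \<in> {p, q}" for i
    using that assms by (auto simp: star_bound_def Y_def m_def)
  have "X q * Y p < X p * Y q"
    unfolding X_def Y_def using assms n_ge_2K by (intro Stirling_ratio_decreasing) (auto simp: m_def)
  hence "(t + 1) * (X q * Y p) < (t + 1) * (X p * Y q)" by (simp only: mult_less_cancel1) simp
  thus ?thesis using top s by (simp add: algebra_simps)
qed

end

lemma mult_less_of_less_of_le: "a < b \<Longrightarrow> c \<le> d \<Longrightarrow> 0 < d \<Longrightarrow> a * c < b * d" for a b c d :: nat
  by (rule le_less_trans[of _ "a * d"]) auto

lemma prod_eq_imp_eq: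
  fixes f g :: "'a \<Rightarrow> nat"
  assumes "finite I" "\<And>i. i \<in> I \<Longrightarrow> f i \<le> g i" "\<And>i. i \<in> I \<Longrightarrow> 0 < g i" "(\<Prod>i\<in>I. g i) \<le> (\<Prod>i\<in>I. f i)" "i \<in> I"
  shows "f i = g i"
proof (rule ccontr)
  assume "f i \<noteq> g i"
  hence "f i < g i" using assms(2)[OF assms(5)] by simp
  moreover have "(\<Prod>j\<in>I - {i}. f j) \<le> (\<Prod>j\<in>I - {i}. g j)" using assms by (intro prod_mono) auto
  moreover have "(\<Prod>j\<in>I - {i}. g j) > 0" using assms by (intro prod_pos) auto
  ultimately have "f i * (\<Prod>j\<in>I - {i}. f j) < g i * (\<Prod>j\<in>I - {i}. g j)"
    by (rule mult_less_of_less_of_le)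
  hence "(\<Prod>i\<in>I. f i) < (\<Prod>i\<in>I. g i)" using prod.remove[OF assms(1,5)] by metis
  thus False using assms(4) by simp
qed

section \<open>Nontrivial families\<close>

text \<open>Nonemptiness is added to the hypotheses because traces need a member of every family;
  the final theorem treats empty families separately.\<close>

locale cross_families =
  fixes n r t :: nat and k :: "nat \<Rightarrow> nat" and F :: "nat \<Rightarrow> nat set set set"
  assumes r_ge_3: "r \<ge> 3" and t_ge_1: "t \<ge> 1"
    and k_mono: "\<And>i j. 1 \<le> i \<Longrightarrow> i \<le> j \<Longrightarrow> j \<le> r \<Longrightarrow> k j \<le> k i"
    and k_r: "k r \<ge> t + 2"
    and n_large: "real n \<ge> 5 - real (k 1) + 2 * real (k 1) * log 2 (real (k 1))"
    and F_sub: "\<And>i. i \<in> {1..r} \<Longrightarrow> F i \<subseteq> Pi_part n (k i)"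
    and F_ne: "\<And>i. i \<in> {1..r} \<Longrightarrow> F i \<noteq> {}"
    and cross: "cross_intersecting_on {1..r} t F"
    and nontriv: "non_trivial r t F"
begin

abbreviation "I \<equiv> {1..r}"
abbreviation "s i j \<equiv> star_bound n (k i) j"
abbreviation "tb i \<equiv> top_bound n (k i) t"
abbreviation "Z a \<equiv> (\<Prod>i\<in>I - {a}. s i (t + 1))"

definition extremal :: bool where
  "extremal \<longleftrightarrow> (\<exists>a\<in>I. k a = k r \<and> (\<exists>T. card T = t + 1 \<and> (\<forall>B\<in>T. \<exists>x\<in>{1..n}. B = {x}) \<and>
     F a = {P \<in> Pi_part n (k a). card (T \<inter> P) \<ge> t} \<and> (\<forall>i\<in>I - {a}. F i = {P \<in> Pi_part n (k i). T \<subseteq> P})))"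

definition bounded_with_extremal :: bool where
  "bounded_with_extremal \<longleftrightarrow> (\<Prod>i\<in>I. card (F i)) \<le> tb r * Z r \<and>
     ((\<Prod>i\<in>I. card (F i)) = tb r * Z r \<longrightarrow> extremal)"

lemma k_bounds: "i \<in> I \<Longrightarrow> t + 2 \<le> k i \<and> k i \<le> k 1 \<and> k r \<le> k i"
  using k_mono[of 1 i] k_mono[of i r] k_r by auto

sublocale large_ground n "k 1"
  using k_bounds[of r] r_ge_3 t_ge_1 n_large by unfold_locales auto

lemma I_facts [simp]: "r \<in> I" "1 \<in> I"
  using r_ge_3 by auto

lemma k_less_n: "i \<in> I \<Longrightarrow> k i < n"
  using k_bounds[of i] n_ge_2K by linarith

lemma s_pos: "i \<in> I \<Longrightarrow> 0 < s i j"
  using k_bounds[of i] by (intro star_bound_pos) auto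

lemma Z_pos: "0 < Z a"
  using s_pos by (intro prod_pos) auto

lemma memF: "A \<in> F i \<Longrightarrow> i \<in> I \<Longrightarrow> A \<in> Pi_part n (k i) \<and> finite A \<and> card A = k i"
  using F_sub[of i] Pi_part_finite[of A n "k i"] Pi_part_card[of A n "k i"] by auto

lemma finF: "i \<in> I \<Longrightarrow> finite (F i)"
  by (rule finite_subset[OF F_sub finite_Pi_part])

lemma F_pos: "i \<in> I \<Longrightarrow> 0 < card (F i)"
  using F_ne finF by (simp add: card_gt_0_iff)

lemma prod_split: "a \<in> I \<Longrightarrow> (\<Prod>i\<in>I. f i) = f a * (\<Prod>i\<in>I - {a}. f i)" for f :: "nat \<Rightarrow> nat"
  by (rule prod.remove) auto

lemma F_both: "i \<in> I \<Longrightarrow> F i \<noteq> {} \<and> F i \<subseteq> Pi_part n (k i)"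
  using F_ne F_sub by simp

lemma pair: "i \<in> I \<Longrightarrow> j \<in> I \<Longrightarrow> i \<noteq> j \<Longrightarrow> A \<in> F i \<Longrightarrow> B \<in> F j \<Longrightarrow> t \<le> card (A \<inter> B)"
  using cross_intersecting_on_pair[OF cross] F_both by blast

lemma card_F_le_star:
  assumes "i \<in> I" "finite T" "\<And>A. A \<in> F i \<Longrightarrow> T \<subseteq> A"
  shows "card (F i) \<le> s i (card T)"
proof -
  have "F i \<subseteq> star n (k i) T" using assms F_sub by (auto simp: star_def)
  hence "card (F i) \<le> card (star n (k i) T)" by (intro card_mono) auto
  also have "\<dots> \<le> s i (card T)" using assms k_less_n[of i] k_bounds[of i] by (intro card_star_le) auto
  finally show ?thesis .
qed

text \<open>The two products differ only in the factors of \<open>a\<close> and \<open>r\<close>.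
  The strict part forces \<open>k a = k r\<close> in the equality case.\<close>

lemma top_Z_le:
  assumes "a \<in> I"
  shows "tb a * Z a \<le> tb r * Z r" and "k a \<noteq> k r \<Longrightarrow> tb a * Z a < tb r * Z r"
proof -
  define W where "W = (\<Prod>i\<in>I - {a, r}. s i (t + 1))"
  have W: "W > 0" unfolding W_def using s_pos by (intro prod_pos) auto
  have Zs: "Z a = s r (t + 1) * W" "Z r = s a (t + 1) * W" if "a \<noteq> r"
  proof -
    have "I - {a} - {r} = I - {a, r}" "I - {r} - {a} = I - {a, r}" by auto
    thus "Z a = s r (t + 1) * W" "Z r = s a (t + 1) * W"
      using prod.remove[of "I - {a}" r "\<lambda>i. s i (t + 1)"] prod.remove[of "I - {r}" a "\<lambda>i. s i (t + 1)"] that assms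
      by (auto simp: W_def)
  qed
  show *: "tb a * Z a < tb r * Z r" if "k a \<noteq> k r"
  proof -
    have "tb a * s r (t + 1) < tb r * s a (t + 1)"
      using that k_bounds[OF assms] k_bounds[OF I_facts(1)] by (intro top_bound_ratio) auto
    hence "tb a * s r (t + 1) * W < tb r * s a (t + 1) * W" using W by simp
    thus ?thesis using Zs that by (cases "a = r") (simp_all add: mult.assoc)
  qed
  show "tb a * Z a \<le> tb r * Z r"
  proof (cases "k a = k r")
    case True
    then show ?thesis using Zs by (cases "a = r") simp_all
  qed (use * in auto)
qed

lemma bounded_if_less:
  assumes "a \<in> I" "(\<Prod>i\<in>I. card (F i)) < tb a * Z a"
  shows bounded_with_extremal
  using top_Z_le(1)[OF assms(1)] assms(2) by (simp add: bounded_with_extremal_def)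

text \<open>Suppose \<open>G\<close> misses \<open>b\<close>. Members of \<open>F a\<close>
  containing \<open>T - {b'}\<close>, for another block \<open>b'\<close>, find only
  \<open>t - 1\<close> common blocks with \<open>G\<close> inside that set, so they contain a
  further block of \<open>G\<close>: at most \<open>K\<close> stars of \<open>t + 1\<close> blocks.
  The remaining members lie in \<open>t\<close> stars of \<open>t\<close> blocks. Together this is
  less than \<open>top_bound\<close>.\<close>

lemma contains_of_full:
  assumes a: "a \<in> I" and T: "card T = t + 1" "T \<subseteq> P" "P \<in> Pi_part n q"
    and hit: "\<And>A. A \<in> F a \<Longrightarrow> t \<le> card (A \<inter> T)" and full: "card (F a) = tb a"
    and i: "i \<in> I - {a}" and G: "G \<in> F i"
  shows "T \<subseteq> G"
proof (rule ccontr)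
  assume "\<not> T \<subseteq> G"
  then obtain b where b: "b \<in> T" "b \<notin> G" by auto
  have fT: "finite T" using subset_Pi_part(1)[OF T(3,2)] .
  have "card (T - {b}) = t" using T(1) b fT by simp
  hence "T - {b} \<noteq> {}" using t_ge_1 by fastforce
  then obtain b' where b': "b' \<in> T" "b' \<noteq> b" by auto
  define \<A> where "\<A> = {A \<in> F a. T - {b'} \<subseteq> A}"
  have cT: "card (T - {c}) = t" if "c \<in> T" for c using that T(1) fT by simp
  have sa: "card (star n (k a) (T - {c})) \<le> s a t" if "c \<in> T" for c
    using card_star_le[of "k a" n "T - {c}"] cT[OF that] k_less_n[OF a] k_bounds[OF a] fT by simp
  have fA: "finite \<A>" using finF[OF a] by (simp add: \<A>_def)
  have "F a \<subseteq> near_star n (k a) t T" using hit F_sub[OF a] by (auto simp: near_star_def)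
  moreover have "A \<in> \<A> \<union> (\<Union>c\<in>T - {b'}. star n (k a) (T - {c}))"
    if A: "A \<in> F a" "A \<in> near_star n (k a) t T" for A
  proof -
    obtain c where "c \<in> T" "A \<in> star n (k a) (T - {c})"
      using near_star_cover[OF T(1), of n "k a"] A(2) by blast
    thus ?thesis using A(1) by (cases "c = b'") (auto simp: \<A>_def star_def)
  qed
  ultimately have "F a \<subseteq> \<A> \<union> (\<Union>c\<in>T - {b'}. star n (k a) (T - {c}))" by blast
  hence "tb a \<le> card (\<A> \<union> (\<Union>c\<in>T - {b'}. star n (k a) (T - {c})))"
    unfolding full[symmetric] using fA fT by (intro card_mono) auto
  also have "\<dots> \<le> card \<A> + (\<Sum>c\<in>T - {b'}. card (star n (k a) (T - {c})))"
    using fT by (intro order_trans[OF card_Un_le] add_left_mono card_UN_le) auto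
  also have "\<dots> \<le> card \<A> + (\<Sum>c\<in>T - {b'}. s a t)" using sa by (intro add_left_mono sum_mono) auto
  also have "\<dots> = card \<A> + t * s a t" using cT[OF b'(1)] by simp
  finally have 1: "tb a \<le> card \<A> + t * s a t" .
  have fG: "finite G" "card G \<le> k 1" using memF[OF G] i k_bounds by auto
  have "\<A> \<subseteq> (\<Union>y\<in>G - (T - {b'}). star n (k a) (insert y (T - {b'})))"
  proof
    fix A assume A: "A \<in> \<A>"
    have "\<not> A \<inter> G \<subseteq> T - {b'}"
    proof
      assume "A \<inter> G \<subseteq> T - {b'}"
      hence "A \<inter> G \<subseteq> T - {b'} - {b}" using b by auto
      hence "card (A \<inter> G) \<le> card (T - {b'} - {b})" using fT by (intro card_mono) auto
      also have "\<dots> = t - 1" using cT[OF b'(1)] b b' fT by simp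
      finally show False using pair[of a i A G] A G i a t_ge_1 by (auto simp: \<A>_def)
    qed
    thus "A \<in> (\<Union>y\<in>G - (T - {b'}). star n (k a) (insert y (T - {b'})))"
      using A F_sub[OF a] by (auto simp: \<A>_def star_def)
  qed
  hence "card \<A> \<le> card (\<Union>y\<in>G - (T - {b'}). star n (k a) (insert y (T - {b'})))"
    using fG by (intro card_mono) auto
  also have "\<dots> \<le> (\<Sum>y\<in>G - (T - {b'}). card (star n (k a) (insert y (T - {b'}))))"
    using fG by (intro card_UN_le) auto
  also have "\<dots> \<le> (\<Sum>y\<in>G - (T - {b'}). s a (t + 1))"
  proof (intro sum_mono)
    fix y assume "y \<in> G - (T - {b'})"
    hence "card (insert y (T - {b'})) = t + 1" using fT cT[OF b'(1)] by simp
    thus "card (star n (k a) (insert y (T - {b'}))) \<le> s a (t + 1)"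
      using card_star_le[of "k a" n "insert y (T - {b'})"] k_less_n[OF a] k_bounds[OF a] fT by simp
  qed
  also have "\<dots> \<le> k 1 * s a (t + 1)"
    using fG card_mono[of G "G - (T - {b'})"] by (simp add: mult_le_mono1)
  finally have 2: "card \<A> \<le> k 1 * s a (t + 1)" .
  have ka: "t + 2 \<le> k a" "k a \<le> k 1" using k_bounds[OF a] by auto
  have "(t + 1) * s a t \<le> k 1 * s a (t + 1) + t * s a t + t * s a (t + 1)"
    using 1 2 top_bound_eq[OF ka] by linarith
  hence "s a t \<le> (k 1 + t) * s a (t + 1)" by (simp add: algebra_simps)
  also have "\<dots> < 2 * (k 1) ^ 2 * s a (t + 1)"
  proof -
    have "3 * k 1 \<le> k 1 * k 1" using K_ge_3 by (intro mult_right_mono) auto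
    moreover have "t < k 1" using ka by linarith
    ultimately have "k 1 + t < 2 * (k 1) ^ 2" unfolding power2_eq_square by linarith
    thus ?thesis using s_pos[OF a] by simp
  qed
  finally show False using star_bound_step[OF ka] by simp
qed

text \<open>Every case that admits equality ends here. Equality forces \<open>k a = k r\<close> and
  \<open>F a\<close> of full size; a block of \<open>T\<close> with two elements would make
  \<open>F a\<close> too small. Then \<open>contains_of_full\<close> puts the other families into
  stars of \<open>T\<close>, and equal products make them equal to these stars.\<close>

lemma bounded_from_base:
  assumes a: "a \<in> I" and T: "card T = t + 1" "T \<subseteq> P" "P \<in> Pi_part n q"
    and hit: "\<And>A. A \<in> F a \<Longrightarrow> t \<le> card (A \<inter> T)"
    and rest: "(\<Prod>i\<in>I - {a}. card (F i)) \<le> Z a"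
  shows bounded_with_extremal
proof -
  have ka: "t + 2 \<le> k a" "k a \<le> k 1" using k_bounds[OF a] by auto
  have sub: "F a \<subseteq> near_star n (k a) t T" using hit F_sub[OF a] by (auto simp: near_star_def)
  hence le: "card (F a) \<le> card (near_star n (k a) t T)" by (intro card_mono) auto
  have le': "card (near_star n (k a) t T) \<le> tb a"
    using card_near_star_le[OF T(3,2,1) t_ge_1 ka(1) k_less_n[OF a]] .
  have prod_le: "(\<Prod>i\<in>I. card (F i)) \<le> tb a * Z a"
    unfolding prod_split[OF a] using le le' rest by (intro mult_le_mono) auto
  have extremal if eq: "(\<Prod>i\<in>I. card (F i)) = tb r * Z r"
  proof -
    have eq': "tb a * Z a = tb r * Z r" using top_Z_le(1)[OF a] prod_le eq by simp
    have kar: "k a = k r" using top_Z_le(2)[OF a] eq' by (cases "k a = k r") auto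
    have full: "card (F a) = tb a"
    proof (rule ccontr)
      assume "card (F a) \<noteq> tb a"
      hence "card (F a) < tb a" using le le' by simp
      hence "card (F a) * (\<Prod>i\<in>I - {a}. card (F i)) < tb a * Z a"
        using rest Z_pos by (rule mult_less_of_less_of_le)
      thus False using eq eq' unfolding prod_split[OF a] by simp
    qed
    have single: "\<forall>B\<in>T. card B = 1"
    proof (rule ccontr)
      assume "\<not> (\<forall>B\<in>T. card B = 1)"
      from card_near_star_big[OF T(3,2,1) t_ge_1 ka(1) k_less_n[OF a] this]
        near_star_big_less[OF T(3,2,1) t_ge_1 ka(1) k_less_n[OF a]] le full
      show False by simp
    qed
    have Fa: "F a = near_star n (k a) t T"
      using sub le le' full by (intro card_subset_eq) simp_all
    have fT: "finite T" using subset_Pi_part(1)[OF T(3,2)] .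
    have top_pos: "tb a > 0" using full F_pos[OF a] by simp
    have Fi: "F i = star n (k i) T" if i: "i \<in> I - {a}" for i
    proof -
      have sub: "F j \<subseteq> star n (k j) T" if j: "j \<in> I - {a}" for j
        using contains_of_full[OF a T hit full j] F_sub[of j] j by (auto simp: star_def)
      have le: "card (star n (k j) T) \<le> s j (t + 1)" if j: "j \<in> I - {a}" for j
        using card_star_le[of "k j" n T] T(1) fT k_less_n[of j] k_bounds[of j] j by simp
      have "card (F i) = s i (t + 1)"
      proof (rule prod_eq_imp_eq[of "I - {a}" "\<lambda>i. card (F i)" "\<lambda>i. s i (t + 1)", OF _ _ _ _ i])
        show "card (F j) \<le> s j (t + 1)" if "j \<in> I - {a}" for j
          using card_mono[OF finite_star sub[OF that]] le[OF that] by simp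
        show "Z a \<le> (\<Prod>i\<in>I - {a}. card (F i))"
        proof -
          have "tb a * (\<Prod>i\<in>I - {a}. card (F i)) = tb a * Z a"
            using eq eq' full unfolding prod_split[OF a] by simp
          thus ?thesis using top_pos unfolding mult_cancel1 by linarith
        qed
      qed (use s_pos in auto)
      thus ?thesis using sub[OF i] le[OF i] card_mono[OF finite_star sub[OF i]] by (intro card_subset_eq) simp_all
    qed
    have "\<exists>x\<in>{1..n}. B = {x}" if B: "B \<in> T" for B
    proof -
      have "card B = 1" using single B by blast
      then obtain x where x: "B = {x}" by (rule card_1_singletonE)
      hence "x \<in> {1..n}" using subset_Pi_part(3)[OF T(3,2)] B by blast
      thus ?thesis using x by blast
    qed
    moreover have "F a = {P \<in> Pi_part n (k a). card (T \<inter> P) \<ge> t}"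
      unfolding Fa near_star_def by (simp only: Int_commute)
    moreover have "\<forall>i\<in>I - {a}. F i = {P \<in> Pi_part n (k i). T \<subseteq> P}" using Fi unfolding star_def by blast
    ultimately show extremal unfolding extremal_def using a kar T(1) by blast
  qed
  thus ?thesis using prod_le top_Z_le(1)[OF a] by (simp add: bounded_with_extremal_def)
qed

section \<open>Traces: intersections over all indices but one\<close>

definition traces :: "nat \<Rightarrow> nat set set set" where
  "traces a = {\<Inter>i\<in>I - {a}. G i |G. \<forall>i\<in>I - {a}. G i \<in> F i}"

lemma traces_ne: "traces a \<noteq> {}"
proof -
  have "\<forall>i\<in>I - {a}. (SOME Q. Q \<in> F i) \<in> F i" using F_ne by (simp add: some_in_eq)
  hence "(\<Inter>i\<in>I - {a}. SOME Q. Q \<in> F i) \<in> traces a"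
    unfolding traces_def by (intro CollectI exI[of _ "\<lambda>i. SOME Q. Q \<in> F i"] conjI) auto
  thus ?thesis by blast
qed

lemma other_index: "\<exists>j\<in>I. j \<noteq> a \<and> j \<noteq> b"
proof -
  have "\<exists>j\<in>{1, 2, 3}. j \<noteq> a \<and> j \<noteq> b" by auto
  thus ?thesis using r_ge_3 by fastforce
qed

lemma trace_below:
  assumes "i \<in> I - {a}" "j \<in> I - {a}" "P \<in> F i" "Q \<in> F j" "i = j \<Longrightarrow> P = Q"
  shows "\<exists>H\<in>traces a. H \<subseteq> P \<inter> Q"
proof -
  define G where "G l = (if l = i then P else if l = j then Q else (SOME Q. Q \<in> F l))" for l
  have "\<forall>l\<in>I - {a}. G l \<in> F l" using assms F_ne by (auto simp: G_def some_in_eq)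
  hence "(\<Inter>l\<in>I - {a}. G l) \<in> traces a" by (auto simp: traces_def)
  moreover have "G i = P" "G j = Q" using assms(5) by (auto simp: G_def)
  hence "(\<Inter>l\<in>I - {a}. G l) \<subseteq> P \<inter> Q" using assms(1,2) by blast
  ultimately show ?thesis by blast
qed

lemma trace_above: "H \<in> traces a \<Longrightarrow> i \<in> I - {a} \<Longrightarrow> \<exists>P\<in>F i. H \<subseteq> P"
  unfolding traces_def by blast

lemma trace_finite: "H \<in> traces a \<Longrightarrow> finite H \<and> card H \<le> k 1"
proof -
  assume H: "H \<in> traces a"
  obtain j where j: "j \<in> I" "j \<noteq> a" using other_index by blast
  then obtain P where "P \<in> F j" "H \<subseteq> P" using trace_above[OF H, of j] by auto
  thus ?thesis using memF[of P j] k_bounds[of j] j by (metis card_mono finite_subset order_trans)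
qed

lemma trace_hit:
  assumes "a \<in> I" "A \<in> F a" "H \<in> traces a"
  shows "t \<le> card (A \<inter> H)"
proof -
  obtain G where G: "H = (\<Inter>j\<in>I - {a}. G j)" "\<forall>j\<in>I - {a}. G j \<in> F j" using assms by (auto simp: traces_def)
  have "t \<le> card (\<Inter>j\<in>I. (G(a := A)) j)"
    using G assms by (intro cross_intersecting_onD[OF cross]) auto
  also have "(\<Inter>j\<in>I. (G(a := A)) j) = A \<inter> H" using assms G by (auto split: if_splits)
  finally show ?thesis .
qed

lemma no_common_set:
  assumes "t \<le> card X" "\<And>i A. i \<in> I \<Longrightarrow> A \<in> F i \<Longrightarrow> X \<subseteq> A"
  shows False
proof -
  obtain A where A: "A \<in> F r" using F_ne[OF I_facts(1)] by blast
  have sub: "X \<subseteq> common_blocks r F" using assms(2) unfolding common_blocks_def by blast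
  have "common_blocks r F \<subseteq> A" using A I_facts(1) unfolding common_blocks_def by blast
  hence "finite (common_blocks r F)" using memF[OF A I_facts(1)] finite_subset by blast
  hence "card X \<le> card (common_blocks r F)" using sub card_mono by blast
  thus False using nontriv assms(1) by (simp add: non_trivial_def)
qed

text \<open>A trace of size \<open>t\<close> would equal \<open>X\<close>, and by
  \<open>trace_hit\<close> every member of \<open>F a\<close> would contain it too, against
  nontriviality.\<close>

lemma traces_large_if_common:
  assumes a: "a \<in> I" and X: "card X = t" and com: "\<And>i A. i \<in> I - {a} \<Longrightarrow> A \<in> F i \<Longrightarrow> X \<subseteq> A"
    and H: "H \<in> traces a"
  shows "t + 1 \<le> card H"
proof (rule ccontr)
  assume less: "\<not> t + 1 \<le> card H"
  have fH: "finite H" using trace_finite[OF H] by simp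
  have "X \<subseteq> H" using H com by (force simp: traces_def)
  hence XH: "X = H" using less X fH by (metis Suc_eq_plus1 card_mono card_subset_eq le_antisym not_less_eq_eq)
  have "X \<subseteq> A" if A: "A \<in> F a" for A
  proof -
    have "A \<inter> H = H"
      using trace_hit[OF a A H] X XH fH card_mono[of H "A \<inter> H"] by (intro card_subset_eq) auto
    thus ?thesis using XH by auto
  qed
  thus False using no_common_set[of X] X com by (metis Diff_iff order_refl singletonD)
qed

lemma card_F_le_choose:
  assumes a: "a \<in> I" and H: "H \<in> traces a"
  shows "card (F a) \<le> (card H choose t) * s a t"
proof -
  have "card (F a) \<le> (card H choose t) * (k 1 ^ 0 * s a (t + 0))"
  proof (rule branching_from_cover[where HH = "traces a" and x = t])
    show "\<exists>H\<in>traces a. card (X \<inter> H) < t" if "finite X" "card X < t" for X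
    proof -
      have "card (X \<inter> H) \<le> card X" using that by (intro card_mono) auto
      thus ?thesis using that H by (intro bexI[OF _ H]) auto
    qed
  qed (use a H k_bounds[OF a] F_sub[OF a] trace_hit[OF a] trace_finite in auto)
  thus ?thesis by simp
qed


lemma s_small: "i \<in> I \<Longrightarrow> k i = t + 2 \<Longrightarrow> j \<ge> t + 1 \<Longrightarrow> s i j = 1"
  using k_bounds[of i] by (intro star_bound_pred) auto

lemma Stirling_two_large: "i \<in> I \<Longrightarrow> k i = t + 2 \<Longrightarrow> k 1 ^ 6 \<le> s i t + 1"
  using Stirling_two_ge[of "k i"] k_bounds[of i] by (simp add: star_bound_def)

text \<open>Two different partitions into \<open>t + 2\<close> blocks cannot share
  \<open>t + 1\<close> of them. So the intersection has exactly \<open>t\<close> blocks, with no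
  slack left for a third family.\<close>

lemma small_pair:
  assumes "a \<in> I" "b \<in> I" "a \<noteq> b" "k a = t + 2" "k b = t + 2" "A \<in> F a" "B \<in> F b" "A \<noteq> B"
  shows "card (A \<inter> B) = t" "\<And>j G. j \<in> I - {a, b} \<Longrightarrow> G \<in> F j \<Longrightarrow> A \<inter> B \<subseteq> G"
proof -
  have AB: "A \<in> Pi_part n (t + 2)" "B \<in> Pi_part n (t + 2)" and fA: "finite A"
    using memF[OF assms(6,1)] memF[OF assms(7,2)] assms(4,5) by auto
  have lt: "t + 2 < n" using k_less_n[OF assms(1)] assms(4) by simp
  have "\<not> t + 1 \<le> card (A \<inter> B)"
  proof
    assume "t + 1 \<le> card (A \<inter> B)"
    hence "A = B" using AB lt by (intro Pi_part_eqI[of A n "t + 2" B]) auto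
    thus False using assms(8) by simp
  qed
  moreover have "t \<le> card (A \<inter> B)" using pair[OF assms(1,2,3,6,7)] .
  ultimately show c: "card (A \<inter> B) = t" by simp
  fix j G assume j: "j \<in> I - {a, b}" and G: "G \<in> F j"
  have cr: "cross_intersecting_on {a, b, j} t F"
    using assms j F_both by (intro cross_intersecting_on_mono[OF cross, where n = n and k = k]) auto
  define f where "f l = (if l = a then A else if l = b then B else G)" for l
  have "f l \<in> F l" if "l \<in> {a, b, j}" for l using that assms j G by (auto simp: f_def)
  from cross_intersecting_onD[OF cr this] have "t \<le> card (\<Inter>l\<in>{a, b, j}. f l)" .
  also have "(\<Inter>l\<in>{a, b, j}. f l) = A \<inter> B \<inter> G" using assms(3) j by (auto simp: f_def)
  finally have "A \<inter> B \<inter> G = A \<inter> B"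
    using c fA card_mono[of "A \<inter> B" "A \<inter> B \<inter> G"] by (intro card_subset_eq) auto
  thus "A \<inter> B \<subseteq> G" by auto
qed

text \<open>Here nontriviality raises the cover number to \<open>t + 2\<close>. All members of
  \<open>F a\<close> contain the \<open>t\<close>-trace \<open>T\<close>, so only covers above
  \<open>T\<close> matter. By \<open>traces_large_if_common\<close> no \<open>t\<close>-set lies in
  all families but one, hence partitions missing a block of \<open>T\<close> occur in two different
  families. A cover of size at most \<open>t + 1\<close> would then have \<open>t\<close> blocks
  common to all families but \<open>F a\<close>.\<close>

lemma card_F_le_if_traces_small:
  assumes small: "\<And>a. a \<in> I \<Longrightarrow> \<exists>H\<in>traces a. card H = t" and a: "a \<in> I"
  shows "card (F a) \<le> k 1 ^ 2 * s a (t + 2)"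
proof -
  obtain T where T: "T \<in> traces a" "card T = t" using small[OF a] by blast
  have fT: "finite T" using trace_finite[OF T(1)] by simp
  have TA: "T \<subseteq> A" if "A \<in> F a" for A
  proof -
    have "A \<inter> T = T" using trace_hit[OF a that T(1)] T(2) fT card_mono[of T "A \<inter> T"] by (intro card_subset_eq) auto
    thus ?thesis by auto
  qed
  have no: False if c: "c \<in> I" and X: "card X = t" "\<And>i A. i \<in> I - {c} \<Longrightarrow> A \<in> F i \<Longrightarrow> X \<subseteq> A" for c X
  proof -
    obtain H where "H \<in> traces c" "card H = t" using small[OF c] by blast
    thus False using traces_large_if_common[OF c X] by fastforce
  qed
  have missing: "\<exists>b\<in>I - {a, c}. \<exists>B\<in>F b. \<not> T \<subseteq> B" if c: "c \<in> I" for c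
  proof (rule ccontr)
    assume "\<not> (\<exists>b\<in>I - {a, c}. \<exists>B\<in>F b. \<not> T \<subseteq> B)"
    hence "T \<subseteq> A" if "i \<in> I - {c}" "A \<in> F i" for i A using that TA by (cases "i = a") blast+
    thus False using no[OF c T(2)] by blast
  qed
  have nocov: "\<exists>H\<in>traces a. card (X \<inter> H) < t" if X: "finite X" "T \<subseteq> X" "card X < t + 2" for X
  proof (rule ccontr)
    assume "\<not> (\<exists>H\<in>traces a. card (X \<inter> H) < t)"
    hence cov: "\<And>H. H \<in> traces a \<Longrightarrow> t \<le> card (X \<inter> H)" by force
    \<comment> \<open>A trace below \<open>B\<close> and \<open>G\<close> avoids \<open>u\<close>
      but meets \<open>X\<close> in \<open>t\<close> blocks. As \<open>X - {u}\<close> has at most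
      \<open>t\<close> blocks, all of them lie in \<open>G\<close>.\<close>
    have key: "X - {u} \<subseteq> G \<and> card (X - {u}) = t"
      if b: "b \<in> I - {a}" "B \<in> F b" "u \<in> T" "u \<notin> B" and j: "j \<in> I - {a}" "j \<noteq> b" "G \<in> F j" for b B u j G
    proof -
      obtain H where H: "H \<in> traces a" "H \<subseteq> B \<inter> G" using trace_below[OF b(1) j(1) b(2) j(3)] j(2) by blast
      have sub: "X \<inter> H \<subseteq> X - {u}" using H b by auto
      have "card (X - {u}) \<le> t" using X b(3) by (subst card_Diff_singleton) auto
      moreover have "card (X \<inter> H) \<le> card (X - {u})" using sub X by (intro card_mono) auto
      moreover have "t \<le> card (X \<inter> H)" using cov[OF H(1)] .
      ultimately have "card (X \<inter> H) = card (X - {u})" "card (X - {u}) = t" by auto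
      thus ?thesis using card_subset_eq[OF _ sub] X H by auto
    qed
    obtain b B u where b: "b \<in> I - {a}" "B \<in> F b" "u \<in> T" "u \<notin> B" using missing[OF a] by blast
    obtain c C v where c: "c \<in> I - {a, b}" "C \<in> F c" "v \<in> T" "v \<notin> C" using missing[of b] b(1) by blast
    \<comment> \<open>\<open>C\<close> contains \<open>X - {u}\<close> but not \<open>v\<close>, so
      it misses \<open>u\<close> as well and can replace \<open>B\<close> when \<open>G\<close>
      comes from \<open>F b\<close>.\<close>
    have "v = u" using key[OF b, of c C] c X(2) by auto
    hence c': "c \<in> I - {a}" "u \<notin> C" using c by auto
    have "X - {u} \<subseteq> G" if "j \<in> I - {a}" "G \<in> F j" for j G
    proof (cases "j = b")
      case True
      then show ?thesis using key[OF c'(1) c(2) b(3) c'(2) that(1) _ that(2)] c by auto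
    next
      case False
      then show ?thesis using key[OF b that(1) False that(2)] by simp
    qed
    moreover have "card (X - {u}) = t" using key[OF b, of c C] c by auto
    ultimately show False using no[OF a] by blast
  qed
  have "card {G \<in> F a. T \<subseteq> G} \<le> k 1 ^ 2 * s a (card T + 2)"
  proof (rule branching[where HH = "traces a" and x = "t + 2" and T\<^sub>0 = T and h = t])
    show "F a \<subseteq> Pi_part n (k a)" using F_sub[OF a] .
    show "1 \<le> k a" "k a \<le> k 1" using k_bounds[OF a] by auto
    show "t \<le> card (G \<inter> H)" if "G \<in> F a" "H \<in> traces a" for G H using trace_hit[OF a that] .
    show "finite H \<and> card H \<le> k 1" if "H \<in> traces a" for H using trace_finite[OF that] .
    show "\<exists>H\<in>traces a. card (X \<inter> H) < t" if "finite X" "T \<subseteq> X" "card X < t + 2" for X using nocov[OF that] .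
  qed (use fT T in auto)
  moreover have "{G \<in> F a. T \<subseteq> G} = F a" using TA by auto
  ultimately show ?thesis using T(2) by simp
qed

text \<open>Such a family may exceed its star bound 1 by a factor \<open>K^2\<close>, and two of
  these factors still fit below \<open>S(n - t, 2)\<close>. With three families, all intersections
  of different members of \<open>F a\<close> and \<open>F b\<close> coincide, since two different
  ones would give \<open>t + 1\<close> blocks common to all of \<open>F c\<close> and make it a
  single partition. Their common value then lies in every member of every family.\<close>

lemma at_most_two_small_families:
  "card {a \<in> I. k a = t + 2 \<and> 2 \<le> card (F a)} \<le> 2"
proof (rule ccontr)
  define D where "D = {a \<in> I. k a = t + 2 \<and> 2 \<le> card (F a)}"
  assume "\<not> card {a \<in> I. k a = t + 2 \<and> 2 \<le> card (F a)} \<le> 2"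
  hence "3 \<le> card D" by (simp add: D_def)
  then obtain S where "S \<subseteq> D" "card S = 3" using obtain_subset_with_card_n by metis
  then obtain a b c where abc: "a \<in> D" "b \<in> D" "c \<in> D" "a \<noteq> b" "a \<noteq> c" "b \<noteq> c" by (auto simp: card_3_iff)
  have D: "i \<in> I" "k i = t + 2" "2 \<le> card (F i)" if "i \<in> D" for i using that by (auto simp: D_def)
  have ex: "\<exists>B\<in>F i. B \<noteq> A" if "i \<in> D" for i A
  proof (rule ccontr)
    assume "\<not> (\<exists>B\<in>F i. B \<noteq> A)"
    hence "F i \<subseteq> {A}" by auto
    hence "card (F i) \<le> 1" using card_mono[of "{A}" "F i"] by simp
    thus False using D(3)[OF that] by simp
  qed
  obtain A0 where A0: "A0 \<in> F a" using F_ne[OF D(1)[OF abc(1)]] by blast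
  obtain B0 where B0: "B0 \<in> F b" "B0 \<noteq> A0" using ex[OF abc(2)] by blast
  define S0 where "S0 = A0 \<inter> B0"
  note sp = small_pair[OF D(1)[OF abc(1)] D(1)[OF abc(2)] abc(4) D(2)[OF abc(1)] D(2)[OF abc(2)]]
  have S0: "card S0 = t" "\<And>j G. j \<in> I - {a, b} \<Longrightarrow> G \<in> F j \<Longrightarrow> S0 \<subseteq> G"
    unfolding S0_def using sp[OF A0 B0(1)] B0(2) by blast+
  have cI: "c \<in> I - {a, b}" using abc D(1) by blast
  have eq: "A \<inter> B = S0" if AB: "A \<in> F a" "B \<in> F b" "A \<noteq> B" for A B
  proof (rule ccontr)
    assume ne: "A \<inter> B \<noteq> S0"
    obtain C where C: "C \<in> F c" using F_ne cI by blast
    have f: "finite A0" "finite A" using memF[OF A0] memF[OF AB(1)] D(1)[OF abc(1)] by blast+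
    have cu: "t + 1 \<le> card (S0 \<union> (A \<inter> B))"
    proof (rule ccontr)
      assume "\<not> t + 1 \<le> card (S0 \<union> (A \<inter> B))"
      hence le: "card (S0 \<union> (A \<inter> B)) \<le> t" by simp
      have fu: "finite (S0 \<union> (A \<inter> B))" using f by (simp add: S0_def)
      have "S0 = S0 \<union> (A \<inter> B)" using fu le S0(1) card_mono[OF fu, of S0] by (intro card_subset_eq) auto
      moreover have "A \<inter> B = S0 \<union> (A \<inter> B)"
        using fu le sp(1)[OF AB] card_mono[OF fu, of "A \<inter> B"] by (intro card_subset_eq) auto
      ultimately show False using ne by simp
    qed
    have sub: "S0 \<union> (A \<inter> B) \<subseteq> C'" if "C' \<in> F c" for C'
      using S0(2)[OF cI that] sp(2)[OF AB cI that] by blast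
    have "C' = C" if C': "C' \<in> F c" for C'
    proof (rule Pi_part_eqI)
      have cc: "c \<in> I" using cI by simp
      show "C' \<in> Pi_part n (t + 2)" "C \<in> Pi_part n (t + 2)"
        using memF[OF C cc] memF[OF C' cc] D(2)[OF abc(3)] by auto
      have "card (S0 \<union> (A \<inter> B)) \<le> card (C' \<inter> C)"
        using sub[OF C] sub[OF C'] memF[OF C cc] by (intro card_mono) auto
      thus "t + 2 \<le> card (C' \<inter> C) + 1" using cu by simp
      show "t + 2 < n" using k_less_n[OF cc] D(2)[OF abc(3)] by simp
    qed simp
    thus False using ex[OF abc(3), of C] by blast
  qed
  have "S0 \<subseteq> G" if i: "i \<in> I" "G \<in> F i" for i G
  proof -
    consider "i = a" | "i = b" | "i \<in> I - {a, b}" using i by blast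
    thus ?thesis
    proof cases
      case 1
      obtain B where "B \<in> F b" "B \<noteq> G" using ex[OF abc(2)] by blast
      thus ?thesis using eq[of G B] i 1 by blast
    next
      case 2
      obtain A where "A \<in> F a" "A \<noteq> G" using ex[OF abc(1)] by blast
      thus ?thesis using eq[of A G] i 2 by blast
    next
      case 3
      thus ?thesis using S0(2) i by blast
    qed
  qed
  thus False using no_common_set[of S0] S0(1) by simp
qed

lemma bounded_if_traces_small:
  assumes small: "\<And>a. a \<in> I \<Longrightarrow> \<exists>H\<in>traces a. card H = t"
  shows bounded_with_extremal
proof -
  define D where "D = {a \<in> I. k a = t + 2 \<and> 2 \<le> card (F a)}"
  have D2: "card D \<le> 2" unfolding D_def by (rule at_most_two_small_families)
  have D: "i \<in> I" "k i = t + 2" if "i \<in> D" for i using that by (auto simp: D_def)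
  have fD: "finite D" "D \<subseteq> I" by (auto simp: D_def)
  have leD: "card (F i) \<le> k 1 ^ 2" if "i \<in> D" for i
    using card_F_le_if_traces_small[OF small, of i] D[OF that] s_small[of i "t + 2"] by simp
  have le: "card (F i) \<le> s i (t + 1)" if i: "i \<in> I - D" for i
  proof (cases "k i = t + 2")
    case True
    hence "card (F i) \<le> 1" using i by (auto simp: D_def)
    thus ?thesis using s_small[of i "t + 1"] True i by simp
  next
    case False
    have ki: "t + 3 \<le> k i" "k i \<le> k 1" using k_bounds[of i] i False by auto
    have "card (F i) \<le> k 1 ^ 2 * s i (t + 2)" using card_F_le_if_traces_small[OF small, of i] i by blast
    also have "\<dots> \<le> 2 * k 1 ^ 2 * s i (t + 1 + 1)" by simp
    also have "\<dots> \<le> s i (t + 1)" using ki by (intro star_bound_step) auto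
    finally show ?thesis .
  qed
  have prod_le: "(\<Prod>i\<in>I. card (F i)) \<le> (k 1 ^ 2) ^ card D * (\<Prod>i\<in>I. s i (t + 1))"
  proof -
    have "(\<Prod>i\<in>I. card (F i)) = (\<Prod>i\<in>I - D. card (F i)) * (\<Prod>i\<in>D. card (F i))"
      using fD by (intro prod.subset_diff) auto
    also have "\<dots> \<le> (\<Prod>i\<in>I - D. s i (t + 1)) * (\<Prod>i\<in>D. k 1 ^ 2)"
      using le leD by (intro mult_le_mono prod_mono) auto
    also have "(\<Prod>i\<in>I - D. s i (t + 1)) = (\<Prod>i\<in>I. s i (t + 1))"
    proof -
      have "(\<Prod>i\<in>D. s i (t + 1)) = 1" using s_small D by (intro prod.neutral) auto
      thus ?thesis using prod.subset_diff[OF fD(2), of "\<lambda>i. s i (t + 1)"] by simp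
    qed
    finally show ?thesis by (simp add: mult.commute)
  qed
  show ?thesis
  proof (cases "D = {}")
    case True
    have kr: "t + 2 \<le> k r" "k r \<le> k 1" using k_bounds[OF I_facts(1)] by auto
    have "1 \<le> k 1 ^ 2" using K_ge_3 by (intro one_le_power) auto
    hence "1 * s r (t + 1) < 2 * k 1 ^ 2 * s r (t + 1)"
      using s_pos[OF I_facts(1)] by (intro mult_less_mono1) auto
    also have "2 * k 1 ^ 2 * s r (t + 1) \<le> s r t" by (rule star_bound_step[OF kr])
    also have "\<dots> \<le> tb r" by (rule star_bound_le_top[OF kr(1)])
    finally have less: "s r (t + 1) * Z r < tb r * Z r" using Z_pos[of r] by simp
    have "(\<Prod>i\<in>I. card (F i)) \<le> s r (t + 1) * Z r"
      using prod_le True unfolding prod_split[OF I_facts(1), of "\<lambda>i. s i (t + 1)"] by simp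
    from bounded_if_less[OF I_facts(1) le_less_trans[OF this less]] show ?thesis .
  next
    case False
    then obtain a where a: "a \<in> D" by auto
    have "(k 1 ^ 2) ^ card D \<le> (k 1 ^ 2) ^ 2" using D2 K_ge_3 by (intro power_increasing) auto
    also have "\<dots> = k 1 ^ 4" by (simp flip: power_mult)
    also have "\<dots> < s a t"
    proof -
      have "3 ^ 2 * k 1 ^ 4 \<le> k 1 ^ 2 * k 1 ^ 4" using K_ge_3 by (intro mult_right_mono power_mono) auto
      moreover have "k 1 ^ 4 \<ge> 1" using K_ge_3 by simp
      moreover have "k 1 ^ 2 * k 1 ^ 4 = k 1 ^ 6" by (simp flip: power_add)
      ultimately show ?thesis using Stirling_two_large[of a] D[OF a] by simp
    qed
    also have "\<dots> \<le> tb a" using D[OF a] by (intro star_bound_le_top) simp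
    finally have less: "(k 1 ^ 2) ^ card D * Z a < tb a * Z a" using Z_pos[of a] by simp
    have "(\<Prod>i\<in>I. s i (t + 1)) = Z a"
      unfolding prod_split[OF D(1)[OF a], of "\<lambda>i. s i (t + 1)"] using s_small[of a "t + 1"] D[OF a] by simp
    hence "(\<Prod>i\<in>I. card (F i)) \<le> (k 1 ^ 2) ^ card D * Z a" using prod_le by simp
    from bounded_if_less[OF D(1)[OF a] le_less_trans[OF this less]] show ?thesis .
  qed
qed


section \<open>An index all of whose traces have at least \<open>t + 1\<close> blocks\<close>

lemma traces_cross: "(\<And>H. H \<in> traces a \<Longrightarrow> c \<le> card H) \<Longrightarrow> cross_intersecting_on (I - {a}) c F"
  unfolding cross_intersecting_on_def traces_def by blast

lemma card_I_minus: "a \<in> I \<Longrightarrow> 2 \<le> card (I - {a})"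
  using r_ge_3 by simp

lemma smallest_trace:
  obtains H where "H \<in> traces a" "\<And>H'. H' \<in> traces a \<Longrightarrow> card H \<le> card H'"
proof -
  obtain H where "H \<in> traces a" using traces_ne by blast
  thus ?thesis using that ex_has_least_nat[of "\<lambda>H. H \<in> traces a" H card] by blast
qed

lemma trace_in_partition:
  assumes "H \<in> traces a"
  obtains j P where "j \<in> I" "j \<noteq> a" "P \<in> F j" "H \<subseteq> P" "P \<in> Pi_part n (k j)"
proof -
  obtain j where j: "j \<in> I" "j \<noteq> a" using other_index by blast
  then obtain P where P: "P \<in> F j" "H \<subseteq> P" using trace_above[OF assms, of j] by blast
  show ?thesis using that[OF j P] memF[OF P(1) j(1)] by blast
qed

text \<open>\<open>top_bound\<close> falls short of the union bound only by
  \<open>t * s i (t + 1)\<close>, at most half of \<open>t * s i t\<close>. The factor 2 lost here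
  is covered by the 2 in \<open>2 * K^2\<close>.\<close>

lemma double_top: "i \<in> I \<Longrightarrow> (t + 1) * s i t < 2 * tb i"
proof -
  assume i: "i \<in> I"
  have ki: "t + 2 \<le> k i" "k i \<le> k 1" using k_bounds[OF i] by auto
  have "1 \<le> k 1 ^ 2" using K_ge_3 by (intro one_le_power) auto
  hence "2 * 1 * s i (t + 1) \<le> 2 * k 1 ^ 2 * s i (t + 1)" by (intro mult_right_mono mult_left_mono) auto
  also have "\<dots> \<le> s i t" by (rule star_bound_step[OF ki])
  finally have "2 * s i (t + 1) \<le> s i t" by simp
  hence "t * (2 * s i (t + 1)) \<le> t * s i t" by (rule mult_left_mono) simp
  hence "2 * (t * s i (t + 1)) \<le> t * s i t" by (simp only: mult.left_commute)
  moreover have "tb i + t * s i (t + 1) = t * s i t + s i t" using top_bound_eq[OF ki] by simp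
  moreover have "s i t > 0" using s_pos[OF i] .
  moreover have "(t + 1) * s i t = t * s i t + s i t" by simp
  ultimately show ?thesis by linarith
qed

text \<open>With \<open>h = t + 1 + g\<close> the smallest trace size, \<open>F a\<close> is at most
  \<open>(t + 1) * K^g\<close> times a single star bound, while the others lose
  \<open>(2 * K^2)^g\<close> against \<open>Z a\<close>. For \<open>g = 0\<close> this is the
  situation of \<open>bounded_from_base\<close>; for \<open>g >= 1\<close> the loss wins.\<close>

lemma bounded_if_others_large:
  assumes a: "a \<in> I" and large: "\<And>H. H \<in> traces a \<Longrightarrow> t + 1 \<le> card H"
    and k3: "\<And>i. i \<in> I - {a} \<Longrightarrow> t + 3 \<le> k i"
  shows bounded_with_extremal
proof -
  obtain H where H: "H \<in> traces a" "\<And>H'. H' \<in> traces a \<Longrightarrow> card H \<le> card H'" using smallest_trace[of a] by blast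
  define h where "h = card H"
  have th: "t + 1 \<le> h" using large[OF H(1)] by (simp add: h_def)
  have ekr: "(\<Prod>i\<in>I - {a}. card (F i)) \<le> (\<Prod>i\<in>I - {a}. ekr_bound n (k i) h)"
  proof (rule cross_intersecting_prod_le[OF _ card_I_minus[OF a]])
    show "cross_intersecting_on (I - {a}) h F" using H(2) unfolding h_def by (rule traces_cross)
    show "F i \<noteq> {} \<and> F i \<subseteq> Pi_part n (k i)" if "i \<in> I - {a}" for i using F_both that by blast
    show "1 \<le> k i \<and> k i \<le> k 1" if "i \<in> I - {a}" for i using k_bounds[of i] that by auto
  qed simp
  show ?thesis
  proof (cases "h = t + 1")
    case True
    have "ekr_bound n (k i) h = s i (t + 1)" if "i \<in> I - {a}" for i
      using k3[OF that] True by (simp add: ekr_bound_def)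
    hence rest: "(\<Prod>i\<in>I - {a}. card (F i)) \<le> Z a" using ekr by simp
    obtain j P where "P \<in> Pi_part n (k j)" "H \<subseteq> P" using trace_in_partition[OF H(1)] by metis
    thus ?thesis using bounded_from_base[OF a _ _ _ trace_hit[OF a _ H(1)] rest] True by (simp add: h_def)
  next
    case False
    define g where "g = h - t - 1"
    have g: "g \<ge> 1" "h = t + 1 + g" using False th by (auto simp: g_def)
    have gain: "ekr_bound n (k i) h * (2 * k 1 ^ 2) ^ g \<le> s i (t + 1)" if i: "i \<in> I - {a}" for i
    proof -
      have ki: "t + 1 + 2 \<le> k i" "k i \<le> k 1" using k3[OF i] k_bounds[of i] i by auto
      obtain P where P: "P \<in> F i" "H \<subseteq> P" using trace_above[OF H(1) i] by blast
      have hk: "h \<le> k i" using memF[OF P(1)] P(2) i unfolding h_def by (metis DiffE card_mono)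
      show ?thesis
      proof (cases "k i = h + 1")
        case True
        \<comment> \<open>\<open>ekr_bound\<close> is \<open>h + 1\<close> here and not the star
          bound 1. As \<open>h + 1 = k i\<close>, the decay can run one step further, to all
          \<open>k i\<close> blocks, and the additional \<open>2 * K^2\<close> absorbs
          \<open>h + 1\<close>.\<close>
        have "h + 1 \<le> 2 * k 1 ^ 2"
        proof -
          have "1 * k 1 \<le> k 1 * k 1" using K_ge_3 by (intro mult_right_mono) auto
          thus ?thesis using True ki(2) unfolding power2_eq_square by linarith
        qed
        hence "ekr_bound n (k i) h * (2 * k 1 ^ 2) ^ g \<le> (2 * k 1 ^ 2) * (2 * k 1 ^ 2) ^ g"
          using True by (intro mult_right_mono) (auto simp: ekr_bound_def)
        also have "\<dots> = s i (t + 1 + (g + 1)) * (2 * k 1 ^ 2) ^ (g + 1)"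
          using True g(2) by (simp add: star_bound_def)
        also have "\<dots> \<le> s i (t + 1)" using ki True g(2) by (intro star_bound_decay) auto
        finally show ?thesis .
      next
        case False
        have "s i (t + 1 + g) * (2 * k 1 ^ 2) ^ g \<le> s i (t + 1)" using ki hk g(2) by (intro star_bound_decay) auto
        thus ?thesis using False by (simp add: ekr_bound_def g(2))
      qed
    qed
    have ekr_le: "ekr_bound n (k i) h \<le> s i (t + 1)" if i: "i \<in> I - {a}" for i
    proof -
      have "1 \<le> (2 * k 1 ^ 2) ^ g" using K_ge_3 by (intro one_le_power) auto
      hence "ekr_bound n (k i) h * 1 \<le> ekr_bound n (k i) h * (2 * k 1 ^ 2) ^ g" by (rule mult_left_mono) simp
      also note gain[OF i]
      finally show ?thesis by simp
    qed
    define p where "p = (\<Prod>i\<in>I - {a}. ekr_bound n (k i) h)"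
    \<comment> \<open>The loss of a single family suffices; the others merely must not exceed
      \<open>s i (t + 1)\<close>.\<close>
    obtain j where j: "j \<in> I - {a}" using other_index[of a a] by blast
    have "p * (2 * k 1 ^ 2) ^ g
        = (ekr_bound n (k j) h * (2 * k 1 ^ 2) ^ g) * (\<Prod>i\<in>I - {a} - {j}. ekr_bound n (k i) h)"
      unfolding p_def using prod.remove[OF _ j, of "\<lambda>i. ekr_bound n (k i) h"] by simp
    also have "\<dots> \<le> s j (t + 1) * (\<Prod>i\<in>I - {a} - {j}. s i (t + 1))"
      using gain[OF j] ekr_le by (intro mult_le_mono prod_mono) auto
    also have "\<dots> = Z a" using prod.remove[OF _ j, of "\<lambda>i. s i (t + 1)"] by simp
    finally have p: "p * (2 * k 1 ^ 2) ^ g \<le> Z a" .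
    have "card (F a) \<le> (h choose t) * s a t" unfolding h_def by (rule card_F_le_choose[OF a H(1)])
    also have "(h choose t) \<le> (t + 1) * k 1 ^ g"
    proof -
      have "(t + (g + 1)) choose t \<le> (t + 1) ^ (g + 1)" by (rule choose_add_le_power)
      also have "\<dots> = (t + 1) * (t + 1) ^ g" by simp
      also have "\<dots> \<le> (t + 1) * k 1 ^ g" using k_bounds[OF a] by (intro mult_left_mono power_mono) auto
      finally show ?thesis by (simp add: g(2))
    qed
    finally have Fa: "card (F a) \<le> (t + 1) * k 1 ^ g * s a t" by simp
    have kg: "2 * k 1 ^ g \<le> (2 * k 1 ^ 2) ^ g"
    proof -
      have "2 ^ 1 \<le> (2::nat) ^ g" using g(1) by (intro power_increasing) auto
      moreover have "k 1 ^ g \<le> (k 1 ^ 2) ^ g" using K_ge_3 by (intro power_mono) (auto simp: power2_eq_square)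
      ultimately have "2 ^ 1 * k 1 ^ g \<le> 2 ^ g * (k 1 ^ 2) ^ g" by (rule mult_le_mono)
      thus ?thesis by (simp add: power_mult_distrib)
    qed
    define N where "N = (\<Prod>i\<in>I. card (F i))"
    have "N \<le> card (F a) * p" unfolding N_def prod_split[OF a] p_def using ekr by (rule mult_left_mono) simp
    hence "N * (2 * k 1 ^ g) \<le> (card (F a) * p) * (2 * k 1 ^ 2) ^ g" using kg by (rule mult_le_mono)
    also have "\<dots> = card (F a) * (p * (2 * k 1 ^ 2) ^ g)" by simp
    also have "\<dots> \<le> ((t + 1) * k 1 ^ g * s a t) * Z a" using Fa p by (rule mult_le_mono)
    finally have "k 1 ^ g * (2 * N) \<le> k 1 ^ g * ((t + 1) * s a t * Z a)" by (simp only: mult_ac)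
    hence "2 * N \<le> (t + 1) * s a t * Z a" using K_ge_3 by simp
    also have "\<dots> < 2 * tb a * Z a" using double_top[OF a] Z_pos[of a] by (intro mult_less_mono1)
    finally have "N < tb a * Z a" by simp
    thus ?thesis unfolding N_def by (rule bounded_if_less[OF a])
  qed
qed

lemma prod_others_le:
  assumes a: "a \<in> I" and large: "\<And>H. H \<in> traces a \<Longrightarrow> t + 1 \<le> card H"
  shows "(\<Prod>i\<in>I - {a}. card (F i)) \<le> (t + 2) * Z a"
proof -
  have "(\<Prod>i\<in>I - {a}. card (F i)) \<le> (t + 1 + 1) * (\<Prod>i\<in>I - {a}. s i (t + 1))"
  proof (rule cross_intersecting_prod_le'[OF _ card_I_minus[OF a]])
    show "cross_intersecting_on (I - {a}) (t + 1) F" using large by (rule traces_cross)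
    show "F i \<noteq> {} \<and> F i \<subseteq> Pi_part n (k i)" if "i \<in> I - {a}" for i using F_both that by blast
    show "t + 1 + 1 \<le> k i \<and> k i \<le> k 1" if "i \<in> I - {a}" for i using k_bounds[of i] that by auto
  qed simp
  thus ?thesis by simp
qed

text \<open>\<open>a\<close> is the wrong base: \<open>k r = t + 2\<close>, and by
  \<open>Stirling_two_dominates\<close> the base \<open>r\<close> gains a factor
  \<open>K^3 / 2\<close>. This leaves room for the crude losses \<open>(t + 2) * (t + 1) / 2\<close>
  in \<open>F a\<close> and \<open>t + 2\<close> in the other families.\<close>

lemma bounded_if_base_not_small:
  assumes a: "a \<in> I" and large: "\<And>H. H \<in> traces a \<Longrightarrow> t + 1 \<le> card H"
    and i: "i \<in> I - {a}" "k i = t + 2" and ka: "t + 3 \<le> k a"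
  shows bounded_with_extremal
proof -
  obtain H where H: "H \<in> traces a" using traces_ne by blast
  have kr: "k r = t + 2" using k_bounds[of i] k_bounds[OF I_facts(1)] i by auto
  obtain P where P: "P \<in> F i" "H \<subseteq> P" using trace_above[OF H i(1)] by blast
  have "card H \<le> t + 2" using memF[OF P(1)] P(2) i by (metis DiffE card_mono)
  hence "card H choose t \<le> (t + 2) choose t" by (rule binomial_right_mono)
  also have "\<dots> = (t + 2) choose 2" using binomial_symmetric[of 2 "t + 2"] by simp
  finally have ch: "2 * (card H choose t) \<le> (t + 2) * (t + 1)" by (simp add: choose_two)
  have sr: "s r (t + 1) = 1" using s_small[OF I_facts(1) kr] by simp
  have Z: "Z r = s a (t + 1) * Z a"
    using prod_split[OF I_facts(1), of "\<lambda>i. s i (t + 1)"] prod_split[OF a, of "\<lambda>i. s i (t + 1)"] sr by simp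
  have kk: "(t + 2) * ((t + 2) * (t + 1)) < k 1 ^ 3"
  proof -
    have "t + 2 < k 1" using ka k_bounds[OF a] by auto
    hence "(t + 2) * ((t + 2) * (t + 1)) < k 1 * (k 1 * k 1)" by (intro mult_strict_mono) auto
    thus ?thesis by (simp add: power3_eq_cube)
  qed
  define N where "N = (\<Prod>i\<in>I. card (F i))"
  have "N \<le> ((card H choose t) * s a t) * ((t + 2) * Z a)"
    unfolding N_def prod_split[OF a]
    using card_F_le_choose[OF a H] prod_others_le[OF a large] by (intro mult_le_mono)
  also have "\<dots> = (card H choose t) * ((t + 2) * (s a t * Z a))" by (simp only: mult_ac)
  finally have "2 * N \<le> (2 * (card H choose t)) * ((t + 2) * (s a t * Z a))"
    unfolding mult.assoc by (rule mult_left_mono) simp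
  also have "\<dots> \<le> ((t + 2) * (t + 1)) * ((t + 2) * (s a t * Z a))" using ch by (rule mult_right_mono) simp
  also have "\<dots> = ((t + 2) * ((t + 2) * (t + 1))) * (s a t * Z a)" by (simp only: mult_ac)
  also have "\<dots> < k 1 ^ 3 * (s a t * Z a)" using kk s_pos[OF a] Z_pos[of a] by (intro mult_less_mono1) auto
  also have "\<dots> = (k 1 ^ 3 * s a t) * Z a" by simp
  also have "\<dots> \<le> (2 * s r t * s a (t + 1)) * Z a"
    using Stirling_two_dominates[OF t_ge_1 ka] k_bounds[OF a] ka kr
    by (intro mult_right_mono) (auto simp: star_bound_def)
  also have "\<dots> = 2 * s r t * Z r" by (simp only: Z mult.assoc)
  also have "\<dots> \<le> 2 * tb r * Z r"
    using star_bound_le_top[of t "k r"] kr by (intro mult_right_mono mult_left_mono) auto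
  finally have "N < tb r * Z r" by simp
  thus ?thesis unfolding N_def by (rule bounded_if_less[OF I_facts(1)])
qed

text \<open>A trace below a member of \<open>F i\<close> has at most \<open>t + 2\<close> blocks, so
  it must be that whole partition, and all families but \<open>F a\<close> are the same
  \<open>{P}\<close>. It remains to count partitions sharing \<open>t\<close> blocks with
  \<open>P\<close>. Equality is possible only if deleting one block of \<open>P\<close> leaves
  \<open>t + 1\<close> singletons, which then serve as \<open>T\<close>.\<close>

lemma bounded_if_others_fixed:
  assumes a: "a \<in> I" "k a = t + 2" and i: "i \<in> I - {a}" "k i = t + 2"
    and large: "\<And>H. H \<in> traces a \<Longrightarrow> t + 2 \<le> card H"
  shows bounded_with_extremal
proof -
  obtain P where P: "P \<in> F i" using F_ne i by blast
  have eq: "G = Q" if j: "j \<in> I - {a, i}" "G \<in> F j" "Q \<in> F i" for j G Q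
  proof -
    have j': "j \<in> I - {a}" "i \<noteq> j" "j \<in> I" "i \<in> I" using j(1) i(1) by auto
    obtain H where H: "H \<in> traces a" "H \<subseteq> Q \<inter> G"
      using trace_below[OF i(1) j'(1) j(3) j(2)] j'(2) by blast
    note Q = memF[OF j(3) j'(4)]
    have "H = Q" using large[OF H(1)] Q H(2) i(2) card_mono[of Q H] by (intro card_subset_eq) auto
    hence "Q \<subseteq> G" using H by blast
    thus ?thesis using Pi_part_superset_eq[of Q n "k i" G "k j"] Q memF[OF j(2) j'(3)] by blast
  qed
  have FP: "F j = {P}" if j: "j \<in> I - {a}" for j
  proof (cases "j = i")
    case True
    obtain l where l: "l \<in> I - {a, i}" using other_index[of a i] by blast
    obtain G where "G \<in> F l" using F_ne l by blast
    hence "Q = P" if "Q \<in> F i" for Q using eq[OF l _ that] eq[OF l _ P] by blast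
    thus ?thesis using P True by blast
  next
    case False
    hence "G = P" if "G \<in> F j" for G using eq[OF _ that P] j by blast
    thus ?thesis using F_ne j by blast
  qed
  have kj: "k j = t + 2" if j: "j \<in> I - {a}" for j
    using memF[of P j] memF[OF P] FP[OF j] i j by auto
  have PP: "P \<in> Pi_part n (t + 2)" using memF[OF P] i by auto
  have Z1: "Z a = 1" using s_small kj by (intro prod.neutral) auto
  have F1: "(\<Prod>j\<in>I - {a}. card (F j)) = 1" using FP by (intro prod.neutral) auto
  have hit: "A \<in> Pi_part n (t + 2) \<and> t \<le> card (A \<inter> P)" if "A \<in> F a" for A
    using pair[OF a(1) _ _ that P] memF[OF that a(1)] a(2) i by auto
  show ?thesis
  proof (cases "\<exists>b\<in>P. \<forall>B\<in>P - {b}. card B = 1")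
    case True
    then obtain b where b: "b \<in> P" "\<forall>B\<in>P - {b}. card B = 1" by blast
    show ?thesis
    proof (rule bounded_from_base[OF a(1), of "P - {b}" P])
      show "card (P - {b}) = t + 1" using b(1) PP Pi_part_finite[OF PP] Pi_part_card[OF PP] by simp
      show "t \<le> card (A \<inter> (P - {b}))" if "A \<in> F a" for A
        using card_near_full_partition_singletons[OF PP b _ _ t_ge_1] hit[OF that] by blast
      show "(\<Prod>i\<in>I - {a}. card (F i)) \<le> Z a" by (simp only: F1 Z1)
    qed (use PP in auto)
  next
    case False
    have "F a \<subseteq> near_star n (t + 2) t P" using hit unfolding near_star_def by blast
    hence "card (F a) \<le> card (near_star n (t + 2) t P)" by (intro card_mono) auto
    also have "\<dots> < tb a"
      using card_near_full_partition_less[OF PP False t_ge_1] k_bounds[OF a(1)] a(2) by simp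
    finally have "(\<Prod>i\<in>I. card (F i)) < tb a * Z a" unfolding prod_split[OF a(1)] F1 Z1 by simp
    thus ?thesis by (rule bounded_if_less[OF a(1)])
  qed
qed


text \<open>Two different traces of size \<open>t\<close> prescribe \<open>t + 1\<close> blocks, which determine \<open>A\<close>.\<close>

lemma card_differing_traces_le:
  assumes a: "a \<in> I" "k a = t + 2" and i: "i \<in> I - {a}" "k i = t + 2" and Q: "Q1 \<in> F i" "Q2 \<in> F i"
  shows "4 * card {A \<in> F a. A \<notin> {Q1, Q2} \<and> A \<inter> Q1 \<noteq> A \<inter> Q2} \<le> k 1 ^ 4"
proof -
  define E where "E = {A \<in> F a. A \<notin> {Q1, Q2} \<and> A \<inter> Q1 \<noteq> A \<inter> Q2}"
  have iI: "i \<in> I" "a \<noteq> i" using i by auto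
  define \<T> where "\<T> Q = {T. T \<subseteq> Q \<and> card T = t}" for Q :: "nat set set"
  have c: "card (\<T> Q) = (t + 2) choose 2" "finite (\<T> Q)" if "Q \<in> F i" for Q
    using n_subsets[of Q t] memF[OF that iI(1)] i(2) binomial_symmetric[of 2 "t + 2"] by (auto simp: \<T>_def)
  have tr: "card (A \<inter> Q) = t" if "A \<in> E" "Q \<in> {Q1, Q2}" for A Q
    using small_pair(1)[OF a(1) iI(1,2) a(2) i(2), of A Q] that Q unfolding E_def by blast
  have "inj_on (\<lambda>A. (A \<inter> Q1, A \<inter> Q2)) E"
  proof (rule inj_onI)
    fix A B assume A: "A \<in> E" and B: "B \<in> E" and eq: "(A \<inter> Q1, A \<inter> Q2) = (B \<inter> Q1, B \<inter> Q2)"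
    have AF: "A \<in> F a" "B \<in> F a" using A B by (auto simp: E_def)
    note mA = memF[OF AF(1) a(1)] and mB = memF[OF AF(2) a(1)]
    show "A = B"
    proof (rule Pi_part_eqI[of A n "t + 2" B])
      show "A \<in> Pi_part n (t + 2)" "B \<in> Pi_part n (t + 2)" using mA mB a(2) by auto
      have "A \<inter> Q1 \<union> A \<inter> Q2 \<subseteq> A \<inter> B" using eq by blast
      hence "card (A \<inter> Q1 \<union> A \<inter> Q2) \<le> card (A \<inter> B)" using mA by (intro card_mono) auto
      moreover have "t + 1 \<le> card (A \<inter> Q1 \<union> A \<inter> Q2)"
      proof (rule ccontr)
        assume "\<not> t + 1 \<le> card (A \<inter> Q1 \<union> A \<inter> Q2)"
        hence le: "card (A \<inter> Q1 \<union> A \<inter> Q2) \<le> t" by simp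
        have f: "finite (A \<inter> Q1 \<union> A \<inter> Q2)" using mA by simp
        have "A \<inter> Q = A \<inter> Q1 \<union> A \<inter> Q2" if "Q \<in> {Q1, Q2}" for Q
          using that le tr[OF A that] card_mono[OF f, of "A \<inter> Q"] by (intro card_subset_eq[OF f]) auto
        hence "A \<inter> Q1 = A \<inter> Q2" by blast
        thus False using A by (simp add: E_def)
      qed
      ultimately show "t + 2 \<le> card (A \<inter> B) + 1" by simp
      show "t + 2 < n" using k_less_n[OF a(1)] a(2) by simp
    qed simp
  qed
  hence "card E = card ((\<lambda>A. (A \<inter> Q1, A \<inter> Q2)) ` E)" by (simp add: card_image)
  also have "\<dots> \<le> card (\<T> Q1 \<times> \<T> Q2)"
    using c Q tr by (intro card_mono) (auto simp: \<T>_def)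
  also have "\<dots> = ((t + 2) choose 2) * ((t + 2) choose 2)" using c Q by (simp add: card_cartesian_product)
  finally have "4 * card E \<le> (2 * ((t + 2) choose 2)) * (2 * ((t + 2) choose 2))" by simp
  also have "2 * ((t + 2) choose 2) = (t + 2) * (t + 1)" by (simp add: choose_two)
  also have "(t + 2) * (t + 1) * ((t + 2) * (t + 1)) \<le> (k 1 * k 1) * (k 1 * k 1)"
    using k_bounds[OF a(1)] by (intro mult_le_mono) auto
  also have "\<dots> = k 1 ^ 4" by (simp add: eval_nat_numeral)
  finally show ?thesis unfolding E_def .
qed

lemma small_base_large_tb:
  assumes "a \<in> I" "k a = t + 2"
  shows "2 * k 1 ^ 5 < s a t"
proof -
  have "3 * k 1 ^ 5 \<le> k 1 * k 1 ^ 5" using K_ge_3 by (intro mult_right_mono) auto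
  moreover have "k 1 * k 1 ^ 5 = k 1 ^ 6" by (simp add: eval_nat_numeral)
  moreover have "3 ^ 5 \<le> k 1 ^ 5" using K_ge_3 by (intro power_mono) auto
  moreover have "(3::nat) ^ 5 = 243" by simp
  ultimately show ?thesis using Stirling_two_large[OF assms] by linarith
qed

text \<open>A trace of size \<open>t + 1\<close> does not give the sharp product at once, because
  indices with \<open>k i = t + 2\<close> leave the factor \<open>t + 2\<close> of
  \<open>prod_others_le\<close>. If every such family other than \<open>F a\<close> is a single
  partition, two members of \<open>F a\<close> meeting it differently put \<open>t + 1\<close>
  common blocks into the larger families. If one of them has two members, the remaining families
  share \<open>t + 2\<close> blocks and the bound is strict.\<close>

lemma bounded_if_base_small:
  assumes a: "a \<in> I" "k a = t + 2" and large: "\<And>H. H \<in> traces a \<Longrightarrow> t + 1 \<le> card H"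
    and H: "H \<in> traces a" "card H = t + 1" and i0: "i0 \<in> I - {a}" "k i0 = t + 2"
  shows bounded_with_extremal
proof (cases "card (F a) \<le> 2 * k 1 ^ 4")
  \<comment> \<open>So small an \<open>F a\<close> leaves room for the factor
    \<open>t + 2 <= K\<close>, since \<open>2 * K^5 < s a t\<close>.\<close>
  case True
  have "(\<Prod>i\<in>I. card (F i)) \<le> (2 * k 1 ^ 4) * ((t + 2) * Z a)"
    unfolding prod_split[OF a(1)] using True prod_others_le[OF a(1) large] by (rule mult_le_mono)
  also have "\<dots> \<le> (2 * k 1 ^ 4) * (k 1 * Z a)"
    using k_bounds[OF a(1)] by (intro mult_left_mono mult_right_mono) auto
  also have "\<dots> = (2 * (k 1 * k 1 ^ 4)) * Z a" by (simp only: mult_ac)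
  also have "k 1 * k 1 ^ 4 = k 1 ^ 5" by (simp add: eval_nat_numeral)
  also have "(2 * k 1 ^ 5) * Z a < tb a * Z a"
    using small_base_large_tb[OF a] star_bound_le_top[of t "k a"] a(2) Z_pos[of a] by (intro mult_less_mono1) auto
  finally show ?thesis by (rule bounded_if_less[OF a(1)])
next
  case False
  hence Fa: "2 * k 1 ^ 4 < card (F a)" by simp
  have K4: "3 \<le> k 1 ^ 4" using power_increasing[of 1 4 "k 1"] K_ge_3 by simp
  have tn: "t + 2 < n" using k_less_n[OF a(1)] a(2) by simp
  show ?thesis
  proof (cases "\<forall>l\<in>I - {a}. k l = t + 2 \<longrightarrow> card (F l) = 1")
    case True
    have i0I: "i0 \<in> I" "a \<noteq> i0" using i0 by auto
    obtain P where FP: "F i0 = {P}" using True i0 card_1_singletonE by metis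
    note sp = small_pair[OF a(1) i0I a(2) i0(2), of _ P]
    \<comment> \<open>If all members of \<open>F a\<close> other than \<open>P\<close> met
      \<open>P\<close> in the same \<open>t\<close> blocks, these would be common to all
      families.\<close>
    have "\<exists>A\<in>F a. \<exists>B\<in>F a. A \<noteq> P \<and> B \<noteq> P \<and> A \<inter> P \<noteq> B \<inter> P"
    proof (rule ccontr)
      assume no: "\<not> (\<exists>A\<in>F a. \<exists>B\<in>F a. A \<noteq> P \<and> B \<noteq> P \<and> A \<inter> P \<noteq> B \<inter> P)"
      have "\<not> F a \<subseteq> {P}" using card_mono[of "{P}" "F a"] Fa K4 by auto
      then obtain A where A: "A \<in> F a" "A \<noteq> P" by blast
      have cA: "card (A \<inter> P) = t" using sp(1)[OF A(1) _ A(2)] FP by simp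
      have "A \<inter> P \<subseteq> G" if G: "l \<in> I" "G \<in> F l" for l G
      proof -
        consider "l = a" | "l = i0" | "l \<in> I - {a, i0}" using G by blast
        thus ?thesis
        proof cases
          case 1
          then show ?thesis using no A G by (cases "G = P") blast+
        next
          case 2
          then show ?thesis using G FP by blast
        next
          case 3
          then show ?thesis using sp(2)[OF A(1) _ A(2) 3 G(2)] FP by blast
        qed
      qed
      thus False using no_common_set[of "A \<inter> P"] cA by simp
    qed
    then obtain A B where AB: "A \<in> F a" "B \<in> F a" "A \<noteq> P" "B \<noteq> P" "A \<inter> P \<noteq> B \<inter> P" by blast
    have fP: "finite P" using memF[of P i0] FP i0I by blast
    have cAB: "card (A \<inter> P) = t" "card (B \<inter> P) = t" using sp(1) AB FP by blast+
    have "t + 1 \<le> card (A \<inter> P \<union> B \<inter> P)"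
    proof (rule ccontr)
      assume "\<not> t + 1 \<le> card (A \<inter> P \<union> B \<inter> P)"
      hence le: "card (A \<inter> P \<union> B \<inter> P) \<le> t" by simp
      have f: "finite (A \<inter> P \<union> B \<inter> P)" using fP by simp
      have "A \<inter> P = A \<inter> P \<union> B \<inter> P"
        using le cAB card_mono[OF f, of "A \<inter> P"] by (intro card_subset_eq[OF f]) auto
      moreover have "B \<inter> P = A \<inter> P \<union> B \<inter> P"
        using le cAB card_mono[OF f, of "B \<inter> P"] by (intro card_subset_eq[OF f]) auto
      ultimately show False using AB(5) by simp
    qed
    \<comment> \<open>Both intersections lie in every member of the families outside
      \<open>a\<close> and \<open>i0\<close>, so these all contain \<open>X\<close>.\<close>
    then obtain X where X: "X \<subseteq> A \<inter> P \<union> B \<inter> P" "card X = t + 1" using obtain_subset_with_card_n by metis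
    have le: "card (F l) \<le> s l (t + 1)" if l: "l \<in> I - {a}" for l
    proof (cases "k l = t + 2")
      case True
      hence "card (F l) = 1" using \<open>\<forall>l\<in>I - {a}. k l = t + 2 \<longrightarrow> card (F l) = 1\<close> l by blast
      then show ?thesis using s_small[of l "t + 1"] l True by simp
    next
      case False
      hence l': "l \<in> I - {a, i0}" "l \<in> I" using l i0 by auto
      have "X \<subseteq> G" if "G \<in> F l" for G
        using sp(2)[OF AB(1) _ AB(3) l'(1) that] sp(2)[OF AB(2) _ AB(4) l'(1) that] FP X(1) by blast
      moreover have "finite X" using X fP finite_subset by blast
      ultimately show ?thesis using card_F_le_star[OF l'(2), of X] X(2) by simp
    qed
    have rest: "(\<Prod>i\<in>I - {a}. card (F i)) \<le> Z a" using le by (intro prod_mono) auto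
    obtain j Q where "Q \<in> Pi_part n (k j)" "H \<subseteq> Q" using trace_in_partition[OF H(1)] by metis
    thus ?thesis using bounded_from_base[OF a(1) H(2) _ _ trace_hit[OF a(1) _ H(1)] rest] by blast
  next
    case False
    then obtain i where i: "i \<in> I - {a}" "k i = t + 2" "card (F i) \<noteq> 1" by blast
    have iI: "i \<in> I" "a \<noteq> i" using i by auto
    have "2 \<le> card (F i)" using i(3) F_pos[OF iI(1)] by linarith
    then obtain P1 P2 where P: "P1 \<in> F i" "P2 \<in> F i" "P1 \<noteq> P2"
      by (metis card_le_Suc0_iff_eq finF iI(1) not_less_eq_eq numeral_2_eq_2)
    define T where "T = P1 \<inter> P2"
    define E where "E Q1 Q2 = {A \<in> F a. A \<notin> {Q1, Q2} \<and> A \<inter> Q1 \<noteq> A \<inter> Q2}" for Q1 Q2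
    have E: "4 * card (E Q1 Q2) \<le> k 1 ^ 4" "finite (E Q1 Q2)" if "Q1 \<in> F i" "Q2 \<in> F i" for Q1 Q2
      using card_differing_traces_le[OF a i(1,2) that] finF[OF a(1)] by (auto simp: E_def)
    note sp = small_pair[OF a(1) iI a(2) i(2)]
    have mi: "Q \<in> Pi_part n (t + 2) \<and> finite Q" if "Q \<in> F i" for Q using memF[OF that iI(1)] i(2) by auto
    have ma: "Q \<in> Pi_part n (t + 2) \<and> finite Q \<and> card Q = t + 2" if "Q \<in> F a" for Q using memF[OF that a(1)] a(2) by auto
    have fT: "finite T" using mi[OF P(1)] by (simp add: T_def)
    have cT_le: "card T \<le> t"
    proof (rule ccontr)
      assume "\<not> card T \<le> t"
      hence "P1 = P2" using mi[OF P(1)] mi[OF P(2)] tn by (intro Pi_part_eqI[of P1 n "t + 2" P2]) (auto simp: T_def)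
      thus False using P(3) by simp
    qed
    have typical: "A \<inter> P1 = T \<and> card T = t" if A: "A \<in> F a" "A \<notin> {P1, P2}" "A \<notin> E P1 P2" for A
    proof -
      have "A \<inter> P1 = A \<inter> P2" using A by (simp add: E_def)
      hence sub: "A \<inter> P1 \<subseteq> T" by (auto simp: T_def)
      have "card (A \<inter> P1) = t" using sp(1)[OF A(1) P(1)] A(2) by blast
      moreover hence "A \<inter> P1 = T" using card_mono[OF fT sub] cT_le by (intro card_subset_eq[OF fT sub]) simp
      ultimately show ?thesis by simp
    qed
    \<comment> \<open>Each exceptional set \<open>E\<close> has at most \<open>K^4 / 4\<close>
      members, so two of them and three further partitions cannot exhaust more than
      \<open>2 * K^4\<close> members of \<open>F a\<close>.\<close>
    have few: "\<not> F a \<subseteq> M \<union> (E P1 P2 \<union> E P1 Q)" if M: "finite M" "card M \<le> 3" and Q: "Q \<in> F i" for M Q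
    proof
      assume "F a \<subseteq> M \<union> (E P1 P2 \<union> E P1 Q)"
      hence "card (F a) \<le> card (M \<union> (E P1 P2 \<union> E P1 Q))" using M E P Q by (intro card_mono) auto
      also have "\<dots> \<le> card M + (card (E P1 P2) + card (E P1 Q))"
        by (intro order_trans[OF card_Un_le] add_left_mono card_Un_le)
      finally show False using M(2) E(1)[OF P(1,2)] E(1)[OF P(1) Q] Fa K4 by linarith
    qed
    have "\<not> F a \<subseteq> {P1, P2} \<union> (E P1 P2 \<union> E P1 P2)" by (rule few[OF _ _ P(2)]) (auto simp: card_insert_if)
    then obtain A1 where A1: "A1 \<in> F a" "A1 \<notin> {P1, P2}" "A1 \<notin> E P1 P2" by blast
    have cT: "card T = t" and A1T: "A1 \<inter> P1 = T" using typical[OF A1] by auto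
    \<comment> \<open>Some member of \<open>F a\<close> is unexceptional for both pairs; it meets
      \<open>P1\<close> in \<open>T\<close>, hence \<open>Q\<close> in the same set.\<close>
    have TP: "T \<subseteq> Q" if Q: "Q \<in> F i" for Q
    proof (rule ccontr)
      assume no: "\<not> T \<subseteq> Q"
      have "A \<in> {P1, P2, Q} \<union> (E P1 P2 \<union> E P1 Q)" if A: "A \<in> F a" for A
      proof (rule ccontr)
        assume "A \<notin> {P1, P2, Q} \<union> (E P1 P2 \<union> E P1 Q)"
        moreover hence "A \<inter> P1 = T" using typical[OF A] by blast
        ultimately have "T = A \<inter> Q" using A unfolding E_def by blast
        thus False using no by blast
      qed
      moreover have "card {P1, P2, Q} \<le> 3" by (simp add: card_insert_if)
      ultimately show False using few[of "{P1, P2, Q}" Q] Q by blast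
    qed
    have TG: "T \<subseteq> G" if "l \<in> I - {a, i}" "G \<in> F l" for l G
      using sp(2)[OF A1(1) P(1) _ that] A1(2) A1T by blast
    have "\<exists>A\<in>F a. \<not> T \<subseteq> A"
    proof (rule ccontr)
      assume "\<not> (\<exists>A\<in>F a. \<not> T \<subseteq> A)"
      hence "T \<subseteq> G" if "l \<in> I" "G \<in> F l" for l G using that TP TG by (cases "l = a"; cases "l = i") blast+
      thus False using no_common_set[of T] cT by simp
    qed
    then obtain A where A: "A \<in> F a" "\<not> T \<subseteq> A" by blast
    have Ai: "\<exists>z\<in>A - T. z \<in> Q" if Q: "Q \<in> F i" for Q
    proof (rule ccontr)
      assume "\<not> (\<exists>z\<in>A - T. z \<in> Q)"
      hence sub: "A \<inter> Q \<subseteq> T" by blast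
      have "A \<noteq> Q" using TP[OF Q] A(2) by blast
      hence "card (A \<inter> Q) = t" using sp(1)[OF A(1) Q] by blast
      hence "A \<inter> Q = T" using cT by (intro card_subset_eq[OF fT sub]) simp
      thus False using A(2) by blast
    qed
    \<comment> \<open>Together with \<open>T\<close>, one block of \<open>A - T\<close> gives
      \<open>t + 1\<close> blocks and fixes \<open>Q\<close>, so \<open>F i\<close> injects into
      \<open>A\<close>.\<close>
    have Fi: "card (F i) \<le> k 1"
    proof -
      define \<phi> where "\<phi> Q = (SOME z. z \<in> A - T \<and> z \<in> Q)" for Q
      have \<phi>: "\<phi> Q \<in> A - T \<and> \<phi> Q \<in> Q" if "Q \<in> F i" for Q
        unfolding \<phi>_def by (rule someI_ex) (use Ai[OF that] in blast)
      have "inj_on \<phi> (F i)"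
      proof (rule inj_onI)
        fix Q Q' assume Q: "Q \<in> F i" "Q' \<in> F i" "\<phi> Q = \<phi> Q'"
        show "Q = Q'"
        proof (rule Pi_part_eqI[of Q n "t + 2" Q'])
          have "insert (\<phi> Q) T \<subseteq> Q \<inter> Q'" using \<phi>[OF Q(1)] \<phi>[OF Q(2)] Q(3) TP[OF Q(1)] TP[OF Q(2)] by auto
          hence "card (insert (\<phi> Q) T) \<le> card (Q \<inter> Q')" using mi[OF Q(1)] by (intro card_mono) auto
          moreover have "card (insert (\<phi> Q) T) = t + 1" using \<phi>[OF Q(1)] fT cT by simp
          ultimately show "t + 2 \<le> card (Q \<inter> Q') + 1" by simp
        qed (use mi Q tn in auto)
      qed
      moreover have "\<phi> ` F i \<subseteq> A" using \<phi> by auto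
      ultimately have "card (F i) \<le> card A" using ma[OF A(1)] by (intro card_inj_on_le) auto
      thus ?thesis using ma[OF A(1)] k_bounds[OF a(1)] a(2) by simp
    qed
    obtain z1 z2 where z: "z1 \<in> A - T" "z1 \<in> P1" "z2 \<in> A - T" "z2 \<in> P2" using Ai[OF P(1)] Ai[OF P(2)] by blast
    have z12: "z1 \<noteq> z2" using z by (auto simp: T_def)
    \<comment> \<open>\<open>A\<close> meets \<open>P1\<close> and \<open>P2\<close> outside
      \<open>T\<close> in different blocks, because \<open>T\<close> is all of
      \<open>P1 \<inter> P2\<close>. Both intersections lie in every member of the remaining
      families.\<close>
    define Y where "Y = insert z1 (insert z2 T)"
    have cY: "card Y = t + 2" "finite Y" using z z12 fT cT by (auto simp: Y_def)
    have YG: "Y \<subseteq> G" if l: "l \<in> I - {a, i}" "G \<in> F l" for l G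
    proof -
      have "A \<noteq> P1" "A \<noteq> P2" using TP P A(2) by blast+
      hence "A \<inter> P1 \<subseteq> G" "A \<inter> P2 \<subseteq> G" using sp(2)[OF A(1) P(1) _ l] sp(2)[OF A(1) P(2) _ l] by blast+
      thus ?thesis using TG[OF l] z by (auto simp: Y_def)
    qed
    have leY: "card (F l) \<le> s l (t + 2)" if "l \<in> I - {a, i}" for l
      using card_F_le_star[of l Y] YG[OF that] cY that by simp
    \<comment> \<open>A member \<open>G\<close> with \<open>t + 2\<close> blocks would share
      \<open>t + 1\<close> of them with each member of \<open>F i\<close>, making \<open>P1\<close>
      and \<open>P2\<close> equal.\<close>
    have k3: "t + 3 \<le> k l" if l: "l \<in> I - {a, i}" for l
    proof (rule ccontr)
      assume "\<not> t + 3 \<le> k l"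
      hence kl: "k l = t + 2" using k_bounds[of l] l by auto
      obtain G where G: "G \<in> F l" using F_ne l by blast
      have lI: "l \<in> I" "l \<in> I - {a}" "i \<noteq> l" using l by auto
      have "Q = G" if Q: "Q \<in> F i" for Q
      proof -
        obtain H' where H': "H' \<in> traces a" "H' \<subseteq> Q \<inter> G" using trace_below[OF i(1) lI(2) Q G] lI(3) by blast
        have "t + 1 \<le> card (Q \<inter> G)"
          using large[OF H'(1)] card_mono[OF _ H'(2)] mi[OF Q] by (meson finite_Int order_trans)
        thus ?thesis using mi[OF Q] memF[OF G lI(1)] kl tn by (intro Pi_part_eqI[of Q n "t + 2" G]) auto
      qed
      thus False using P by blast
    qed
    have le: "2 * k 1 ^ 2 * s l (t + 2) \<le> s l (t + 1)" if "l \<in> I - {a, i}" for l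
      using star_bound_step[of "t + 1" "k l"] k3[OF that] k_bounds[of l] that by auto
    have one: "1 \<le> 2 * k 1 ^ 2" using K_ge_3 by simp
    have le1: "card (F l) \<le> s l (t + 1)" if "l \<in> I - {a, i}" for l
    proof -
      have "1 * s l (t + 2) \<le> 2 * k 1 ^ 2 * s l (t + 2)" using one by (rule mult_right_mono) simp
      thus ?thesis using le[OF that] leY[OF that] by linarith
    qed
    define W where "W = (\<Prod>l\<in>I - {a, i}. s l (t + 1))"
    have ZW: "Z a = W"
      using prod.remove[of "I - {a}" i "\<lambda>l. s l (t + 1)"] i s_small[OF iI(1) i(2), of "t + 1"]
      by (simp add: W_def Diff_insert2[symmetric] insert_commute)
    have Wpos: "0 < W" unfolding ZW[symmetric] by (rule Z_pos)
    obtain j where j: "j \<in> I - {a, i}" using other_index[of a i] by blast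
    define p where "p = (\<Prod>l\<in>I - {a, i}. card (F l))"
    have pW: "2 * k 1 ^ 2 * p \<le> W"
    proof -
      have "2 * k 1 ^ 2 * p = (2 * k 1 ^ 2 * card (F j)) * (\<Prod>l\<in>I - {a, i} - {j}. card (F l))"
        unfolding p_def using prod.remove[OF _ j, of "\<lambda>l. card (F l)"] by simp
      also have "\<dots> \<le> s j (t + 1) * (\<Prod>l\<in>I - {a, i} - {j}. s l (t + 1))"
      proof (intro mult_le_mono prod_mono)
        have "2 * k 1 ^ 2 * card (F j) \<le> 2 * k 1 ^ 2 * s j (t + 2)" using leY[OF j] by (rule mult_left_mono) simp
        thus "2 * k 1 ^ 2 * card (F j) \<le> s j (t + 1)" using le[OF j] by linarith
      qed (use le1 in auto)
      also have "\<dots> = W" unfolding W_def using prod.remove[OF _ j, of "\<lambda>l. s l (t + 1)"] by simp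
      finally show ?thesis .
    qed
    have Fa2: "card (F a) \<le> 2 * s a t"
    proof -
      have "F a \<subseteq> {P1, P2} \<union> (E P1 P2 \<union> star n (k a) T)"
        using typical F_sub[OF a(1)] unfolding star_def by blast
      hence "card (F a) \<le> card ({P1, P2} \<union> (E P1 P2 \<union> star n (k a) T))" using E P by (intro card_mono) auto
      also have "\<dots> \<le> card {P1, P2} + (card (E P1 P2) + card (star n (k a) T))"
        by (intro order_trans[OF card_Un_le] add_left_mono card_Un_le)
      also have "\<dots> \<le> 2 + (k 1 ^ 4 + s a t)"
      proof (intro add_mono)
        show "card {P1, P2} \<le> 2" by (simp add: card_insert_if)
        show "card (E P1 P2) \<le> k 1 ^ 4" using E(1)[OF P(1,2)] by simp
        show "card (star n (k a) T) \<le> s a t"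
          using card_star_le[of "k a" n T] fT cT k_less_n[OF a(1)] k_bounds[OF a(1)] by simp
      qed
      also have "\<dots> \<le> 2 * s a t"
      proof -
        have "k 1 ^ 4 \<le> k 1 ^ 5" using K_ge_3 by (intro power_increasing) auto
        thus ?thesis using small_base_large_tb[OF a] K4 by linarith
      qed
      finally show ?thesis .
    qed
    have "(\<Prod>l\<in>I. card (F l)) = card (F a) * (card (F i) * p)"
      unfolding prod_split[OF a(1)] p_def using prod.remove[of "I - {a}" i "\<lambda>l. card (F l)"] i
      by (simp add: Diff_insert2[symmetric] insert_commute)
    also have "\<dots> \<le> (2 * s a t) * (k 1 * p)" using Fa2 Fi by (intro mult_le_mono) auto
    finally have N: "(\<Prod>l\<in>I. card (F l)) \<le> s a t * (2 * k 1 * p)" by simp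
    \<comment> \<open>The gain \<open>2 * K^2\<close> from one remaining family exceeds the cost, a
      factor 2 from \<open>F a\<close> and \<open>K\<close> from \<open>F i\<close>.\<close>
    have "2 * k 1 * p < W"
    proof (cases "p = 0")
      case False
      have "1 * k 1 < k 1 * k 1" using K_ge_3 by (intro mult_strict_right_mono) auto
      hence "2 * k 1 * p < 2 * k 1 ^ 2 * p" using False by (simp add: power2_eq_square)
      thus ?thesis using pW by linarith
    qed (use Wpos in simp)
    hence "s a t * (2 * k 1 * p) < s a t * W" using s_pos[OF a(1)] by (rule mult_strict_left_mono)
    also have "\<dots> \<le> tb a * Z a" unfolding ZW using star_bound_le_top[of t "k a"] a(2) by (intro mult_right_mono) auto
    finally have "(\<Prod>l\<in>I. card (F l)) < tb a * Z a" using N by linarith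
    thus ?thesis by (rule bounded_if_less[OF a(1)])
  qed
qed

theorem bounded: bounded_with_extremal
proof (cases "\<forall>a\<in>I. \<exists>H\<in>traces a. card H = t")
  case True
  thus ?thesis by (intro bounded_if_traces_small) blast
next
  case False
  then obtain a where a: "a \<in> I" "\<And>H. H \<in> traces a \<Longrightarrow> card H \<noteq> t" by blast
  obtain A where A: "A \<in> F a" using F_ne[OF a(1)] by blast
  have large: "t + 1 \<le> card H" if H: "H \<in> traces a" for H
  proof -
    have "card (A \<inter> H) \<le> card H" using trace_finite[OF H] by (intro card_mono) auto
    thus ?thesis using trace_hit[OF a(1) A H] a(2)[OF H] by linarith
  qed
  show ?thesis
  proof (cases "\<forall>i\<in>I - {a}. t + 3 \<le> k i")
    case True
    thus ?thesis using bounded_if_others_large[OF a(1) large] by blast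
  next
    case False
    then obtain i where i: "i \<in> I - {a}" "k i = t + 2" using k_bounds by fastforce
    show ?thesis
    proof (cases "k a = t + 2")
      case True
      show ?thesis
      proof (cases "\<exists>H\<in>traces a. card H = t + 1")
        case 2: True
        thus ?thesis using bounded_if_base_small[OF a(1) True large _ _ i] by blast
      next
        case 2: False
        have "t + 2 \<le> card H" if "H \<in> traces a" for H using large[OF that] 2 that by fastforce
        thus ?thesis using bounded_if_others_fixed[OF a(1) True i] by blast
      qed
    next
      case False
      hence "t + 3 \<le> k a" using k_bounds[OF a(1)] by linarith
      thus ?thesis using bounded_if_base_not_small[OF a(1) large i] by blast
    qed
  qed
qed

end

theorem theorem1p6:
  fixes n r t :: nat and k :: "nat \<Rightarrow> nat" and F :: "nat \<Rightarrow> nat set set set"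
  assumes hr: "r \<ge> 3" and ht: "t \<ge> 1"
    and hmono: "\<And>i j. 1 \<le> i \<Longrightarrow> i \<le> j \<Longrightarrow> j \<le> r \<Longrightarrow> k j \<le> k i"
    and hkr: "k r \<ge> t + 2"
    and hn: "real n \<ge> 5 - real (k 1) + 2 * real (k 1) * log 2 (real (k 1))"
    and hF: "\<And>i. i \<in> {1..r} \<Longrightarrow> F i \<subseteq> Pi_part n (k i)"
    and hcross: "cross_t_intersecting r t F"
    and hnt: "non_trivial r t F"
  shows "int (\<Prod>i\<in>{1..r}. card (F i))
           \<le> ((int t + 1) * int (Stirling (n - t) (k r - t))
               - int t * int (Stirling (n - t - 1) (k r - t - 1)))
             * (\<Prod>i\<in>{1..r-1}. int (Stirling (n - t - 1) (k i - t - 1))) \<and>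
         (int (\<Prod>i\<in>{1..r}. card (F i))
           = ((int t + 1) * int (Stirling (n - t) (k r - t))
               - int t * int (Stirling (n - t - 1) (k r - t - 1)))
             * (\<Prod>i\<in>{1..r-1}. int (Stirling (n - t - 1) (k i - t - 1)))
         \<longrightarrow> (\<exists>a\<in>{1..r}. k a = k r \<and>
               (\<exists>T. card T = t + 1 \<and> (\<forall>B\<in>T. \<exists>x\<in>{1..n}. B = {x}) \<and>
                    F a = {P \<in> Pi_part n (k a). card (T \<inter> P) \<ge> t} \<and>
                    (\<forall>i\<in>{1..r} - {a}. F i = {P \<in> Pi_part n (k i). T \<subseteq> P}))))"
proof -
  have kb: "t + 2 \<le> k i \<and> k i \<le> k 1" if "i \<in> {1..r}" for i
    using hmono[of 1 i] hmono[of i r] hkr that by auto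
  have rI: "r \<in> {1..r}" using hr by simp
  interpret large_ground n "k 1"
    using kb[OF rI] ht hn by unfold_locales auto
  define Z where "Z = (\<Prod>i\<in>{1..r} - {r}. star_bound n (k i) (t + 1))"
  have sb: "star_bound n (k i) (t + 1) = Stirling (n - t - 1) (k i - t - 1)" if "i \<in> {1..r}" for i
    using kb[OF that] by (simp add: star_bound_def)
  have set_eq: "{1..r} - {r} = {1..r - 1}" by auto
  have Z: "int Z = (\<Prod>i\<in>{1..r-1}. int (Stirling (n - t - 1) (k i - t - 1)))"
    unfolding Z_def of_nat_prod set_eq[symmetric] using sb by (intro prod.cong) auto
  have top: "int (top_bound n (k r) t) = (int t + 1) * int (Stirling (n - t) (k r - t))
               - int t * int (Stirling (n - t - 1) (k r - t - 1))"
  proof -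
    have "top_bound n (k r) t + t * star_bound n (k r) (t + 1) = (t + 1) * star_bound n (k r) t"
      using kb[OF rI] by (intro top_bound_eq) auto
    hence "int (top_bound n (k r) t + t * star_bound n (k r) (t + 1)) = int ((t + 1) * star_bound n (k r) t)" by simp
    moreover have "star_bound n (k r) t = Stirling (n - t) (k r - t)" using kb[OF rI] by (simp add: star_bound_def)
    ultimately show ?thesis unfolding sb[OF rI] by (simp add: algebra_simps)
  qed
  define N where "N = (\<Prod>i\<in>{1..r}. card (F i))"
  define ext where "ext \<longleftrightarrow> (\<exists>a\<in>{1..r}. k a = k r \<and>
               (\<exists>T. card T = t + 1 \<and> (\<forall>B\<in>T. \<exists>x\<in>{1..n}. B = {x}) \<and>
                    F a = {P \<in> Pi_part n (k a). card (T \<inter> P) \<ge> t} \<and>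
                    (\<forall>i\<in>{1..r} - {a}. F i = {P \<in> Pi_part n (k i). T \<subseteq> P})))"
  \<comment> \<open>An empty family makes the product 0, strictly below the positive bound, so that
    the equality claim is vacuous; otherwise the locale applies.\<close>
  have main: "N \<le> top_bound n (k r) t * Z \<and> (N = top_bound n (k r) t * Z \<longrightarrow> ext)"
  proof (cases "\<exists>i\<in>{1..r}. F i = {}")
    case True
    then obtain i where "i \<in> {1..r}" "F i = {}" by blast
    hence N0: "N = 0" unfolding N_def by (intro prod_zero bexI[of _ i]) simp_all
    have "0 < star_bound n (k i) (t + 1)" if "i \<in> {1..r} - {r}" for i
      using kb[of i] that by (intro star_bound_pos) auto
    hence "0 < Z" unfolding Z_def by (intro prod_pos)
    moreover have "0 < star_bound n (k r) t" using kb[OF rI] by (intro star_bound_pos) auto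
    hence "0 < top_bound n (k r) t" using star_bound_le_top[of t "k r"] hkr by linarith
    ultimately show ?thesis using N0 by simp
  next
    case False
    interpret cross_families n r t k F
    proof
      show "cross_intersecting_on {1..r} t F"
        using hcross unfolding cross_t_intersecting_def cross_intersecting_on_def .
    qed (use assms False in auto)
    show ?thesis using bounded
      unfolding bounded_with_extremal_def extremal_def N_def Z_def ext_def .
  qed
  have "int N \<le> int (top_bound n (k r) t * Z) \<and> (int N = int (top_bound n (k r) t * Z) \<longrightarrow> ext)"
    unfolding of_nat_le_iff of_nat_eq_iff using main .
  thus ?thesis unfolding of_nat_mult top Z ext_def N_def .
qed

end
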